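(* Let $\mathcal{A}=\{A_i\}_{i\in \mathcal{I}}$ be a finite set of invertible $d\times d$ real matrices such that: there exists a positive diagonal matrix $A$ (diagonal with strictly positive diagonal entries) with $A_i=A$ for all $i\in\mathcal{I}$; $\|A\|<1/2$; and $\lambda(\mathcal{A})>1$. Then the following statements are true. 1. For Lebesgue almost every $\mathbf{t}\in\mathbb{R}^{\#\mathcal{I}\cdot d}$, for any sequence $\mathbf{x}\in X_{\mathbf{t}}^{\mathbb{N}}$ and any $h\in H$, the set $W(\mathcal{S}_{\mathbf{t}},\mathbf{x},h)$ has positive Lebesgue measure. 2. For Lebesgue almost every $\mathbf{t}\in\mathbb{R}^{\#\mathcal{I}\cdot d}$, for any $x\in X_{\mathbf{t}}$ and any $h\in H$ that is decaying regularly and decreasing, Lebesgue almost every $y\in X_{\mathbf{t}}$ is contained in $W(\mathcal{S}_{\mathbf{t}},x,h)$. 3. Let $U$ be an open subset of $\mathbb{R}^{\#\mathcal{I}\cdot d}$ and let $\mathbf{i}\in\mathcal{I}^{\mathbb{N}}$. Assume that $\pi_{\mathbf{t}}(\mathbf{i})\in \mathrm{int}(X_{\mathbf{t}})$ for Lebesgue almost every $\mathbf{t}\in U$. Then for Lebesgue almost every $\mathbf{t}\in U$, for any $h\in H$ that is decaying regularly and decreasing, Lebesgue almost every $x\in X_{\mathbf{t}}$ is contained in $$\left\{x: \exists\, \mathbf{j}=(j_n)_{n\ge 1}\in\mathcal{I}^{\mathbb{N}} \text{ such that }(T_{j_{n},\mathbf{t}}\circ \cdots \circ T_{j_1,\mathbf{t}})(x)\in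 B\left(\pi_{\mathbf{t}}(\mathbf{i}),\left(\frac{h(n)}{ \lambda(\mathcal{A})^{n}}\right)^{1/d}\right)\text{ for infinitely many } n\in \mathbb{N}\right\}.$$ 4. For Lebesgue almost every $\mathbf{t}\in\mathbb{R}^{\#\mathcal{I}\cdot d}$, for any $h\in H$, the set $R(\mathcal{S}_{\mathbf{t}},h)$ has positive Lebesgue measure.
   Context: $\|\cdot\|$ is the operator norm for the Euclidean norm; $B(x,r)$ is the closed Euclidean ball with centre $x$ and radius $r$. For a finite set of invertible $d\times d$ matrices $\mathcal{A}=\{A_i\}_{i\in\mathcal{I}}$ with $\|A_i\|<1$ for all $i$, let $\lambda(\mathcal{A})=\sum_{i\in\mathcal{I}}|\det(A_i)|$. For $\mathbf{t}=(t_i)_{i\in\mathcal{I}}\in(\mathbb{R}^d)^{\mathcal{I}}\cong\mathbb{R}^{\#\mathcal{I}\cdot d}$ let $\mathcal{S}_{\mathbf{t}}=\{S_{i,\mathbf{t}}\}_{i\in\mathcal{I}}$ with $S_{i,\mathbf{t}}(x)=A_ix+t_i$, let $T_{i,\mathbf{t}}=S_{i,\mathbf{t}}^{-1}$, and let $X_{\mathbf{t}}$ be the self-affine set, i.e. the unique non-empty compact set with $X_{\mathbf{t}}=\bigcup_{i\in\mathcal{I}}S_{i,\mathbf{t}}(X_{\mathbf{t}})$. The projection $\pi_{\mathbf{t}}:\mathcal{I}^{\mathbb{N}}\to X_{\mathbf{t}}$ is $\pi_{\mathbf{t}}((i_n)_{n\ge1})=\lim_{n\to\infty}(S_{i_1,\mathbf{t}}\circ\cdots\circ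 S_{i_n,\mathbf{t}})(0)$. For $\mathbf{x}=(x_n)\in X_{\mathbf{t}}^{\mathbb{N}}$ and $h:\mathbb{N}\to[0,\infty)$, $W(\mathcal{S}_{\mathbf{t}},\mathbf{x},h)$ is the set of $x\in X_{\mathbf{t}}$ such that $$(T_{i_N,\mathbf{t}}\circ\cdots\circ T_{i_1,\mathbf{t}})(x)\in B\left(x_N,\left(\frac{h(N)}{\lambda(\mathcal{A})^N}\right)^{1/d}\right)$$ for infinitely many words $(i_1,\ldots,i_N)\in\bigcup_{n\ge1}\mathcal{I}^n$. For a point $x\in X_{\mathbf{t}}$, $W(\mathcal{S}_{\mathbf{t}},x,h)$ denotes this set for the constant sequence equal to $x$. $R(\mathcal{S}_{\mathbf{t}},h)$ is the set of $x\in X_{\mathbf{t}}$ such that $(T_{i_N,\mathbf{t}}\circ\cdots\circ T_{i_1,\mathbf{t}})(x)\in B\left(x,\left(h(N)/\lambda(\mathcal{A})^N\right)^{1/d}\right)$ for infinitely many words $(i_1,\ldots,i_N)\in\bigcup_{n\ge1}\mathcal{I}^n$. For $B\subset\mathbb{N}$ the upper density is $\overline{d}(B)=\limsup_{n\to\infty}\frac{\#\{1\le j\le n:j\in B\}}{n}$. For $\epsilon>0$, $H_\epsilon$ is the set of $h:\mathbb{N}\to[0,\infty)$ such that $\sum_{n\in B}h(n)=\infty$ for every $B\subset\mathbb{N}$ with $\overline{d}(B)>1-\epsilon$, and $H=\bigcup_{\epsilon>0}H_\epsilon$. A function $h$ is decaying regularly if $\inf_{n\in\mathbb{N}}\frac{h(n+1)}{h(n)}>0$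 (in particular $h(n)>0$ for all $n$). Decreasing means $h(n+1)\le h(n)$ for all $n$. *)

theory Defs
  imports "HOL-Analysis.Analysis"
begin

text \<open>
  The index set is a finite type \<open>'i\<close>, the dimension is \<open>d = CARD('d)\<close>, and the parameter space
  is the Euclidean space \<open>(real^'d)^'i\<close> of dimension \<open>CARD('i) * CARD('d)\<close>.
  The natural numbers of the source start at 1: sequences are functions on \<^typ>\<open>nat\<close> whose value
  at 0 is never used. A word \<open>(i_1, ..., i_N)\<close> is the list \<open>[i_1, ..., i_N]\<close>.
\<close>

definition opnorm :: "real^'d^'d \<Rightarrow> real"
  where "opnorm M = onorm (\<lambda>x. M *v x)"

definition positive_diagonal :: "real^'d^'d \<Rightarrow> bool"
  where "positive_diagonal M \<longleftrightarrow> (\<forall>i j. i \<noteq> j \<longrightarrow> M $ i $ j = 0) \<and> (\<forall>i. M $ i $ i > 0)"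

definition lam :: "('i::finite \<Rightarrow> real^'d^'d) \<Rightarrow> real"
  where "lam A = (\<Sum>i\<in>UNIV. \<bar>det (A i)\<bar>)"

definition S_map :: "('i::finite \<Rightarrow> real^'d^'d) \<Rightarrow> (real^'d)^'i \<Rightarrow> 'i \<Rightarrow> real^'d \<Rightarrow> real^'d"
  where "S_map A t i x = A i *v x + t $ i"

definition T_map :: "('i::finite \<Rightarrow> real^'d^'d) \<Rightarrow> (real^'d)^'i \<Rightarrow> 'i \<Rightarrow> real^'d \<Rightarrow> real^'d"
  where "T_map A t i = inv (S_map A t i)"

text \<open>The composition \<open>S_{i_1} \<circ> ... \<circ> S_{i_N}\<close>, with \<open>S_{i_N}\<close> applied first.\<close>

definition S_word :: "('i::finite \<Rightarrow> real^'d^'d) \<Rightarrow> (real^'d)^'i \<Rightarrow> 'i list \<Rightarrow> real^'d \<Rightarrow> real^'d"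
  where "S_word A t w x = foldr (S_map A t) w x"

text \<open>The composition \<open>T_{i_N} \<circ> ... \<circ> T_{i_1}\<close>, with \<open>T_{i_1}\<close> applied first.\<close>

definition T_word :: "('i::finite \<Rightarrow> real^'d^'d) \<Rightarrow> (real^'d)^'i \<Rightarrow> 'i list \<Rightarrow> real^'d \<Rightarrow> real^'d"
  where "T_word A t w x = fold (T_map A t) w x"

definition prefix_word :: "(nat \<Rightarrow> 'i) \<Rightarrow> nat \<Rightarrow> 'i list"
  where "prefix_word j n = map j [1..<Suc n]"

text \<open>Existence and uniqueness hold when \<open>opnorm (A i) < 1\<close> for all \<open>i\<close>.\<close>

definition self_affine_set :: "('i::finite \<Rightarrow> real^'d^'d) \<Rightarrow> (real^'d)^'i \<Rightarrow> (real^'d) set"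
  where "self_affine_set A t =
    (THE X. X \<noteq> {} \<and> compact X \<and> X = (\<Union>i. S_map A t i ` X))"

definition coding_map :: "('i::finite \<Rightarrow> real^'d^'d) \<Rightarrow> (real^'d)^'i \<Rightarrow> (nat \<Rightarrow> 'i) \<Rightarrow> real^'d"
  where "coding_map A t j = lim (\<lambda>n. S_word A t (prefix_word j n) 0)"

definition radius :: "('i::finite \<Rightarrow> real^'d^'d) \<Rightarrow> (nat \<Rightarrow> real) \<Rightarrow> nat \<Rightarrow> real"
  where "radius A h n = (h n / lam A ^ n) powr (1 / real CARD('d))"

definition W_set :: "('i::finite \<Rightarrow> real^'d^'d) \<Rightarrow> (real^'d)^'i \<Rightarrow> (nat \<Rightarrow> real^'d) \<Rightarrow> (nat \<Rightarrow> real)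
    \<Rightarrow> (real^'d) set"
  where "W_set A t xs h = {x \<in> self_affine_set A t.
    infinite {w. w \<noteq> [] \<and> T_word A t w x \<in> cball (xs (length w)) (radius A h (length w))}}"

definition R_set :: "('i::finite \<Rightarrow> real^'d^'d) \<Rightarrow> (real^'d)^'i \<Rightarrow> (nat \<Rightarrow> real) \<Rightarrow> (real^'d) set"
  where "R_set A t h = {x \<in> self_affine_set A t.
    infinite {w. w \<noteq> [] \<and> T_word A t w x \<in> cball x (radius A h (length w))}}"

definition upper_density :: "nat set \<Rightarrow> ereal"
  where "upper_density B = limsup (\<lambda>n. ereal (real (card {j \<in> {1..n}. j \<in> B}) / real n))"

definition H_eps :: "real \<Rightarrow> (nat \<Rightarrow> real) set"
  where "H_eps \<epsilon> = {h. (\<forall>n\<ge>1. h n \<ge> 0) \<and>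
    (\<forall>B\<subseteq>{1..}. upper_density B > ereal (1 - \<epsilon>) \<longrightarrow> (\<Sum>\<^sub>\<infinity>n\<in>B. ennreal (h n)) = \<infinity>)}"

definition H_class :: "(nat \<Rightarrow> real) set"
  where "H_class = (\<Union>\<epsilon>\<in>{0<..}. H_eps \<epsilon>)"

definition decaying_regularly :: "(nat \<Rightarrow> real) \<Rightarrow> bool"
  where "decaying_regularly h \<longleftrightarrow> (\<forall>n\<ge>1. h n > 0) \<and> (INF n\<in>{1..}. h (n + 1) / h n) > 0"

definition decreasing :: "(nat \<Rightarrow> real) \<Rightarrow> bool"
  where "decreasing h \<longleftrightarrow> (\<forall>n\<ge>1. h (n + 1) \<le> h n)"

end

theory Submission
  imports Defs
begin

text \<open>
  Write \<open>m\<close> for the number of letters, \<open>d\<close> for the dimension, \<open>a\<^sub>k < 1/2\<close> for the diagonal entries of the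
  common linear part and \<open>\<lambda> = m \<Prod>\<^sub>k a\<^sub>k > 1\<close>. For a word \<open>w\<close> of length \<open>n\<close> the condition
  \<open>T\<^sub>w x \<in> B(z, (h(n)/\<lambda>\<^sup>n)\<^bsup>1/d\<^esup>)\<close> says that \<open>x\<close> lies in an ellipsoid with centre \<open>S\<^sub>w z\<close> and semi-axes
  \<open>a\<^sub>k\<^sup>n (h(n)/\<lambda>\<^sup>n)\<^bsup>1/d\<^esup>\<close>, whose volume is comparable to \<open>h(n)/m\<^sup>n\<close>. There are \<open>m\<^sup>n\<close> of them, so
  \<open>\<Sum> h(n) = \<infinity>\<close> is the divergence condition of a Borel-Cantelli lemma. Ellipsoids are replaced by
  coordinate boxes throughout.

  Transversality. All linear parts are equal, so \<open>S\<^sub>v z - S\<^sub>w z\<close> is the same for all \<open>z\<close> when \<open>v\<close> and \<open>w\<close>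
  have the same length. If their first letters differ, its \<open>k\<close>-th component depends on the
  translation of the first letter of \<open>v\<close> with a coefficient at least
  \<open>1 - a\<^sub>k/(1 - a\<^sub>k)\<close>, which is positive as \<open>a\<^sub>k < 1/2\<close> (lemma \<open>transversality\<close>). Cancelling
  common prefixes and summing a geometric series in \<open>\<lambda>\<close>, the expected number of pairs of words of length \<open>n\<close>
  whose images are closer than \<open>s a\<^sub>k\<^sup>n \<lambda>\<^bsup>-n/d\<^esup>\<close> in every component is \<open>O(s\<^sup>d m\<^sup>n)\<close> (\<open>sum_close_events\<close>).
  Call \<open>n\<close> a good level for \<open>t\<close> and \<open>s\<close> if there are at most \<open>m\<^sup>n/2\<close> such pairs. By Markov's inequality and Fatou's
  lemma, for almost every \<open>t\<close> the upper density of the good levels tends to 1 as \<open>s\<close> tends to 0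
  (\<open>AE_typical\<close>). Hence a function in the class \<open>H\<close> has a divergent sum over the good levels of some \<open>s\<close>.

  Positive measure. On a good level at least half of the centres are separated. Counting how many small boxes
  of level \<open>q\<close> fit into a box of level \<open>n < q\<close> shows that the unions of the boxes of different
  good levels are quasi-independent, and the Chung-Erdos inequality bounds the measure of their limsup
  from below (\<open>limsup_box_union_measure\<close>, \<open>limsup_set_measure\<close>). This gives the claim on
  \<open>W\<close>, and the claim on \<open>R\<close> with the fixed points of the maps \<open>S\<^sub>w\<close> as centres.

  Full measure. The lower bound does not change when \<open>h\<close> is replaced by \<open>h/C\<close>, so the points that belong to the limsup sets
  of \<open>h/C\<close> for all \<open>C\<close> form a set \<open>Z\<close> of positive measure. Regular decay of \<open>h\<close> puts
  \<open>S\<^sub>v Z\<close> into the limsup set of \<open>h\<close> for every word \<open>v\<close>. The sets \<open>S\<^sub>v Z\<close> together cover almost all of the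
  self-affine set: its uncovered part would be porous at every scale (\<open>X_diff_images_null\<close>). Finally, if
  the target \<open>p\<close> is an interior point, then a branch of inverse images that comes close to \<open>p\<close>
  is again in the self-affine set and can be continued to a later visit, so that one
  sequence realises infinitely many visits (\<open>AE_branch_hits\<close>).
\<close>

section \<open>Boxes and the measure of a union\<close>

definition abox :: "real^'d \<Rightarrow> ('d \<Rightarrow> real) \<Rightarrow> (real^'d) set"
  where "abox p v = {y. \<forall>k. \<bar>y $ k - p $ k\<bar> \<le> v k}"

lemma abox_eq_cbox: "abox p v = cbox (\<chi> k. p $ k - v k) (\<chi> k. p $ k + v k)"
  by (rule set_eqI) (simp add: abox_def mem_box_cart abs_diff_le_iff)

lemma abox_borel [measurable, simp]: "abox p v \<in> sets borel"
  by (simp add: abox_eq_cbox)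

lemma abox_fmeasurable [simp]: "abox p v \<in> fmeasurable lborel"
  by (simp add: abox_eq_cbox)

lemma measure_abox:
  fixes p :: "real^'d"
  assumes "\<And>k. 0 \<le> v k"
  shows "measure lborel (abox p v) = (\<Prod>k\<in>UNIV. 2 * v k)"
proof -
  have "abox p v \<noteq> {}"
    using assms by (auto simp: abox_def intro!: exI[of _ p])
  then have "measure lborel (abox p v) = (\<Prod>k\<in>UNIV. (p $ k + v k) - (p $ k - v k))"
    by (simp add: abox_eq_cbox content_cbox_cart)
  then show ?thesis by simp
qed

text \<open>Cauchy-Schwarz for the function that counts how many of the sets contain a point; it vanishes
  outside the union.\<close>

lemma chung_erdos_inequality:
  fixes E :: "'b \<Rightarrow> 'a set"
  assumes fin: "finite J" and E: "\<And>j. j \<in> J \<Longrightarrow> E j \<in> fmeasurable M"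
    and B: "(\<Sum>i\<in>J. \<Sum>j\<in>J. measure M (E i \<inter> E j)) \<le> B" and "B > 0"
  shows "(\<Sum>j\<in>J. measure M (E j))\<^sup>2 / B \<le> measure M (\<Union>j\<in>J. E j)"
proof -
  define U where "U = (\<Union>j\<in>J. E j)"
  have U: "U \<in> fmeasurable M" unfolding U_def using fin E by blast
  define S where "S = (\<Sum>j\<in>J. measure M (E j))"
  define c where "c = B / S"
  have EE: "E i \<inter> E j \<in> fmeasurable M" if "i \<in> J" "j \<in> J" for i j
    using E[OF that(1)] E[OF that(2)] by (simp add: fmeasurable_Int_fmeasurable fmeasurableD)
  have int: "integrable M (indicat_real A)" "(\<integral>x. indicat_real A x \<partial>M) = measure M A"
    if "A \<in> fmeasurable M" for A
    using that by (auto simp: fmeasurable_def integrable_indicator_iff)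

  have sq: "(\<Sum>i\<in>J. \<Sum>j\<in>J. indicat_real (E i \<inter> E j) x) = (\<Sum>i\<in>J. indicat_real (E i) x)\<^sup>2" for x
    by (simp add: power2_eq_square sum_product indicator_inter_arith)
  \<comment> \<open>Integrate \<open>0 \<le> (f - c 1_U)\<^sup>2\<close>, where \<open>f\<close> counts the sets that contain a point; \<open>c = B / S\<close> is the best choice.\<close>
  have pt: "2 * c * (\<Sum>j\<in>J. indicat_real (E j) x)
      \<le> (\<Sum>i\<in>J. \<Sum>j\<in>J. indicat_real (E i \<inter> E j) x) + c\<^sup>2 * indicat_real U x" for x
  proof (cases "x \<in> U")
    case True
    have "0 \<le> ((\<Sum>i\<in>J. indicat_real (E i) x) - c)\<^sup>2" by simp
    then show ?thesis unfolding sq using True by (simp add: power2_diff algebra_simps)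
  next
    case False
    then have "indicat_real (E j) x = 0" if "j \<in> J" for j
      using that by (auto simp: U_def)
    then have "(\<Sum>j\<in>J. indicat_real (E j) x) = 0" by simp
    then show ?thesis unfolding sq by simp
  qed
  have "2 * c * S = (\<integral>x. 2 * c * (\<Sum>j\<in>J. indicat_real (E j) x) \<partial>M)"
    unfolding S_def using int E by (subst integral_mult_right_zero, subst Bochner_Integration.integral_sum) auto
  also have "\<dots> \<le> (\<integral>x. (\<Sum>i\<in>J. \<Sum>j\<in>J. indicat_real (E i \<inter> E j) x) + c\<^sup>2 * indicat_real U x \<partial>M)"
    using int E EE U pt
    by (intro integral_mono Bochner_Integration.integrable_add Bochner_Integration.integrable_sum
        integrable_mult_right) auto
  also have "\<dots> = (\<Sum>i\<in>J. \<Sum>j\<in>J. measure M (E i \<inter> E j)) + c\<^sup>2 * measure M U"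
    using int EE U
    by (subst Bochner_Integration.integral_add)
       (auto simp: Bochner_Integration.integral_sum Bochner_Integration.integrable_sum)
  also have "\<dots> \<le> B + c\<^sup>2 * measure M U" using B by simp
  finally have main: "2 * c * S \<le> B + c\<^sup>2 * measure M U" .
  show ?thesis
  proof (cases "S = 0")
    case True
    then show ?thesis by (simp add: S_def[symmetric])
  next
    case False
    moreover have "0 \<le> S" by (simp add: S_def sum_nonneg)
    ultimately have "S > 0" by simp
    then have "2 * B \<le> B + B\<^sup>2 * measure M U / S\<^sup>2"
      using main by (simp add: c_def power_divide)
    then have "B * S\<^sup>2 \<le> B * (B * measure M U)"
      using \<open>S > 0\<close> by (simp add: field_simps power2_eq_square)
    then show ?thesis
      using \<open>B > 0\<close> by (simp add: S_def[symmetric] U_def[symmetric] field_simps)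
  qed
qed

section \<open>Limsup sets of separated boxes\<close>

lemma sum_half_powers_le:
  assumes "finite J"
  shows "(\<Sum>i\<in>J. if i \<le> j then (1/2::real) ^ (j - i) else 0) \<le> 2"
proof -
  have "(\<Sum>i\<in>J. if i \<le> j then (1/2::real) ^ (j - i) else 0) = (\<Sum>i\<in>{i \<in> J. i \<le> j}. (1/2) ^ (j - i))"
    using assms by (simp add: sum.inter_filter)
  also have "\<dots> \<le> (\<Sum>i\<in>{..j}. (1/2) ^ (j - i))"
    by (rule sum_mono2) auto
  also have "\<dots> = (\<Sum>i\<in>{..j}. (1/2) ^ i)"
    by (rule sum.reindex_bij_witness[of _ "\<lambda>i. j - i" "\<lambda>i. j - i"]) auto
  also have "\<dots> \<le> 2"
    by (simp add: sum_gp_basic  sum_gp0)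
  finally show ?thesis .
qed

lemma prod_box_sides:
  fixes \<alpha> :: "'d::finite \<Rightarrow> real"
  shows "(\<Prod>k\<in>UNIV. 2 * (r * \<alpha> k ^ n)) = (2 * r) ^ CARD('d) * (\<Prod>k\<in>UNIV. \<alpha> k) ^ n"
  by (simp add: prod.distrib prod_power_distrib power_mult_distrib)

text \<open>The boxes of half-widths \<open>v\<close> about the points are disjoint and lie in the box of half-widths
  \<open>u + v\<close> about \<open>p\<close>; compare volumes.\<close>

lemma packing_bound:
  fixes y :: "'b \<Rightarrow> real^'d"
  assumes fin: "finite J" and v: "\<And>k. 0 < v k"
    and sep: "\<And>i j. i \<in> J \<Longrightarrow> j \<in> J \<Longrightarrow> i \<noteq> j \<Longrightarrow> \<exists>k. 2 * v k < \<bar>y i $ k - y j $ k\<bar>"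
    and near: "\<And>j k. j \<in> J \<Longrightarrow> \<bar>y j $ k - p $ k\<bar> \<le> u k" and u: "\<And>k. 0 \<le> u k"
  shows "real (card J) * (\<Prod>k\<in>UNIV. 2 * v k) \<le> (\<Prod>k\<in>UNIV. 2 * (u k + v k))"
proof -
  have disj: "disjoint_family_on (\<lambda>j. abox (y j) v) J"
    unfolding disjoint_family_on_def
  proof (intro ballI impI)
    fix i j assume ij: "i \<in> J" "j \<in> J" "i \<noteq> j"
    then obtain k where k: "2 * v k < \<bar>y i $ k - y j $ k\<bar>" using sep by blast
    show "abox (y i) v \<inter> abox (y j) v = {}"
    proof (rule ccontr)
      assume "abox (y i) v \<inter> abox (y j) v \<noteq> {}"
      then obtain x where "\<bar>x $ k - y i $ k\<bar> \<le> v k" "\<bar>x $ k - y j $ k\<bar> \<le> v k"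
        by (auto simp: abox_def)
      then show False using k by linarith
    qed
  qed
  have "real (card J) * (\<Prod>k\<in>UNIV. 2 * v k) = (\<Sum>j\<in>J. measure lborel (abox (y j) v))"
    using v by (simp add: measure_abox less_imp_le)
  also have "\<dots> = measure lborel (\<Union>j\<in>J. abox (y j) v)"
    by (rule measure_finite_Union[symmetric])
       (use fin disj fmeasurableD2[OF abox_fmeasurable] in auto)
  also have "\<dots> \<le> measure lborel (abox p (\<lambda>k. u k + v k))"
  proof (rule measure_mono_fmeasurable)
    show "(\<Union>j\<in>J. abox (y j) v) \<subseteq> abox p (\<lambda>k. u k + v k)"
    proof (clarsimp simp: abox_def)
      fix x j k assume "j \<in> J" and "\<forall>k. \<bar>x $ k - y j $ k\<bar> \<le> v k"
      then show "\<bar>x $ k - p $ k\<bar> \<le> u k + v k"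
        using near[of j k] by (smt (verit))
    qed
  qed (use fin in auto)
  also have "\<dots> = (\<Prod>k\<in>UNIV. 2 * (u k + v k))"
    using u v by (subst measure_abox) (auto simp: add_nonneg_nonneg less_imp_le)
  finally show ?thesis .
qed

lemma power_add_le_two_power_mult:
  fixes u v :: real
  assumes "0 \<le> u" "0 \<le> v"
  shows "(u + v) ^ n \<le> 2 ^ n * (u ^ n + v ^ n)"
proof -
  have "(u + v) ^ n \<le> (2 * max u v) ^ n" using assms by (intro power_mono) auto
  also have "\<dots> = 2 ^ n * (max u v) ^ n" by (simp add: power_mult_distrib)
  also have "\<dots> \<le> 2 ^ n * (u ^ n + v ^ n)"
    using assms by (intro mult_left_mono) (auto simp: max_def)
  finally show ?thesis .
qed

text \<open>Taking \<open>1 / \<alpha> k ^ q\<close> out of every factor leaves factors \<open>\<alpha> k ^ q + x \<le> (1/2) ^ q + x\<close>. The geometric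
  decay in \<open>q\<close> makes up for boxes that are long in some directions and short in others: this is how
  different contraction ratios are handled.\<close>

lemma prod_one_add_le:
  fixes \<alpha> :: "'d::finite \<Rightarrow> real"
  assumes \<alpha>: "\<And>k. 0 < \<alpha> k" "\<And>k. \<alpha> k \<le> 1/2" and x: "0 \<le> x" and q: "q > 0"
  shows "(\<Prod>k\<in>UNIV. 1 + x / \<alpha> k ^ q)
    \<le> 2 ^ CARD('d) * ((1/2) ^ q + x ^ CARD('d)) / (\<Prod>k\<in>UNIV. \<alpha> k) ^ q"
proof -
  have "(\<Prod>k\<in>UNIV. 1 + x / \<alpha> k ^ q) = (\<Prod>k\<in>UNIV. (\<alpha> k ^ q + x) / \<alpha> k ^ q)"
    by (intro prod.cong refl) (use \<alpha>(1) in \<open>simp add: field_simps less_imp_neq[symmetric]\<close>)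
  also have "\<dots> = (\<Prod>k\<in>UNIV. \<alpha> k ^ q + x) / (\<Prod>k\<in>UNIV. \<alpha> k) ^ q"
    by (simp add: prod_dividef prod_power_distrib)
  also have "\<dots> \<le> (\<Prod>k\<in>(UNIV::'d set). (1/2) ^ q + x) / (\<Prod>k\<in>UNIV. \<alpha> k) ^ q"
    using \<alpha> x by (intro divide_right_mono prod_mono zero_le_power prod_nonneg conjI ballI add_mono power_mono)
      (auto simp: less_imp_le add_nonneg_nonneg)
  also have "(\<Prod>k\<in>(UNIV::'d set). (1/2) ^ q + x) = ((1/2) ^ q + x) ^ CARD('d)" by simp
  also have "\<dots> \<le> 2 ^ CARD('d) * (((1/2) ^ q) ^ CARD('d) + x ^ CARD('d))"
    using x by (intro power_add_le_two_power_mult) auto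
  also have "\<dots> \<le> 2 ^ CARD('d) * ((1/2) ^ q + x ^ CARD('d))"
  proof -
    have "((1/2::real) ^ q) ^ CARD('d) \<le> ((1/2) ^ q) ^ 1"
      by (intro power_decreasing) (auto simp: power_le_one Suc_le_eq)
    then show ?thesis by simp
  qed
  finally show ?thesis using \<alpha>(1) by (simp add: divide_right_mono prod_nonneg less_imp_le)
qed

definition box_union :: "('d::finite \<Rightarrow> real) \<Rightarrow> (nat \<Rightarrow> 'b set) \<Rightarrow> (nat \<Rightarrow> 'b \<Rightarrow> real^'d) \<Rightarrow> (nat \<Rightarrow> real) \<Rightarrow> nat \<Rightarrow> (real^'d) set"
  where "box_union \<alpha> Y y \<eta> n = (\<Union>w\<in>Y n. abox (y n w) (\<lambda>k. \<eta> n * \<alpha> k ^ n))"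

text \<open>The ratios \<open>\<alpha>\<close> are normalised so that a box with half-widths \<open>r * \<alpha> k ^ n\<close> has measure
  \<open>(2 * r) ^ d / \<mu> ^ n\<close>. On the levels in \<open>G\<close> about \<open>\<mu> ^ n\<close> such boxes are placed, and as
  \<open>\<eta> \<le> s / 2\<close> the separation of the centres makes the boxes of one level disjoint.\<close>

context
  fixes \<alpha> :: "'d::finite \<Rightarrow> real" and \<mu> s :: real
    and Y :: "nat \<Rightarrow> 'b set" and y :: "nat \<Rightarrow> 'b \<Rightarrow> real^'d" and \<eta> :: "nat \<Rightarrow> real" and G :: "nat set"
  assumes \<alpha>: "\<And>k. 0 < \<alpha> k" "\<And>k. \<alpha> k \<le> 1/2" and prod_\<alpha>: "(\<Prod>k\<in>UNIV. \<alpha> k) = 1 / \<mu>"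
    and s: "0 < s" and \<eta>: "\<And>n. 0 \<le> \<eta> n" "\<And>n. \<eta> n \<le> s / 2"
    and finY: "\<And>n. n \<in> G \<Longrightarrow> finite (Y n)"
    and cardY: "\<And>n. n \<in> G \<Longrightarrow> real (card (Y n)) \<le> \<mu> ^ n" "\<And>n. n \<in> G \<Longrightarrow> \<mu> ^ n / 2 \<le> real (card (Y n))"
    and sep: "\<And>n v w. n \<in> G \<Longrightarrow> v \<in> Y n \<Longrightarrow> w \<in> Y n \<Longrightarrow> v \<noteq> w \<Longrightarrow>
        \<exists>k. s * \<alpha> k ^ n < \<bar>y n v $ k - y n w $ k\<bar>"
begin

private abbreviation "E \<equiv> box_union \<alpha> Y y \<eta>"

lemma \<mu>_pos: "\<mu> > 0"
proof -
  have "(\<Prod>k\<in>UNIV. \<alpha> k) > 0" using \<alpha>(1) by (simp add: prod_pos)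
  then show ?thesis unfolding prod_\<alpha> by (simp add: zero_less_divide_iff)
qed

lemma measure_level_box:
  assumes "0 \<le> r"
  shows "measure lborel (abox (p::real^'d) (\<lambda>k. r * \<alpha> k ^ n)) = (2 * r) ^ CARD('d) / \<mu> ^ n"
  using assms \<alpha>(1)
  by (subst measure_abox) (auto simp: prod_box_sides prod_\<alpha> power_one_over less_imp_le)

lemma box_union_fmeasurable: "n \<in> G \<Longrightarrow> E n \<in> fmeasurable lborel"
  unfolding box_union_def using finY by (intro fmeasurable.finite_UN) auto

lemma measure_box_union:
  assumes n: "n \<in> G"
  shows "measure lborel (E n) = real (card (Y n)) * ((2 * \<eta> n) ^ CARD('d) / \<mu> ^ n)"
proof -
  have disj: "disjoint_family_on (\<lambda>w. abox (y n w) (\<lambda>k. \<eta> n * \<alpha> k ^ n)) (Y n)"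
    unfolding disjoint_family_on_def
  proof (intro ballI impI)
    fix v w assume "v \<in> Y n" "w \<in> Y n" "v \<noteq> w"
    then obtain k where k: "s * \<alpha> k ^ n < \<bar>y n v $ k - y n w $ k\<bar>" using sep n by blast
    have *: "\<eta> n * \<alpha> k ^ n + \<eta> n * \<alpha> k ^ n \<le> s * \<alpha> k ^ n"
      using \<eta>(2)[of n] \<alpha>(1)[of k] by (simp add: distrib_right[symmetric])
    show "abox (y n v) (\<lambda>k. \<eta> n * \<alpha> k ^ n) \<inter> abox (y n w) (\<lambda>k. \<eta> n * \<alpha> k ^ n) = {}"
    proof (rule ccontr)
      assume "\<not> ?thesis"
      then obtain x where "\<bar>x $ k - y n v $ k\<bar> \<le> \<eta> n * \<alpha> k ^ n" "\<bar>x $ k - y n w $ k\<bar> \<le> \<eta> n * \<alpha> k ^ n"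
        by (auto simp: abox_def)
      then show False using k * by linarith
    qed
  qed
  have "measure lborel (E n) = (\<Sum>w\<in>Y n. measure lborel (abox (y n w) (\<lambda>k. \<eta> n * \<alpha> k ^ n)))"
    unfolding box_union_def
    by (rule measure_finite_Union)
       (use finY[OF n] disj fmeasurableD2[OF abox_fmeasurable] in auto)
  also have "\<dots> = real (card (Y n)) * ((2 * \<eta> n) ^ CARD('d) / \<mu> ^ n)"
    by (simp add: measure_level_box[OF \<eta>(1)])
  finally show ?thesis .
qed

lemma measure_box_union_bounds:
  assumes n: "n \<in> G"
  shows "2 ^ CARD('d) / 2 * \<eta> n ^ CARD('d) \<le> measure lborel (E n)" "measure lborel (E n) \<le> 2 ^ CARD('d) * \<eta> n ^ CARD('d)"
proof -
  have pos: "0 \<le> (2 * \<eta> n) ^ CARD('d) / \<mu> ^ n" using \<eta>(1)[of n] \<mu>_pos by simp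
  have "\<mu> ^ n / 2 * ((2 * \<eta> n) ^ CARD('d) / \<mu> ^ n) \<le> measure lborel (E n)"
    unfolding measure_box_union[OF n] by (rule mult_right_mono[OF cardY(2)[OF n] pos])
  then show "2 ^ CARD('d) / 2 * \<eta> n ^ CARD('d) \<le> measure lborel (E n)"
    using \<mu>_pos by (simp add: power_mult_distrib)
  have "measure lborel (E n) \<le> \<mu> ^ n * ((2 * \<eta> n) ^ CARD('d) / \<mu> ^ n)"
    unfolding measure_box_union[OF n] by (rule mult_right_mono[OF cardY(1)[OF n] pos])
  then show "measure lborel (E n) \<le> 2 ^ CARD('d) * \<eta> n ^ CARD('d)"
    using \<mu>_pos by (simp add: power_mult_distrib)
qed

text \<open>The boxes of half-widths \<open>s / 2 * \<alpha> k ^ q\<close> about the centres of the boxes counted here are disjoint and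
  lie in the box of level \<open>n\<close> enlarged by \<open>s * \<alpha> k ^ q\<close>. Up to constants, the
  term with \<open>\<eta> n ^ d\<close> is what independence would give; the other one contributes a proportion of the
  \<open>\<mu> ^ (q - n)\<close> boxes that is summable over \<open>n\<close>.\<close>

lemma card_boxes_meeting:
  assumes q: "q \<in> G" and "n < q"
  defines "r \<equiv> (\<lambda>k. \<eta> n * \<alpha> k ^ n)"
  shows "real (card {w \<in> Y q. abox p r \<inter> abox (y q w) (\<lambda>k. \<eta> q * \<alpha> k ^ q) \<noteq> {}})
    \<le> 4 ^ CARD('d) * ((1/2) ^ (q - n) + \<eta> n ^ CARD('d) / s ^ CARD('d)) * \<mu> ^ (q - n)"
proof -
  let ?J = "{w \<in> Y q. abox p r \<inter> abox (y q w) (\<lambda>k. \<eta> q * \<alpha> k ^ q) \<noteq> {}}"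
  have r: "0 \<le> r k" for k using \<eta>(1)[of n] \<alpha>(1)[of k] by (simp add: r_def)
  have ap: "0 < \<alpha> k ^ i" for k i using \<alpha>(1)[of k] by simp
  have near: "\<bar>y q j $ k - p $ k\<bar> \<le> r k + s / 2 * \<alpha> k ^ q" if j: "j \<in> ?J" for j k
  proof -
    obtain x where "\<bar>x $ k - p $ k\<bar> \<le> r k" "\<bar>x $ k - y q j $ k\<bar> \<le> \<eta> q * \<alpha> k ^ q"
      using j by (auto simp: abox_def)
    moreover have "\<eta> q * \<alpha> k ^ q \<le> s / 2 * \<alpha> k ^ q"
      using \<eta>(2)[of q] ap[of k q] by (intro mult_right_mono) auto
    ultimately show ?thesis by linarith
  qed
  have "real (card ?J) * (\<Prod>k\<in>UNIV. 2 * (s / 2 * \<alpha> k ^ q))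
    \<le> (\<Prod>k\<in>UNIV. 2 * ((r k + s / 2 * \<alpha> k ^ q) + s / 2 * \<alpha> k ^ q))"
  proof (rule packing_bound[where y = "y q" and p = p])
    show "finite ?J" using finY[OF q] by simp
    show "0 < s / 2 * \<alpha> k ^ q" for k using s ap[of k q] by simp
    show "\<exists>k. 2 * (s / 2 * \<alpha> k ^ q) < \<bar>y q i $ k - y q j $ k\<bar>" if "i \<in> ?J" "j \<in> ?J" "i \<noteq> j" for i j
      using sep[OF q, of i j] that by auto
    show "0 \<le> r k + s / 2 * \<alpha> k ^ q" for k using r[of k] s ap[of k q] by simp
  qed (rule near)
  moreover have "(\<Prod>k\<in>UNIV. 2 * ((r k + s / 2 * \<alpha> k ^ q) + s / 2 * \<alpha> k ^ q))
     \<le> (\<Prod>k\<in>UNIV. 2 * (s / 2 * \<alpha> k ^ q)) * (2 ^ CARD('d) * (\<Prod>k\<in>UNIV. 1 + \<eta> n / s / \<alpha> k ^ (q - n)))"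
  proof -
    have "(\<Prod>k\<in>UNIV. 2 * (s / 2 * \<alpha> k ^ q)) * (2 ^ CARD('d) * (\<Prod>k\<in>UNIV. 1 + \<eta> n / s / \<alpha> k ^ (q - n)))
      = (\<Prod>k\<in>UNIV. 2 * (s / 2 * \<alpha> k ^ q) * (2 * (1 + \<eta> n / s / \<alpha> k ^ (q - n))))"
      by (simp only: prod.distrib prod_constant)
    moreover have "2 * (s / 2 * \<alpha> k ^ q) * (2 * (1 + \<eta> n / s / \<alpha> k ^ (q - n)))
        = 2 * ((r k + s / 2 * \<alpha> k ^ q) + s / 2 * \<alpha> k ^ q)" for k
    proof -
      have "\<alpha> k ^ q = \<alpha> k ^ n * \<alpha> k ^ (q - n)"
        using \<open>n < q\<close> by (simp add: power_add[symmetric])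
      then show ?thesis using ap[of k "q - n"] s \<alpha>(1)[of k] by (simp add: r_def field_simps)
    qed
    ultimately show ?thesis by simp
  qed
  ultimately have "real (card ?J) * (\<Prod>k\<in>UNIV. 2 * (s / 2 * \<alpha> k ^ q))
     \<le> (2 ^ CARD('d) * (\<Prod>k\<in>UNIV. 1 + \<eta> n / s / \<alpha> k ^ (q - n))) * (\<Prod>k\<in>UNIV. 2 * (s / 2 * \<alpha> k ^ q))"
    by (simp add: mult.commute)
  moreover have "(\<Prod>k\<in>UNIV. 2 * (s / 2 * \<alpha> k ^ q)) > 0"
    using s ap by (intro prod_pos) auto
  ultimately have "real (card ?J) \<le> 2 ^ CARD('d) * (\<Prod>k\<in>UNIV. 1 + \<eta> n / s / \<alpha> k ^ (q - n))"
    by (rule mult_right_le_imp_le)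
  also have "\<dots> \<le> 2 ^ CARD('d) * (2 ^ CARD('d) * ((1/2) ^ (q - n) + (\<eta> n / s) ^ CARD('d)) / (\<Prod>k\<in>UNIV. \<alpha> k) ^ (q - n))"
    using \<alpha> \<eta>(1)[of n] s \<open>n < q\<close> by (intro mult_left_mono prod_one_add_le) auto
  also have "\<dots> = 4 ^ CARD('d) * ((1/2) ^ (q - n) + \<eta> n ^ CARD('d) / s ^ CARD('d)) * \<mu> ^ (q - n)"
    by (simp add: prod_\<alpha> power_divide field_simps flip: power_mult_distrib)
  finally show ?thesis .
qed

lemma measure_box_union_inter:
  assumes n: "n \<in> G" and q: "q \<in> G" and nq: "n < q"
  shows "measure lborel (E n \<inter> E q) \<le> 8 ^ CARD('d) * \<eta> q ^ CARD('d) * ((1/2) ^ (q - n) + \<eta> n ^ CARD('d) / s ^ CARD('d))"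
proof -
  let ?B = "\<lambda>n w. abox (y n w) (\<lambda>k. \<eta> n * \<alpha> k ^ n)"
  let ?J = "\<lambda>v. {w \<in> Y q. ?B n v \<inter> ?B q w \<noteq> {}}"
  let ?c = "4 ^ CARD('d) * ((1/2) ^ (q - n) + \<eta> n ^ CARD('d) / s ^ CARD('d)) * \<mu> ^ (q - n)"
  have c0: "0 \<le> ?c" using \<eta>(1)[of n] s \<mu>_pos by simp
  have "E n \<inter> E q = (\<Union>v\<in>Y n. \<Union>w\<in>?J v. ?B n v \<inter> ?B q w)"
    by (auto simp: box_union_def)
  then have "measure lborel (E n \<inter> E q) \<le> (\<Sum>v\<in>Y n. measure lborel (\<Union>w\<in>?J v. ?B n v \<inter> ?B q w))"
    using finY[OF n] finY[OF q] by (simp add: measure_UNION_le fmeasurableD)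
  also have "\<dots> \<le> (\<Sum>v\<in>Y n. \<Sum>w\<in>?J v. measure lborel (?B n v \<inter> ?B q w))"
    using finY[OF q] by (intro sum_mono measure_UNION_le) auto
  also have "\<dots> \<le> (\<Sum>v\<in>Y n. \<Sum>w\<in>?J v. (2 * \<eta> q) ^ CARD('d) / \<mu> ^ q)"
  proof (intro sum_mono)
    fix v w
    have "measure lborel (?B n v \<inter> ?B q w) \<le> measure lborel (?B q w)"
      by (rule measure_mono_fmeasurable) auto
    then show "measure lborel (?B n v \<inter> ?B q w) \<le> (2 * \<eta> q) ^ CARD('d) / \<mu> ^ q"
      by (simp add: measure_level_box[OF \<eta>(1)])
  qed
  also have "\<dots> = (\<Sum>v\<in>Y n. real (card (?J v)) * ((2 * \<eta> q) ^ CARD('d) / \<mu> ^ q))" by simp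
  also have "\<dots> \<le> (\<Sum>v\<in>Y n. ?c * ((2 * \<eta> q) ^ CARD('d) / \<mu> ^ q))"
    using \<eta>(1)[of q] \<mu>_pos by (intro sum_mono mult_right_mono card_boxes_meeting q nq) auto
  also have "\<dots> = real (card (Y n)) * (?c * ((2 * \<eta> q) ^ CARD('d) / \<mu> ^ q))" by simp
  also have "\<dots> \<le> \<mu> ^ n * (?c * ((2 * \<eta> q) ^ CARD('d) / \<mu> ^ q))"
    using \<eta>(1)[of q] \<mu>_pos c0 by (intro mult_right_mono cardY(1) n) auto
  also have "\<dots> = 8 ^ CARD('d) * \<eta> q ^ CARD('d) * ((1/2) ^ (q - n) + \<eta> n ^ CARD('d) / s ^ CARD('d))"
  proof -
    have "\<mu> ^ q = \<mu> ^ n * \<mu> ^ (q - n)" using nq by (simp add: power_add[symmetric])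
    moreover have "(8::real) ^ CARD('d) = 4 ^ CARD('d) * 2 ^ CARD('d)" by (simp flip: power_mult_distrib)
    ultimately show ?thesis using \<mu>_pos by (simp add: power_mult_distrib)
  qed
  finally show ?thesis .
qed

text \<open>The error terms and the diagonal contribute only a multiple of \<open>\<Sum>\<^sub>j \<eta> j ^ d\<close>, which the square dominates
  once the sum is at least 1.\<close>

lemma sum_measure_box_union_inter:
  assumes J: "finite J" "J \<subseteq> G" and A1: "1 \<le> (\<Sum>j\<in>J. \<eta> j ^ CARD('d))"
  shows "(\<Sum>i\<in>J. \<Sum>j\<in>J. measure lborel (E i \<inter> E j))
    \<le> 8 ^ CARD('d) * (4 + 1 / s ^ CARD('d)) * (\<Sum>j\<in>J. \<eta> j ^ CARD('d))\<^sup>2"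
proof -
  define A where "A = (\<Sum>j\<in>J. \<eta> j ^ CARD('d))"
  let ?f = "\<lambda>i j. if i \<le> j then (1/2::real) ^ (j - i) else 0"
  have e0: "0 \<le> \<eta> i ^ CARD('d)" for i using \<eta>(1)[of i] by simp
  have upper: "measure lborel (E i \<inter> E j)
      \<le> 8 ^ CARD('d) * (\<eta> j ^ CARD('d) * ?f i j + \<eta> i ^ CARD('d) * ?f j i + \<eta> i ^ CARD('d) * \<eta> j ^ CARD('d) / s ^ CARD('d))"
    if "i \<in> J" "j \<in> J" "i < j" for i j
  proof -
    have "measure lborel (E i \<inter> E j)
        \<le> 8 ^ CARD('d) * \<eta> j ^ CARD('d) * ((1/2) ^ (j - i) + \<eta> i ^ CARD('d) / s ^ CARD('d))"
      using that J(2) by (intro measure_box_union_inter) auto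
    also have "\<dots> = 8 ^ CARD('d) * (\<eta> j ^ CARD('d) * ?f i j + \<eta> i ^ CARD('d) * ?f j i
        + \<eta> i ^ CARD('d) * \<eta> j ^ CARD('d) / s ^ CARD('d))"
      using that by (simp add: algebra_simps)
    finally show ?thesis .
  qed
  have pair: "measure lborel (E i \<inter> E j)
      \<le> 8 ^ CARD('d) * (\<eta> j ^ CARD('d) * ?f i j + \<eta> i ^ CARD('d) * ?f j i + \<eta> i ^ CARD('d) * \<eta> j ^ CARD('d) / s ^ CARD('d))"
    if ij: "i \<in> J" "j \<in> J" for i j
  proof (cases i j rule: linorder_cases)
    case less with ij show ?thesis by (rule upper)
  next
    case equal
    have "measure lborel (E i) \<le> 2 ^ CARD('d) * \<eta> i ^ CARD('d)" using measure_box_union_bounds(2)[of i] ij J by auto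
    also have "\<dots> \<le> 8 ^ CARD('d) * \<eta> i ^ CARD('d)" using e0 by (intro mult_right_mono power_mono) auto
    also have "\<dots> \<le> 8 ^ CARD('d) * (\<eta> i ^ CARD('d) + \<eta> i ^ CARD('d) + \<eta> i ^ CARD('d) * \<eta> i ^ CARD('d) / s ^ CARD('d))"
      using e0[of i] s by (intro mult_left_mono) auto
    finally show ?thesis using equal by simp
  next
    case greater
    then show ?thesis using upper[of j i] ij by (simp add: Int_commute algebra_simps)
  qed
  have S1: "(\<Sum>i\<in>J. \<Sum>j\<in>J. \<eta> j ^ CARD('d) * ?f i j) \<le> 2 * A"
  proof -
    have "(\<Sum>i\<in>J. \<Sum>j\<in>J. \<eta> j ^ CARD('d) * ?f i j) = (\<Sum>j\<in>J. \<eta> j ^ CARD('d) * (\<Sum>i\<in>J. ?f i j))"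
      by (subst sum.swap) (simp add: sum_distrib_left)
    also have "\<dots> \<le> (\<Sum>j\<in>J. \<eta> j ^ CARD('d) * 2)"
      by (intro sum_mono mult_left_mono sum_half_powers_le J e0)
    finally show ?thesis by (simp add: A_def sum_distrib_left mult.commute)
  qed
  have S2: "(\<Sum>i\<in>J. \<Sum>j\<in>J. \<eta> i ^ CARD('d) * ?f j i) \<le> 2 * A"
    using S1 by (subst sum.swap) simp
  have S3: "(\<Sum>i\<in>J. \<Sum>j\<in>J. \<eta> i ^ CARD('d) * \<eta> j ^ CARD('d) / s ^ CARD('d)) = A\<^sup>2 / s ^ CARD('d)"
    by (simp add: A_def power2_eq_square sum_product sum_divide_distrib)
  have "(\<Sum>i\<in>J. \<Sum>j\<in>J. measure lborel (E i \<inter> E j))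
    \<le> (\<Sum>i\<in>J. \<Sum>j\<in>J. 8 ^ CARD('d) * (\<eta> j ^ CARD('d) * ?f i j + \<eta> i ^ CARD('d) * ?f j i + \<eta> i ^ CARD('d) * \<eta> j ^ CARD('d) / s ^ CARD('d)))"
    by (intro sum_mono pair)
  also have "\<dots> = 8 ^ CARD('d) * ((\<Sum>i\<in>J. \<Sum>j\<in>J. \<eta> j ^ CARD('d) * ?f i j) + (\<Sum>i\<in>J. \<Sum>j\<in>J. \<eta> i ^ CARD('d) * ?f j i) + A\<^sup>2 / s ^ CARD('d))"
    by (simp only: sum_distrib_left[symmetric] sum.distrib S3)
  also have "\<dots> \<le> 8 ^ CARD('d) * (2 * A + 2 * A + A\<^sup>2 / s ^ CARD('d))"
    using S1 S2 by (intro mult_left_mono add_mono) auto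
  also have "\<dots> \<le> 8 ^ CARD('d) * (4 * A\<^sup>2 + A\<^sup>2 / s ^ CARD('d))"
  proof -
    have "A * 1 \<le> A * A" using A1 by (intro mult_left_mono) (auto simp: A_def)
    then show ?thesis by (simp add: power2_eq_square)
  qed
  also have "\<dots> = 8 ^ CARD('d) * (4 + 1 / s ^ CARD('d)) * A\<^sup>2" by (simp add: algebra_simps)
  finally show ?thesis unfolding A_def .
qed

text \<open>Every tail of the divergent series contains a finite block with sum at least 1, and quasi-independence on
  this block bounds the measure of the tail union. The bound depends only on the dimension and \<open>s\<close>, in
  particular not on the sizes \<open>\<eta>\<close>.\<close>

lemma limsup_box_union_measure:
  assumes bdd: "\<And>n w k. n \<in> G \<Longrightarrow> w \<in> Y n \<Longrightarrow> \<bar>y n w $ k\<bar> \<le> R"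
    and div: "\<not> summable (\<lambda>n. if n \<in> G then \<eta> n ^ CARD('d) else 0)"
  shows "ennreal ((2 ^ CARD('d) / 2)\<^sup>2 / (8 ^ CARD('d) * (4 + 1 / s ^ CARD('d))))
    \<le> emeasure lborel {x. \<exists>\<^sub>\<infinity>n. n \<in> G \<and> x \<in> E n}"
proof -
  let ?c = "(2 ^ CARD('d) / 2)\<^sup>2 / (8 ^ CARD('d) * (4 + 1 / s ^ CARD('d)))"
  define U where "U N = (\<Union>n\<in>G \<inter> {N..}. E n)" for N
  have Emeas: "n \<in> G \<Longrightarrow> E n \<in> sets lborel" for n
    using fmeasurableD[OF box_union_fmeasurable] .
  have Umeas: "U N \<in> sets lborel" for N
    unfolding U_def using Emeas by blast
  have Usub: "U N \<subseteq> abox 0 (\<lambda>k. R + s / 2)" for N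
  proof (clarsimp simp: U_def box_union_def abox_def)
    fix n x w k assume n: "n \<in> G" "w \<in> Y n" and x: "\<forall>k. \<bar>x $ k - y n w $ k\<bar> \<le> \<eta> n * \<alpha> k ^ n"
    have "\<eta> n * \<alpha> k ^ n \<le> s / 2 * 1"
      using \<eta>[of n] \<alpha>(1)[of k] \<alpha>(2)[of k] s by (intro mult_mono) (auto simp: power_le_one)
    then show "\<bar>x $ k\<bar> \<le> R + s / 2" using bdd[OF n, of k] x[rule_format, of k] by linarith
  qed
  have "emeasure lborel (abox (0::real^'d) (\<lambda>k. R + s / 2)) < \<infinity>"
    using abox_fmeasurable by (auto simp: fmeasurable_def)
  then have Ufin: "emeasure lborel (U N) \<noteq> \<infinity>" for N
    using emeasure_mono[OF Usub, of lborel N] by (auto simp: top_unique)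
  have low: "ennreal ?c \<le> emeasure lborel (U N)" for N
  proof -
    let ?h = "\<lambda>n. if n \<in> G then \<eta> n ^ CARD('d) else 0"
    have h0: "0 \<le> ?h n" for n using \<eta>(1)[of n] by simp
    have "\<not> summable (\<lambda>n. ?h (n + N))" using div by (subst summable_iff_shift)
    then have "\<not> (\<forall>M. (\<Sum>n<M. ?h (n + N)) \<le> 1)"
      using h0 by (metis (no_types, lifting) summableI_nonneg_bounded)
    then obtain M where M: "1 < (\<Sum>n<M. ?h (n + N))" by (auto simp: not_le)
    define J where "J = G \<inter> {N..<M + N}"
    have J: "finite J" "J \<subseteq> G" by (auto simp: J_def)
    have "(\<Sum>n<M. ?h (n + N)) = (\<Sum>n\<in>{N..<M + N}. ?h n)"
      using sum.shift_bounds_nat_ivl[of ?h 0 N M] by (simp add: lessThan_atLeast0)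
    also have "\<dots> = (\<Sum>n\<in>J. \<eta> n ^ CARD('d))"
      by (simp add: J_def sum.inter_restrict[symmetric] Int_commute)
    finally have A: "1 \<le> (\<Sum>n\<in>J. \<eta> n ^ CARD('d))" using M by simp
    define A where "A = (\<Sum>n\<in>J. \<eta> n ^ CARD('d))"
    have Apos: "A \<ge> 1" using A by (simp add: A_def)
    have "?c = (2 ^ CARD('d) / 2 * A)\<^sup>2 / (8 ^ CARD('d) * (4 + 1 / s ^ CARD('d)) * A\<^sup>2)"
      using Apos by (simp only: power_mult_distrib mult_divide_mult_cancel_right power_eq_0_iff) simp
    also have "\<dots> \<le> (\<Sum>j\<in>J. measure lborel (E j))\<^sup>2 / (8 ^ CARD('d) * (4 + 1 / s ^ CARD('d)) * A\<^sup>2)"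
    proof (intro divide_right_mono power_mono)
      show "2 ^ CARD('d) / 2 * A \<le> (\<Sum>j\<in>J. measure lborel (E j))"
        unfolding A_def sum_distrib_left using J by (intro sum_mono measure_box_union_bounds) auto
      show "0 \<le> 2 ^ CARD('d) / 2 * A" using Apos by simp
      show "0 \<le> 8 ^ CARD('d) * (4 + 1 / s ^ CARD('d)) * A\<^sup>2" using s by simp
    qed
    also have "\<dots> \<le> measure lborel (\<Union>j\<in>J. E j)"
    proof (rule chung_erdos_inequality)
      show "(\<Sum>i\<in>J. \<Sum>j\<in>J. measure lborel (E i \<inter> E j)) \<le> 8 ^ CARD('d) * (4 + 1 / s ^ CARD('d)) * A\<^sup>2"
        unfolding A_def by (rule sum_measure_box_union_inter[OF J A])
      show "0 < 8 ^ CARD('d) * (4 + 1 / s ^ CARD('d)) * A\<^sup>2"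
        using s Apos by (intro mult_pos_pos) (auto intro: add_pos_pos)
    qed (use J box_union_fmeasurable in auto)
    finally have "ennreal ?c \<le> ennreal (measure lborel (\<Union>j\<in>J. E j))" by (rule ennreal_leI)
    also have "\<dots> = emeasure lborel (\<Union>j\<in>J. E j)"
      by (rule emeasure_eq_measure2[symmetric])
         (use J box_union_fmeasurable in \<open>blast intro: fmeasurable.finite_UN\<close>)
    also have "\<dots> \<le> emeasure lborel (U N)"
      by (rule emeasure_mono[OF _ Umeas]) (auto simp: U_def J_def)
    finally show ?thesis .
  qed
  have "ennreal ?c \<le> (INF N. emeasure lborel (U N))" using low by (rule INF_greatest)
  also have "\<dots> = emeasure lborel (\<Inter>N. U N)"
    by (rule INF_emeasure_decseq) (use Umeas Ufin in \<open>auto simp: decseq_def U_def\<close>)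
  also have "(\<Inter>N. U N) = {x. \<exists>\<^sub>\<infinity>n. n \<in> G \<and> x \<in> E n}"
    by (auto simp: U_def INFM_nat_le)
  finally show ?thesis .
qed

end

section \<open>Diagonal affine images and porous sets\<close>

lemma emeasure_diagonal_affine_image:
  fixes c b :: "real^'d" and Z :: "(real^'d) set"
  assumes c: "\<And>k. 0 < c $ k" and Z: "Z \<in> sets borel"
  defines "T \<equiv> \<lambda>x. (\<chi> k. c $ k * x $ k + b $ k)"
  shows "T ` Z \<in> sets borel"
    and "emeasure lborel (T ` Z) = ennreal (\<Prod>k\<in>UNIV. c $ k) * emeasure lborel Z"
proof -
  define T' where "T' = (\<lambda>y. \<chi> k. (y $ k - b $ k) / c $ k)"
  have TT': "T (T' x) = x" "T' (T x) = x" for x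
    using c by (auto simp: T_def T'_def vec_eq_iff less_imp_neq[symmetric])
  have im: "T ` Z = T' -` Z" using TT' by (auto simp: image_iff) metis
  have "continuous_on UNIV T'"
    unfolding T'_def using c by (intro continuous_intros) (auto simp: less_imp_neq[symmetric])
  then have "T' \<in> borel_measurable borel" by (rule borel_measurable_continuous_onI)
  then show TZ: "T ` Z \<in> sets borel" unfolding im using Z by (simp add: measurable_sets_borel)
  have BasisE: "(Basis :: (real^'d) set) = range (\<lambda>k. axis k 1)" by (auto simp: Basis_vec_def)
  have inj: "inj (\<lambda>k::'d. axis k (1::real))" by (auto simp: inj_def axis_eq_axis)
  have T_eq: "T = (\<lambda>x. b + (\<Sum>j\<in>Basis. ((c \<bullet> j) * (x \<bullet> j)) *\<^sub>R j))"
  proof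
    fix x
    have "b + (\<Sum>j\<in>Basis. ((c \<bullet> j) * (x \<bullet> j)) *\<^sub>R j)
        = b + (\<Sum>j\<in>Basis. ((\<chi> k. c $ k * x $ k) \<bullet> j) *\<^sub>R j)"
      by (auto intro!: sum.cong simp: BasisE inner_axis)
    also have "\<dots> = b + (\<chi> k. c $ k * x $ k)" by (simp only: euclidean_representation)
    finally show "T x = b + (\<Sum>j\<in>Basis. ((c \<bullet> j) * (x \<bullet> j)) *\<^sub>R j)"
      by (simp add: T_def vec_eq_iff)
  qed
  have "lborel = density (distr lborel borel T) (\<lambda>_. (\<Prod>j\<in>Basis. \<bar>c \<bullet> j\<bar>))"
    unfolding T_eq by (rule lborel_affine_euclidean) (use c in \<open>auto simp: BasisE inner_axis less_imp_neq[symmetric]\<close>)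
  moreover have "(\<Prod>j\<in>Basis. \<bar>c \<bullet> j\<bar>) = (\<Prod>k\<in>UNIV. c $ k)"
    using c by (simp add: BasisE prod.reindex[OF inj] inner_axis abs_of_pos)
  ultimately have L: "lborel = density (distr lborel borel T) (\<lambda>_. ennreal (\<Prod>k\<in>UNIV. c $ k))" by simp
  have "continuous_on UNIV T" unfolding T_def by (intro continuous_intros)
  then have Tm: "T \<in> borel_measurable borel" by (rule borel_measurable_continuous_onI)
  have "T -` T ` Z = Z" using TT' by (metis (no_types, lifting) inj_on_inverseI inj_vimage_image_eq)
  then show "emeasure lborel (T ` Z) = ennreal (\<Prod>k\<in>UNIV. c $ k) * emeasure lborel Z"
    using TZ Tm by (subst L) (simp add: emeasure_density nn_integral_cmult emeasure_distr)
qed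

text \<open>The sets \<open>P k\<close> may become arbitrarily eccentric, so Lebesgue's density theorem for balls
  does not apply. Instead, take a compact \<open>K \<subseteq> N\<close> with at least half of the measure and an open \<open>U \<supseteq> N\<close> with
  \<open>U - N\<close> of tiny measure. For small \<open>P k\<close>, each \<open>y \<in> K\<close> sees at least the proportion \<open>c\<close> of \<open>y + P k\<close> in
  \<open>U - N\<close>; averaged over \<open>y\<close>, this contradicts the smallness of \<open>U - N\<close>.\<close>

lemma null_set_if_uniformly_porous:
  fixes N :: "'a::euclidean_space set" and P :: "nat \<Rightarrow> 'a set"
  assumes N: "N \<in> sets borel" "bounded N" and c: "0 < c"
    and P: "\<And>k. P k \<in> sets borel" "\<And>k. emeasure lborel (P k) \<noteq> 0" "\<And>k. emeasure lborel (P k) \<noteq> \<infinity>"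
    and small: "\<And>e. 0 < e \<Longrightarrow> \<exists>k. P k \<subseteq> ball 0 e"
    and porous: "\<And>k y. y \<in> N \<Longrightarrow>
      ennreal c * emeasure lborel (P k) \<le> emeasure lborel {u \<in> P k. y + u \<notin> N}"
  shows "N \<in> null_sets lborel"
proof (rule ccontr)
  assume "N \<notin> null_sets lborel"
  then have Npos: "emeasure lborel N \<noteq> 0" using N by (auto simp: null_sets_def)
  have Nfin: "emeasure lborel N \<noteq> \<infinity>" using emeasure_bounded_finite[OF N(2)] by simp
  define M where "M = measure lborel N"
  have M: "emeasure lborel N = ennreal M" "M > 0"
    using Npos Nfin emeasure_eq_ennreal_measure[of lborel N] measure_nonneg[of lborel N]
    by (auto simp: M_def less_le)
  obtain K where K: "closed K" "K \<subseteq> N" "N - K \<in> lmeasurable" "emeasure lebesgue (N - K) < ennreal (M / 2)"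
    using sets_lebesgue_inner_closed[of N "M / 2"] N M by auto
  have cK: "compact K" using K N(2) by (meson bounded_subset compact_eq_bounded_closed)
  have Kb: "K \<in> sets borel" using K(1) by (rule borel_closed)
  have Kbig: "ennreal (M / 2) \<le> emeasure lborel K"
  proof (rule ccontr)
    assume "\<not> ?thesis"
    then have lt: "emeasure lborel K < ennreal (M / 2)" by simp
    have "emeasure lborel N = emeasure lborel (N - K) + emeasure lborel K"
      using K N Kb by (subst plus_emeasure) (auto intro!: arg_cong[where f="emeasure lborel"])
    also have "\<dots> < ennreal (M / 2) + ennreal (M / 2)"
      using K(4) lt N Kb by (intro add_strict_mono) (simp_all add: )
    also have "\<dots> = ennreal M" using M(2) by (simp flip: ennreal_plus)
    finally show False using M by simp
  qed
  obtain U where U: "open U" "N \<subseteq> U" "emeasure lborel (U - N) < ennreal (c * (M / 2))"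
    using outer_regular_lborel[OF N(1), of "c * (M / 2)"] c M by auto
  have Ub: "U - N \<in> sets borel" using U(1) N(1) by auto
  obtain e where e: "e > 0" "(\<Union>x\<in>K. ball x e) \<subseteq> U"
    using compact_subset_open_imp_ball_epsilon_subset[OF cK U(1)] K(2) U(2) by blast
  obtain k where k: "P k \<subseteq> ball 0 e" using small e(1) by blast
  note [measurable] = P(1)[of k] Ub Kb
  define Q where "Q = emeasure lborel (P k)"
  \<comment> \<open>Count the pairs \<open>(y, u)\<close> with \<open>y \<in> K\<close>, \<open>u \<in> P k\<close> and \<open>y + u \<in> U - N\<close> in both orders.\<close>
  have "ennreal (c * (M / 2)) * Q = ennreal c * Q * ennreal (M / 2)"
    using ennreal_mult[of c "M / 2"] c M(2) by (simp only: less_imp_le mult_ac)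
  also have "\<dots> \<le> ennreal c * Q * emeasure lborel K"
    using Kbig by (rule mult_left_mono) simp
  also have "\<dots> = (\<integral>\<^sup>+ y. ennreal c * Q * indicator K y \<partial>lborel)"
    using Kb by (simp add: nn_integral_cmult_indicator)
  also have "\<dots> \<le> (\<integral>\<^sup>+ y. (\<integral>\<^sup>+ u. indicator K y * indicator (P k) u * indicator (U - N) (y + u) \<partial>lborel) \<partial>lborel)"
  proof (rule nn_integral_mono)
    fix y
    show "ennreal c * Q * indicator K y
      \<le> (\<integral>\<^sup>+ u. indicator K y * indicator (P k) u * indicator (U - N) (y + u) \<partial>lborel)"
    proof (cases "y \<in> K")
      case True
      have "ennreal c * Q \<le> emeasure lborel {u \<in> P k. y + u \<notin> N}"
        unfolding Q_def using porous True K(2) by blast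
      also have "{u \<in> P k. y + u \<notin> N} = {u \<in> P k. y + u \<in> U - N}"
        using k e(2) True by (fastforce simp: dist_norm)
      also have "emeasure lborel \<dots> = (\<integral>\<^sup>+ u. indicator {u \<in> P k. y + u \<in> U - N} u \<partial>lborel)"
        by (rule nn_integral_indicator[symmetric]) measurable
      also have "\<dots> = (\<integral>\<^sup>+ u. indicator K y * indicator (P k) u * indicator (U - N) (y + u) \<partial>lborel)"
        using True by (intro nn_integral_cong) (auto simp: indicator_def)
      finally show ?thesis using True by simp
    qed simp
  qed
  also have "\<dots> = (\<integral>\<^sup>+ u. (\<integral>\<^sup>+ y. indicator K y * indicator (P k) u * indicator (U - N) (y + u) \<partial>lborel) \<partial>lborel)"
    by (rule lborel_pair.Fubini') measurable
  also have "\<dots> \<le> (\<integral>\<^sup>+ u. emeasure lborel (U - N) * indicator (P k) u \<partial>lborel)"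
  proof (rule nn_integral_mono)
    fix u
    have "(\<integral>\<^sup>+ y. indicator K y * indicator (P k) u * indicator (U - N) (y + u) \<partial>lborel)
      \<le> (\<integral>\<^sup>+ y. indicator (P k) u * indicator (U - N) (u + y) \<partial>lborel)"
      by (rule nn_integral_mono) (auto simp: indicator_def add.commute)
    also have "\<dots> = indicator (P k) u * (\<integral>\<^sup>+ y. indicator (U - N) (u + y) \<partial>lborel)"
      by (rule nn_integral_cmult) measurable
    also have "(\<integral>\<^sup>+ y. indicator (U - N) (u + y) \<partial>lborel) = (\<integral>\<^sup>+ y. indicator (U - N) y \<partial>distr lborel borel ((+) u))"
      by (subst nn_integral_distr) auto
    also have "\<dots> = emeasure lborel (U - N)" using Ub by (simp add: lborel_distr_plus)
    finally show "(\<integral>\<^sup>+ y. indicator K y * indicator (P k) u * indicator (U - N) (y + u) \<partial>lborel)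
      \<le> emeasure lborel (U - N) * indicator (P k) u" by (simp add: mult.commute)
  qed
  also have "\<dots> = emeasure lborel (U - N) * Q" by (simp add: nn_integral_cmult_indicator Q_def)
  finally have "ennreal (c * (M / 2)) * Q \<le> emeasure lborel (U - N) * Q" .
  then have "ennreal (c * (M / 2)) \<le> emeasure lborel (U - N)"
    using P(2,3)[of k] by (simp add: Q_def ennreal_mult_le_mult_iff mult.commute)
  then show False using U(3) by simp
qed

section \<open>Components, words and series\<close>

lemma closed_approximable:
  fixes Y :: "(real^'d) set" and x :: "real^'d"
  assumes "closed Y" and "\<And>e. 0 < e \<Longrightarrow> \<exists>y\<in>Y. \<forall>k. \<bar>x $ k - y $ k\<bar> \<le> e"
  shows "x \<in> Y"
proof -
  have "x \<in> closure Y"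
    unfolding closure_approachable
  proof (intro allI impI)
    fix e :: real assume "0 < e"
    then have "0 < e / (2 * real CARD('d))" by simp
    then obtain y where y: "y \<in> Y" "\<forall>k. \<bar>x $ k - y $ k\<bar> \<le> e / (2 * real CARD('d))" using assms(2) by blast
    have "norm (y - x) \<le> (\<Sum>k\<in>UNIV. \<bar>(y - x) $ k\<bar>)" by (rule norm_le_l1_cart)
    also have "\<dots> \<le> (\<Sum>k\<in>(UNIV::'d set). e / (2 * real CARD('d)))"
      using y(2) by (intro sum_mono) (simp add: abs_minus_commute)
    also have "\<dots> < e" using \<open>0 < e\<close> by simp
    finally show "\<exists>y\<in>Y. dist y x < e" using y(1) by (auto simp: dist_norm)
  qed
  then show ?thesis using assms(1) by simp
qed

lemma half_power_le:
  assumes "0 < e"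
  shows "\<exists>n. (1/2::real) ^ n * K \<le> e"
proof -
  have "(\<lambda>n. (1/2::real) ^ n * K) \<longlonglongrightarrow> 0 * K" by (intro tendsto_intros LIMSEQ_realpow_zero) auto
  then have "\<forall>\<^sub>F n in sequentially. (1/2::real) ^ n * K < e" using assms by (intro order_tendstoD) auto
  then obtain n where "(1/2::real) ^ n * K < e" unfolding eventually_sequentially by blast
  then show ?thesis by (intro exI[of _ n]) simp
qed

lemma dist_le_if_components_le:
  fixes u z :: "real^'d"
  assumes "\<And>k. \<bar>u $ k - z $ k\<bar> \<le> r / real CARD('d)"
  shows "dist z u \<le> r"
proof -
  have "dist z u = norm (u - z)" by (simp add: dist_norm norm_minus_commute)
  also have "\<dots> \<le> (\<Sum>k\<in>UNIV. \<bar>(u - z) $ k\<bar>)" by (rule norm_le_l1_cart)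
  also have "\<dots> \<le> (\<Sum>k\<in>(UNIV::'d set). r / real CARD('d))"
    using assms by (intro sum_mono) simp
  finally show ?thesis by simp
qed

lemma continuous_on_axis: "continuous_on UNIV (axis j :: 'v::real_normed_vector \<Rightarrow> 'v^'i::finite)"
proof -
  have "(axis j :: 'v \<Rightarrow> 'v^'i::finite) = (\<lambda>u. \<chi> i. if i = j then u else 0)" by (simp add: fun_eq_iff axis_def)
  moreover have "continuous_on UNIV (\<lambda>u::'v. (\<chi> i. if i = j then u else 0)::'v^'i::finite)"
  proof (rule continuous_on_vec_lambda)
    show "continuous_on UNIV (\<lambda>u::'v. if i = j then u else 0)" for i
      by (cases "i = j") (auto intro: continuous_on_id continuous_on_const)
  qed
  ultimately show ?thesis by simp
qed

lemma finite_words: "finite {w :: 'i::finite list. length w = n}"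
  and card_words: "card {w :: 'i list. length w = n} = CARD('i) ^ n"
  using finite_lists_length_eq[of "UNIV :: 'i set" n] card_lists_length_eq[of "UNIV :: 'i set" n] by auto

text \<open>There are only finitely many words of each length.\<close>

lemma infinite_words_iff:
  fixes P :: "'i::finite list \<Rightarrow> bool"
  shows "infinite {w. w \<noteq> [] \<and> P w} \<longleftrightarrow> (\<exists>\<^sub>\<infinity>n. \<exists>w. length w = n \<and> 1 \<le> n \<and> P w)"
proof -
  let ?W = "{w. w \<noteq> [] \<and> P w}"
  have len: "{n. \<exists>w. length w = n \<and> 1 \<le> n \<and> P w} = length ` ?W"
    by (auto simp: image_iff Suc_le_eq)
  have "finite (length ` ?W) \<longleftrightarrow> finite ?W"
  proof
    assume fin: "finite (length ` ?W)"
    have "?W \<subseteq> (\<Union>n\<in>length ` ?W. {w. length w = n})" by auto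
    then show "finite ?W" by (rule finite_subset) (rule finite_UN_I[OF fin finite_words])
  qed simp
  then show ?thesis by (simp only: INFM_iff_infinite len)
qed

text \<open>A strictly increasing chain of words is the chain of prefixes of one infinite sequence. The letter at
  position \<open>n\<close> (counted from 1) is read off the \<open>n\<close>-th word, which is long enough.\<close>

lemma prefix_word_of_chain:
  fixes u :: "nat \<Rightarrow> 'i list"
  assumes "\<And>k. \<exists>w. w \<noteq> [] \<and> u (Suc k) = u k @ w"
  shows "prefix_word (\<lambda>n. u n ! (n - 1)) (length (u k)) = u k"
    and "strict_mono (\<lambda>k. length (u k))"
proof -
  show sm: "strict_mono (\<lambda>k. length (u k))"
    unfolding strict_mono_Suc_iff
  proof
    fix k obtain w where "w \<noteq> []" "u (Suc k) = u k @ w" using assms by blast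
    then show "length (u k) < length (u (Suc k))" by simp
  qed
  have ext: "\<exists>w. u b = u a @ w" if "a \<le> b" for a b
    using that
  proof (induction b rule: dec_induct)
    case (step b)
    then show ?case using assms[of b] by (metis append.assoc)
  qed simp
  have nth: "u a ! i = u b ! i" if "i < length (u a)" "i < length (u b)" for a b i
    using that by (metis ext nat_le_linear nth_append)
  show "prefix_word (\<lambda>n. u n ! (n - 1)) (length (u k)) = u k"
  proof (rule nth_equalityI)
    fix i assume "i < length (prefix_word (\<lambda>n. u n ! (n - 1)) (length (u k)))"
    then have i: "i < length (u k)" by (simp add: prefix_word_def del: upt_Suc)
    then have "prefix_word (\<lambda>n. u n ! (n - 1)) (length (u k)) ! i = u (Suc i) ! i"
      by (simp add: prefix_word_def del: upt_Suc)
    also have "\<dots> = u k ! i"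
      using i strict_mono_imp_increasing[OF sm, of "Suc i"] by (intro nth) auto
    finally show "prefix_word (\<lambda>n. u n ! (n - 1)) (length (u k)) ! i = u k ! i" .
  qed (simp add: prefix_word_def del: upt_Suc)
qed

lemma regular_decay_power:
  assumes "decaying_regularly h"
  obtains q where "0 < q" "\<And>n l. 1 \<le> n \<Longrightarrow> q ^ l * h n \<le> h (n + l)"
proof
  let ?q = "INF n\<in>{1..}. h (n + 1) / h n"
  have h: "\<And>n. 1 \<le> n \<Longrightarrow> 0 < h n" and q: "0 < ?q"
    using assms by (auto simp: decaying_regularly_def)
  show "0 < ?q" by (rule q)
  have "bdd_below ((\<lambda>n. h (n + 1) / h n) ` {1..})"
    using h by (intro bdd_belowI2[of _ 0]) (auto simp: less_imp_le)
  then have step: "?q * h n \<le> h (n + 1)" if "1 \<le> n" for n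
    using cINF_lower[of "\<lambda>n. h (n + 1) / h n" "{1..}" n] h[OF that] that by (simp add: pos_le_divide_eq)
  show "?q ^ l * h n \<le> h (n + l)" if "1 \<le> n" for n l
  proof (induction l)
    case (Suc l)
    have "?q ^ Suc l * h n = ?q * (?q ^ l * h n)" by simp
    also have "\<dots> \<le> ?q * h (n + l)" using Suc q by (intro mult_left_mono) auto
    also have "\<dots> \<le> h (n + l + 1)" using that by (intro step) simp
    finally show ?case by simp
  qed simp
qed

text \<open>If the truncated series converged, its terms would tend to 0 and the truncation would eventually have no
  effect.\<close>

lemma not_summable_min:
  fixes f :: "nat \<Rightarrow> real"
  assumes f: "\<not> summable f" "\<And>n. 0 \<le> f n" and "0 < C" "0 < c"
  shows "\<not> summable (\<lambda>n. min (f n / C) c)"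
proof
  assume S: "summable (\<lambda>n. min (f n / C) c)"
  then have "(\<lambda>n. min (f n / C) c) \<longlonglongrightarrow> 0" by (rule summable_LIMSEQ_zero)
  then have "\<forall>\<^sub>F n in sequentially. min (f n / C) c < c" using \<open>0 < c\<close> by (rule order_tendstoD)
  then have "\<forall>\<^sub>F n in sequentially. min (f n / C) c = f n / C" by eventually_elim auto
  then have "summable (\<lambda>n. f n / C)" using S by (simp add: summable_cong)
  then have "summable (\<lambda>n. f n / C * C)" by (rule summable_mult2)
  then show False using f \<open>0 < C\<close> by simp
qed

lemma not_summable_if_infsum_infinite:
  assumes h: "\<And>n. n \<in> B \<Longrightarrow> 0 \<le> h n" and inf: "(\<Sum>\<^sub>\<infinity>n\<in>B. ennreal (h n)) = \<infinity>"
  shows "\<not> summable (\<lambda>n::nat. if n \<in> B then h n else 0)"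
proof
  let ?f = "\<lambda>n. if n \<in> B then h n else 0"
  assume S: "summable ?f"
  have nn: "0 \<le> ?f n" for n using h by simp
  have "(\<Sum>\<^sub>\<infinity>n\<in>B. ennreal (h n)) = (SUP F\<in>{F. finite F \<and> F \<subseteq> B}. \<Sum>n\<in>F. ennreal (h n))"
    by (rule nonneg_infsum_complete) simp
  also have "\<dots> \<le> ennreal (suminf ?f)"
  proof (rule SUP_least, clarify)
    fix F assume F: "finite F" "F \<subseteq> B"
    have "(\<Sum>n\<in>F. ennreal (h n)) = ennreal (\<Sum>n\<in>F. h n)"
      using F h by (intro sum_ennreal) auto
    also have "(\<Sum>n\<in>F. h n) = (\<Sum>n\<in>F. ?f n)" using F by (intro sum.cong) auto
    also have "ennreal (\<Sum>n\<in>F. ?f n) \<le> ennreal (suminf ?f)"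
      using F nn by (intro ennreal_leI sum_le_suminf[OF S]) auto
    finally show "(\<Sum>n\<in>F. ennreal (h n)) \<le> ennreal (suminf ?f)" .
  qed
  finally show False using inf by (simp add: top_unique)
qed

section \<open>The self-affine set of a system with one diagonal linear part\<close>

locale equal_diagonal_ifs =
  fixes A :: "'i::finite \<Rightarrow> real^'d^'d" and D :: "real^'d^'d"
  assumes diag: "positive_diagonal D" and A_eq: "\<And>i. A i = D"
    and opnorm_D: "opnorm D < 1/2" and lam_gt_1: "lam A > 1"
begin

definition ratio :: "'d \<Rightarrow> real" where "ratio k = D $ k $ k"

abbreviation X :: "(real^'d)^'i \<Rightarrow> (real^'d) set" where "X \<equiv> self_affine_set A"
abbreviation S :: "(real^'d)^'i \<Rightarrow> 'i list \<Rightarrow> real^'d \<Rightarrow> real^'d" where "S \<equiv> S_word A"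

lemma D_mult_nth: "(D *v x) $ k = ratio k * x $ k"
proof -
  have "(D *v x) $ k = (\<Sum>j\<in>UNIV. D $ k $ j * x $ j)" by (simp add: matrix_vector_mult_def)
  also have "\<dots> = (\<Sum>j\<in>UNIV. if j = k then ratio k * x $ k else 0)"
    using diag by (intro sum.cong) (auto simp: positive_diagonal_def ratio_def)
  finally show ?thesis by simp
qed

lemma ratio_pos: "0 < ratio k"
  using diag by (simp add: positive_diagonal_def ratio_def)

lemma ratio_less_half: "ratio k < 1/2"
proof -
  have "\<bar>ratio k\<bar> = \<bar>(D *v axis k 1) $ k\<bar>" by (simp add: D_mult_nth axis_def)
  also have "\<dots> \<le> norm (D *v axis k 1)" by (rule component_le_norm_cart)
  also have "\<dots> \<le> opnorm D * norm (axis k (1::real))"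
    unfolding opnorm_def by (rule onorm) (rule matrix_vector_mul_bounded_linear)
  finally show ?thesis using opnorm_D by (simp add: norm_axis_1)
qed

lemma ratio_power_pos: "0 < ratio k ^ n" by (simp add: ratio_pos)

lemma ratio_power_le: "ratio k ^ n \<le> (1/2) ^ n"
  using ratio_pos[of k] ratio_less_half[of k] by (intro power_mono) auto

lemma lam_eq: "lam A = real CARD('i) * (\<Prod>k\<in>UNIV. ratio k)"
proof -
  have "det D = (\<Prod>k\<in>UNIV. ratio k)"
    using diag by (subst det_diagonal) (auto simp: positive_diagonal_def ratio_def)
  moreover have "0 \<le> (\<Prod>k\<in>UNIV. ratio k)" using ratio_pos by (simp add: prod_nonneg less_imp_le)
  ultimately show ?thesis by (simp add: lam_def A_eq)
qed

lemma S_map_nth: "S_map A t i x $ k = ratio k * x $ k + t $ i $ k"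
  by (simp add: S_map_def A_eq D_mult_nth)

lemma S_Nil [simp]: "S t [] x = x" and S_Cons [simp]: "S t (i # w) x = S_map A t i (S t w x)"
  by (simp_all add: S_word_def)

lemma S_nth: "S t w x $ k = ratio k ^ length w * x $ k + S t w 0 $ k"
  by (induction w) (simp_all add: S_map_nth algebra_simps)

lemma bij_S_map: "bij (S_map A t i)"
proof (rule o_bij)
  let ?g = "\<lambda>y. \<chi> k. (y $ k - t $ i $ k) / ratio k"
  show "?g \<circ> S_map A t i = id" "S_map A t i \<circ> ?g = id"
    using less_imp_neq[OF ratio_pos] by (auto simp: fun_eq_iff vec_eq_iff S_map_nth)
qed

lemma T_word_append: "T_word A t (v @ w) x = T_word A t w (T_word A t v x)"
  by (simp add: T_word_def)

lemma S_T_word: "S t w (T_word A t w x) = x"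
proof (induction w arbitrary: x)
  case (Cons i w)
  then show ?case
    using bij_S_map[of t i] by (simp add: T_word_def T_map_def bij_is_surj surj_f_inv_f)
qed (simp add: T_word_def)

lemma T_S_word: "T_word A t w (S t w x) = x"
proof (induction w arbitrary: x)
  case (Cons i w)
  then show ?case
    using bij_S_map[of t i] by (simp add: T_word_def T_map_def bij_is_inj inv_f_f)
qed (simp add: T_word_def)

lemma T_word_nth: "T_word A t w y $ k = (y $ k - S t w 0 $ k) / ratio k ^ length w"
  using S_nth[of t w "T_word A t w y" k] ratio_pos[of k]
  by (simp add: S_T_word)

lemma continuous_T_word: "continuous_on UNIV (T_word A t w)"
proof -
  have "T_word A t w = (\<lambda>y. \<chi> k. (y $ k - S t w 0 $ k) / ratio k ^ length w)"
    by (simp add: fun_eq_iff vec_eq_iff T_word_nth)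
  then show ?thesis
    using less_imp_neq[OF ratio_pos] by (auto intro!: continuous_intros)
qed

lemma compact_S_map_image: "compact K \<Longrightarrow> compact (S_map A t i ` K)"
proof (rule compact_continuous_image)
  have "S_map A t i = (\<lambda>x. \<chi> k. ratio k * x $ k + t $ i $ k)"
    by (simp add: fun_eq_iff vec_eq_iff S_map_nth)
  then show "continuous_on K (S_map A t i)" by (auto intro!: continuous_intros)
qed

text \<open>Iterating the Hutchinson operator on an invariant cube decreases to an invariant compact set.\<close>

lemma self_affine_set_exists: "\<exists>X. X \<noteq> {} \<and> compact X \<and> X = (\<Union>i. S_map A t i ` X)"
proof -
  define R where "R = 2 * (\<Sum>i\<in>UNIV. \<Sum>k\<in>UNIV. \<bar>t $ i $ k\<bar>)"
  have tR: "\<bar>t $ i $ k\<bar> \<le> R / 2" for i k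
  proof -
    have "\<bar>t $ i $ k\<bar> \<le> (\<Sum>k\<in>UNIV. \<bar>t $ i $ k\<bar>)" by (rule member_le_sum) auto
    also have "\<dots> \<le> (\<Sum>i\<in>UNIV. \<Sum>k\<in>UNIV. \<bar>t $ i $ k\<bar>)"
      by (rule member_le_sum[where f="\<lambda>i. \<Sum>k\<in>UNIV. \<bar>t $ i $ k\<bar>"]) (auto intro: sum_nonneg)
    finally show ?thesis by (simp add: R_def)
  qed
  define F where "F K = (\<Union>i. S_map A t i ` K)" for K
  define B where "B = abox (0::real^'d) (\<lambda>_. R)"
  define C where "C n = (F ^^ n) B" for n
  have CSuc: "C (Suc n) = F (C n)" for n by (simp add: C_def)
  have Fmono: "K \<subseteq> L \<Longrightarrow> F K \<subseteq> F L" for K L by (auto simp: F_def)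
  have FB: "F B \<subseteq> B"
  proof (clarsimp simp: F_def B_def abox_def S_map_nth)
    fix i :: 'i and x :: "real^'d" and k :: 'd assume "\<forall>k. \<bar>x $ k\<bar> \<le> R"
    then have "\<bar>ratio k * x $ k\<bar> \<le> 1/2 * R"
      unfolding abs_mult using ratio_pos[of k] ratio_less_half[of k] by (intro mult_mono) auto
    then show "\<bar>ratio k * x $ k + t $ i $ k\<bar> \<le> R" using tR[of i k] by linarith
  qed
  have dec1: "C (Suc n) \<subseteq> C n" for n
  proof (induction n)
    case 0 then show ?case using FB by (simp add: C_def)
  next
    case (Suc n) then show ?case using Fmono by (simp add: CSuc)
  qed
  have dec: "m \<le> n \<Longrightarrow> C n \<subseteq> C m" for m n
    by (rule lift_Suc_antimono_le[of C, OF dec1])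
  have comp: "compact (C n)" for n
  proof (induction n)
    case 0 then show ?case by (simp add: C_def B_def abox_eq_cbox compact_cbox)
  next
    case (Suc n) then show ?case unfolding CSuc F_def by (intro compact_UN) (auto intro: compact_S_map_image)
  qed
  have ne: "C n \<noteq> {}" for n
  proof (induction n)
    case 0
    have "0 \<le> R" by (simp add: R_def sum_nonneg)
    then show ?case by (auto simp: C_def B_def abox_def intro!: exI[of _ 0])
  next
    case (Suc n)
    then obtain z where "z \<in> C n" by blast
    then have "S_map A t undefined z \<in> F (C n)" unfolding F_def by blast
    then show ?case unfolding CSuc by blast
  qed
  define Y where "Y = (\<Inter>n. C n)"
  have "Y \<noteq> {}" unfolding Y_def by (rule compact_nest[OF comp ne dec])
  moreover have "compact Y" unfolding Y_def using comp by (intro compact_Inter) auto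
  moreover have "Y = F Y"
  proof
    show "F Y \<subseteq> Y"
    proof -
      have "F Y \<subseteq> C n" for n
        using Fmono[of Y "C n"] dec1[of n] by (auto simp: Y_def CSuc)
      then show ?thesis by (auto simp: Y_def)
    qed
    show "Y \<subseteq> F Y"
    proof
      fix x assume x: "x \<in> Y"
      have "\<exists>i. inv (S_map A t i) x \<in> C n" for n
      proof -
        have "x \<in> F (C n)" using x by (simp add: Y_def flip: CSuc)
        then obtain i z where "z \<in> C n" "x = S_map A t i z" by (auto simp: F_def)
        then show ?thesis using bij_S_map[of t i] by (metis bij_is_inj inv_f_f)
      qed
      then obtain f where f: "\<And>n. inv (S_map A t (f n)) x \<in> C n" by metis
      have "\<exists>i. infinite {n. f n = i}"
        using pigeonhole_infinite[of "UNIV::nat set" f] by (auto simp: finite_subset[of "range f" UNIV])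
      then obtain i where inf: "infinite {n. f n = i}" by blast
      have "inv (S_map A t i) x \<in> C n" for n
      proof -
        obtain m where "n \<le> m" "f m = i" using inf by (auto simp: infinite_nat_iff_unbounded_le)
        then show ?thesis using f[of m] dec by blast
      qed
      then have "inv (S_map A t i) x \<in> Y" by (simp add: Y_def)
      moreover have "S_map A t i (inv (S_map A t i) x) = x"
        using bij_S_map[of t i] by (simp add: bij_is_surj surj_f_inv_f)
      ultimately show "x \<in> F Y" unfolding F_def by (metis UN_I UNIV_I imageI)
    qed
  qed
  ultimately show ?thesis unfolding F_def by blast
qed

lemma invariant_set_words:
  assumes inv: "Y = (\<Union>i. S_map A t i ` Y)"
  shows "x \<in> Y \<Longrightarrow> S t w x \<in> Y" and "x \<in> Y \<Longrightarrow> \<exists>w. length w = n \<and> x \<in> S t w ` Y"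
proof -
  show "x \<in> Y \<Longrightarrow> S t w x \<in> Y"
  proof (induction w)
    case (Cons i w)
    then have "S_map A t i (S t w x) \<in> (\<Union>i. S_map A t i ` Y)" by blast
    then show ?case using inv by simp
  qed simp
  show "x \<in> Y \<Longrightarrow> \<exists>w. length w = n \<and> x \<in> S t w ` Y"
  proof (induction n arbitrary: x)
    case (Suc n)
    then obtain i z where "z \<in> Y" "x = S_map A t i z" using inv by blast
    moreover obtain w where "length w = n" "z \<in> S t w ` Y" using Suc.IH \<open>z \<in> Y\<close> by blast
    ultimately show ?case by (intro exI[of _ "i # w"]) auto
  qed simp
qed

text \<open>A point \<open>S\<^sub>w y\<close> of \<open>Y\<close> and the point \<open>S\<^sub>w z\<close> of \<open>Z\<close> with the same word \<open>w\<close> of length \<open>n\<close> are at distance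
  \<open>O(2\<^bsup>-n\<^esup>)\<close>. By symmetry there is only one invariant compact set.\<close>

lemma invariant_set_subset:
  assumes Y: "compact Y" "Y = (\<Union>i. S_map A t i ` Y)"
    and Z: "Z \<noteq> {}" "compact Z" "Z = (\<Union>i. S_map A t i ` Z)"
  shows "Y \<subseteq> Z"
proof
  fix x assume x: "x \<in> Y"
  obtain z where z: "z \<in> Z" using Z(1) by blast
  obtain K where K: "\<And>y. y \<in> Y \<Longrightarrow> norm y \<le> K" using compact_imp_bounded[OF Y(1)] by (auto simp: bounded_iff)
  show "x \<in> Z"
  proof (rule closed_approximable)
    fix e :: real assume "0 < e"
    then obtain n where n: "(1/2) ^ n * (K + norm z) \<le> e" using half_power_le by blast
    obtain w y where w: "length w = n" "y \<in> Y" "x = S t w y"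
      using invariant_set_words(2)[OF Y(2) x] by blast
    have "\<bar>x $ k - S t w z $ k\<bar> \<le> e" for k
    proof -
      have "\<bar>x $ k - S t w z $ k\<bar> = ratio k ^ n * \<bar>y $ k - z $ k\<bar>"
        using ratio_power_pos[of k n] w by (simp add: S_nth[of t w y] S_nth[of t w z] abs_mult flip: right_diff_distrib)
      also have "\<dots> \<le> (1/2) ^ n * (K + norm z)"
      proof (intro mult_mono ratio_power_le)
        show "\<bar>y $ k - z $ k\<bar> \<le> K + norm z"
          using component_le_norm_cart[of y k] component_le_norm_cart[of z k] K[OF w(2)] by linarith
      qed auto
      finally show ?thesis using n by linarith
    qed
    then show "\<exists>y\<in>Z. \<forall>k. \<bar>x $ k - y $ k\<bar> \<le> e" using invariant_set_words(1)[OF Z(3) z] by blast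
  qed (use Z in \<open>simp add: compact_imp_closed\<close>)
qed

lemma self_affine_set:
  shows X_nonempty: "X t \<noteq> {}" and X_compact: "compact (X t)" and X_invariant: "X t = (\<Union>i. S_map A t i ` X t)"
proof -
  have "\<exists>!X. X \<noteq> {} \<and> compact X \<and> X = (\<Union>i. S_map A t i ` X)"
    using self_affine_set_exists[of t] invariant_set_subset by (metis subset_antisym)
  then have *: "X t \<noteq> {} \<and> compact (X t) \<and> X t = (\<Union>i. S_map A t i ` X t)"
    unfolding self_affine_set_def by (rule theI')
  show "X t \<noteq> {}" by (rule conjunct1[OF *])
  show "compact (X t)" by (rule conjunct1[OF conjunct2[OF *]])
  show "X t = (\<Union>i. S_map A t i ` X t)" by (rule conjunct2[OF conjunct2[OF *]])
qed

lemmas S_in_X = invariant_set_words(1)[OF X_invariant]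
lemmas X_covered = invariant_set_words(2)[OF X_invariant]

lemma X_borel [measurable, simp]: "X t \<in> sets borel"
  by (simp add: X_compact borel_compact)

definition fixed_point :: "(real^'d)^'i \<Rightarrow> 'i list \<Rightarrow> real^'d"
  where "fixed_point t w = (\<chi> k. S t w 0 $ k / (1 - ratio k ^ length w))"

lemma one_minus_ratio_power:
  assumes "w \<noteq> []"
  shows "0 < 1 - ratio k ^ length w" "1 - ratio k ^ length w \<le> 1"
proof -
  have "ratio k ^ length w \<le> (1/2) ^ length w" by (rule ratio_power_le)
  also have "\<dots> \<le> (1/2) ^ 1"
    by (rule power_decreasing) (simp_all add: Suc_leI assms)
  finally have "ratio k ^ length w \<le> 1/2" by (simp only: power_one_right)
  then show "0 < 1 - ratio k ^ length w" by linarith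
  show "1 - ratio k ^ length w \<le> 1" using ratio_power_pos[of k "length w"] by linarith
qed

lemma S_fixed_point:
  assumes "w \<noteq> []"
  shows "S t w (fixed_point t w) = fixed_point t w"
proof (rule vec_eq_iff[THEN iffD2], rule allI)
  fix k
  have "1 - ratio k ^ length w \<noteq> 0" using one_minus_ratio_power(1)[OF assms, of k] by simp
  then show "S t w (fixed_point t w) $ k = fixed_point t w $ k"
    unfolding S_nth[of t w "fixed_point t w" k] by (simp add: fixed_point_def field_simps)
qed

text \<open>The iterates of \<open>S\<^sub>w\<close> on any point of the self-affine set converge to the fixed point.\<close>

lemma fixed_point_in_X:
  assumes w: "w \<noteq> []"
  shows "fixed_point t w \<in> X t"
proof (rule closed_approximable)
  show "closed (X t)" by (simp add: X_compact compact_imp_closed)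
  obtain x0 where x0: "x0 \<in> X t" using X_nonempty by blast
  have orbit: "((S t w) ^^ j) x0 \<in> X t \<and>
      (\<forall>k. \<bar>fixed_point t w $ k - ((S t w) ^^ j) x0 $ k\<bar> \<le> (1/2) ^ j * (norm (fixed_point t w) + norm x0))" for j
  proof (induction j)
    case 0
    have "\<bar>fixed_point t w $ k - x0 $ k\<bar> \<le> norm (fixed_point t w) + norm x0" for k
      using component_le_norm_cart[of "fixed_point t w" k] component_le_norm_cart[of x0 k] by linarith
    then show ?case using x0 by simp
  next
    case (Suc j)
    let ?y = "((S t w) ^^ j) x0"
    have "\<bar>fixed_point t w $ k - S t w ?y $ k\<bar> \<le> (1/2) ^ Suc j * (norm (fixed_point t w) + norm x0)" for k
    proof -
      have "\<bar>fixed_point t w $ k - S t w ?y $ k\<bar> = \<bar>S t w (fixed_point t w) $ k - S t w ?y $ k\<bar>"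
        by (simp add: S_fixed_point[OF w])
      also have "\<dots> = ratio k ^ length w * \<bar>fixed_point t w $ k - ?y $ k\<bar>"
        using ratio_power_pos[of k "length w"]
        by (simp add: S_nth[of t w ?y] S_nth[of t w "fixed_point t w"] abs_mult flip: right_diff_distrib)
      also have "\<dots> \<le> 1/2 * ((1/2) ^ j * (norm (fixed_point t w) + norm x0))"
      proof (rule mult_mono)
        have "ratio k ^ length w \<le> ratio k ^ 1"
          using ratio_pos[of k] ratio_less_half[of k]
          by (intro power_decreasing) (simp_all add: Suc_leI w)
        then show "ratio k ^ length w \<le> 1/2" using ratio_less_half[of k] by simp
      qed (use Suc in auto)
      finally show ?thesis by simp
    qed
    then show ?case using Suc S_in_X by simp
  qed
  show "\<exists>y\<in>X t. \<forall>k. \<bar>fixed_point t w $ k - y $ k\<bar> \<le> e" if "0 < e" for e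
  proof -
    obtain n where "(1/2) ^ n * (norm (fixed_point t w) + norm x0) \<le> e" using half_power_le \<open>0 < e\<close> by blast
    then show ?thesis using orbit[of n] by (meson order_trans)
  qed
qed

end

section \<open>Transversality, and most parameters have many good levels\<close>

context equal_diagonal_ifs
begin

text \<open>With \<open>L = \<lambda>\<^bsup>1/d\<^esup>\<close> the relevant length scale \<open>\<lambda>\<^bsup>-n/d\<^esup>\<close> of level \<open>n\<close> is \<open>1 / L ^ n\<close>.\<close>

definition L :: real where "L = lam A powr (1 / real CARD('d))"

lemma L_pow: "L ^ CARD('d) = lam A" and L_pos: "0 < L" and L_gt_1: "1 < L"
proof -
  show "L ^ CARD('d) = lam A" using lam_gt_1 by (simp add: L_def powr_powr flip: powr_realpow)
  show "0 < L" using lam_gt_1 by (simp add: L_def)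
  show "1 < L" using lam_gt_1 by (simp add: L_def gr_one_powr)
qed

definition cube :: "real \<Rightarrow> ((real^'d)^'i) set"
  where "cube M = {t. \<forall>i k. \<bar>t $ i $ k\<bar> \<le> M}"

definition close_event :: "real \<Rightarrow> 'i list \<Rightarrow> 'i list \<Rightarrow> ((real^'d)^'i) set"
  where "close_event \<rho> v w = {t. \<forall>k. \<bar>S t v 0 $ k - S t w 0 $ k\<bar> \<le> \<rho> * ratio k ^ length v}"

definition word_pairs :: "nat \<Rightarrow> ('i list \<times> 'i list) set"
  where "word_pairs n = {(v, w). length v = n \<and> length w = n \<and> v \<noteq> w}"

lemma continuous_offset: "continuous_on UNIV (\<lambda>t. S t w 0 $ k)"
  by (induction w) (auto simp: S_map_nth intro!: continuous_intros)

lemma close_event_borel [measurable]: "close_event \<rho> v w \<in> sets borel"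
proof -
  have "closed (close_event \<rho> v w)"
    unfolding close_event_def
    by (intro closed_Collect_all closed_Collect_le continuous_intros continuous_offset)
  then show ?thesis by (rule borel_closed)
qed

lemma cube_borel [measurable]: "cube M \<in> sets borel"
proof -
  have "closed (cube M)"
    unfolding cube_def by (intro closed_Collect_all closed_Collect_le continuous_intros)
  then show ?thesis by (rule borel_closed)
qed

lemma cube_fmeasurable: "cube M \<in> fmeasurable lborel"
proof -
  have "bounded (cube M)"
    unfolding bounded_iff
  proof (intro exI ballI)
    fix t assume t: "t \<in> cube M"
    have "norm t \<le> (\<Sum>i\<in>UNIV. norm (t $ i))" by (simp add: norm_vec_def L2_set_le_sum)
    also have "\<dots> \<le> (\<Sum>i\<in>UNIV. \<Sum>k\<in>UNIV. \<bar>t $ i $ k\<bar>)" by (intro sum_mono norm_le_l1_cart)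
    also have "\<dots> \<le> (\<Sum>i\<in>(UNIV::'i set). \<Sum>k\<in>(UNIV::'d set). M)"
      using t by (intro sum_mono) (auto simp: cube_def)
    finally show "norm t \<le> (\<Sum>i\<in>(UNIV::'i set). \<Sum>k\<in>(UNIV::'d set). M)" .
  qed
  then show ?thesis using emeasure_bounded_finite by (auto simp: fmeasurable_def)
qed

text \<open>The component \<open>k\<close> of \<open>S\<^sub>w 0\<close> is a linear function of the translations; \<open>shift_coef j w k\<close> is its coefficient
  at component \<open>k\<close> of the translation \<open>t $ j\<close>.\<close>

primrec shift_coef :: "'i \<Rightarrow> 'i list \<Rightarrow> 'd \<Rightarrow> real"
  where "shift_coef j [] k = 0"
  | "shift_coef j (i # w) k = (if i = j then 1 else 0) + ratio k * shift_coef j w k"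

lemma offset_shift: "S (t + axis j u) w 0 $ k = S t w 0 $ k + shift_coef j w k * u $ k"
  by (induction w) (auto simp: S_map_nth axis_def algebra_simps)

lemma shift_coef_nonneg: "0 \<le> shift_coef j w k"
  using ratio_pos by (induction w) (auto simp: less_imp_le)

lemma shift_coef_le: "shift_coef j w k \<le> 1 / (1 - ratio k)"
proof (induction w)
  case Nil then show ?case using ratio_less_half[of k] by simp
next
  case (Cons i w)
  have "shift_coef j (i # w) k \<le> 1 + ratio k * (1 / (1 - ratio k))"
    unfolding shift_coef.simps using Cons ratio_pos[of k] by (intro add_mono mult_left_mono) auto
  also have "\<dots> = 1 / (1 - ratio k)" using ratio_less_half[of k] by (simp add: field_simps)
  finally show ?case .
qed

definition gap :: "'d \<Rightarrow> real" where "gap k = 1 - ratio k / (1 - ratio k)"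

lemma gap_pos: "0 < gap k"
  using ratio_less_half[of k] by (simp add: gap_def field_simps)

text \<open>The first letter of \<open>i # v\<close> contributes 1, and the letters of \<open>w\<close> equal to \<open>i\<close> can take away at most
  \<open>ratio k / (1 - ratio k)\<close>.\<close>

lemma shift_coef_gap:
  assumes "i \<noteq> j"
  shows "gap k \<le> shift_coef i (i # v) k - shift_coef i (j # w) k"
proof -
  have "ratio k * shift_coef i w k \<le> ratio k * (1 / (1 - ratio k))"
    using shift_coef_le ratio_pos[of k] by (intro mult_left_mono) auto
  moreover have "0 \<le> ratio k * shift_coef i v k" using shift_coef_nonneg ratio_pos[of k] by simp
  ultimately show ?thesis using assms by (simp add: gap_def)
qed

definition transversality_const :: "real \<Rightarrow> real"
  where "transversality_const M = measure lborel (cube (M + 1)) * (\<Prod>k\<in>UNIV. 2 / gap k)"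

lemma transversality_const_nonneg: "0 \<le> transversality_const M"
  unfolding transversality_const_def using gap_pos by (intro mult_nonneg_nonneg prod_nonneg) (auto simp: less_imp_le)

text \<open>Lebesgue measure is invariant under adding \<open>u\<close> to the translation \<open>t $ i\<close>; average over all \<open>u\<close> in a unit
  cube. For fixed \<open>t\<close>, the shifted parameter is in the event only for \<open>u\<close> in a box with half-widths
  \<open>\<rho> * ratio k ^ Suc n / gap k\<close>, because all coefficients are at least \<open>gap k\<close>.\<close>

lemma transversality:
  assumes ij: "i \<noteq> j" and len: "length v = n" "length w = n" and \<rho>: "0 \<le> \<rho>"
  shows "measure lborel (cube M \<inter> close_event \<rho> (i # v) (j # w))
    \<le> transversality_const M * \<rho> ^ CARD('d) * (\<Prod>k\<in>UNIV. ratio k) ^ Suc n"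
proof -
  define F where "F = cube M \<inter> close_event \<rho> (i # v) (j # w)"
  define I where "I = abox (0::real^'d) (\<lambda>_. 1/2)"
  define r where "r k = \<rho> * ratio k ^ Suc n" for k
  define c where "c k = shift_coef i (i # v) k - shift_coef i (j # w) k" for k
  define f where "f t k = S t (i # v) 0 $ k - S t (j # w) 0 $ k" for t k
  have r0: "0 \<le> r k" for k using \<rho> ratio_power_pos[of k "Suc n"] by (simp add: r_def)
  have c: "gap k \<le> c k" "0 < c k" for k
    using shift_coef_gap[OF ij, of k v w] gap_pos[of k] unfolding c_def by linarith+
  have f_shift: "f (t + axis i u) k = f t k + c k * u $ k" for t u k
    unfolding f_def c_def offset_shift by (simp add: algebra_simps)
  have [measurable]: "F \<in> sets borel" "I \<in> sets borel"
    by (simp_all add: F_def I_def sets.Int cube_borel close_event_borel)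
  have "continuous_on UNIV (\<lambda>p :: ((real^'d)^'i) \<times> (real^'d). fst p + axis i (snd p))"
    by (intro continuous_intros continuous_on_compose2[OF continuous_on_axis]) auto
  then have [measurable]: "(\<lambda>p :: ((real^'d)^'i) \<times> (real^'d). fst p + axis i (snd p)) \<in> borel \<rightarrow>\<^sub>M borel"
    by (rule borel_measurable_continuous_onI)
  then have m1 [measurable]: "(\<lambda>(t, u). t + axis i u :: (real^'d)^'i) \<in> borel \<Otimes>\<^sub>M borel \<rightarrow>\<^sub>M borel"
    by (simp add: borel_prod split_beta')
  have m2 [measurable]: "(\<lambda>(u, t). t + axis i u :: (real^'d)^'i) \<in> borel \<Otimes>\<^sub>M borel \<rightarrow>\<^sub>M borel"
    using measurable_compose[OF measurable_pair_swap' m1] by (simp add: split_beta')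
  have [measurable]: "(\<lambda>u. t + axis i u :: (real^'d)^'i) \<in> borel \<rightarrow>\<^sub>M borel" for t
    by (intro borel_measurable_continuous_onI continuous_intros continuous_on_axis)
  have I1: "emeasure lborel I = 1"
  proof -
    have "measure lborel I = 1" by (simp add: I_def measure_abox)
    moreover have "emeasure lborel I = ennreal (measure lborel I)"
      unfolding I_def by (rule emeasure_eq_measure2[OF abox_fmeasurable])
    ultimately show ?thesis by simp
  qed
  have shift_in: "t \<in> cube (M + 1)" if "t + axis i u \<in> F" "u \<in> I" for t u
  proof -
    have "\<bar>t $ i' $ k\<bar> \<le> M + 1" for i' k
    proof -
      have "\<bar>(t + axis i u) $ i' $ k\<bar> \<le> M" using that(1) by (simp add: F_def cube_def)
      moreover have "\<bar>u $ k\<bar> \<le> 1/2" using that(2) by (simp add: I_def abox_def)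
      ultimately show ?thesis by (auto simp: axis_def split: if_splits)
    qed
    then show ?thesis by (simp add: cube_def)
  qed
  have shift_box: "u \<in> abox (\<chi> k. - f t k / c k) (\<lambda>k. r k / gap k)" if "t + axis i u \<in> F" for t u
  proof -
    have "\<bar>u $ k - (- f t k / c k)\<bar> \<le> r k / gap k" for k
    proof -
      have "\<bar>f t k + c k * u $ k\<bar> \<le> r k"
        using that by (simp add: F_def close_event_def r_def len f_shift[symmetric]) (simp add: f_def)
      moreover have "f t k + c k * u $ k = c k * (u $ k - (- f t k / c k))"
        using c(2)[of k] by (simp add: field_simps)
      ultimately have "c k * \<bar>u $ k - (- f t k / c k)\<bar> \<le> r k"
        using c(2)[of k] by (simp add: abs_mult)
      then have "\<bar>u $ k - (- f t k / c k)\<bar> \<le> r k / c k"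
        using c(2)[of k] by (simp add: field_simps)
      also have "\<dots> \<le> r k / gap k" using c(1)[of k] gap_pos[of k] r0[of k] by (intro divide_left_mono) auto
      finally show ?thesis .
    qed
    then show ?thesis by (simp add: abox_def)
  qed
  have box_meas: "emeasure lborel (abox p (\<lambda>k. r k / gap k))
      = ennreal ((\<Prod>k\<in>UNIV. 2 / gap k) * \<rho> ^ CARD('d) * (\<Prod>k\<in>UNIV. ratio k) ^ Suc n)" for p :: "real^'d"
  proof -
    have "measure lborel (abox p (\<lambda>k. r k / gap k)) = (\<Prod>k\<in>UNIV. 2 * (r k / gap k))"
      using r0 gap_pos by (intro measure_abox) (auto simp: less_imp_le)
    also have "\<dots> = (\<Prod>k\<in>UNIV. (2 / gap k) * (\<rho> * ratio k ^ Suc n))"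
      by (simp add: r_def)
    also have "\<dots> = (\<Prod>k\<in>UNIV. 2 / gap k) * \<rho> ^ CARD('d) * (\<Prod>k\<in>UNIV. ratio k) ^ Suc n"
      by (simp only: prod.distrib prod_power_distrib prod_constant mult.assoc)
    finally show ?thesis by (simp add: emeasure_eq_measure2[OF abox_fmeasurable])
  qed
  define \<beta> where "\<beta> = (\<Prod>k\<in>UNIV. 2 / gap k) * \<rho> ^ CARD('d) * (\<Prod>k\<in>UNIV. ratio k) ^ Suc n"
  have \<beta>: "0 \<le> \<beta>" using gap_pos ratio_pos \<rho>
    unfolding \<beta>_def by (intro mult_nonneg_nonneg prod_nonneg zero_le_power) (auto simp: less_imp_le)
  have "emeasure lborel F = (\<integral>\<^sup>+ u. emeasure lborel F * indicator I u \<partial>lborel)"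
    by (simp add: nn_integral_cmult_indicator I1)
  also have "\<dots> = (\<integral>\<^sup>+ u. (\<integral>\<^sup>+ t. indicator I u * indicator F (t + axis i u) \<partial>lborel) \<partial>lborel)"
  proof (rule nn_integral_cong)
    fix u
    have "(\<integral>\<^sup>+ t. indicator I u * indicator F (t + axis i u) \<partial>lborel)
      = indicator I u * (\<integral>\<^sup>+ t. indicator F (axis i u + t) \<partial>lborel)"
      by (subst nn_integral_cmult) (auto simp: add.commute)
    also have "(\<integral>\<^sup>+ t. indicator F (axis i u + t) \<partial>lborel) = (\<integral>\<^sup>+ t. indicator F t \<partial>distr lborel borel ((+) (axis i u)))"
      by (subst nn_integral_distr) auto
    also have "\<dots> = emeasure lborel F" by (simp add: lborel_distr_plus)
    finally show "emeasure lborel F * indicator I u = (\<integral>\<^sup>+ t. indicator I u * indicator F (t + axis i u) \<partial>lborel)"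
      by (simp add: mult.commute)
  qed
  also have "\<dots> = (\<integral>\<^sup>+ t. (\<integral>\<^sup>+ u. indicator I u * indicator F (t + axis i u) \<partial>lborel) \<partial>lborel)"
    by (rule lborel_pair.Fubini') measurable
  also have "\<dots> \<le> (\<integral>\<^sup>+ t. ennreal \<beta> * indicator (cube (M + 1)) t \<partial>lborel)"
  proof (rule nn_integral_mono)
    fix t
    have "(\<integral>\<^sup>+ u. indicator I u * indicator F (t + axis i u) \<partial>lborel)
      \<le> (\<integral>\<^sup>+ u. indicator (cube (M + 1)) t * indicator (abox (\<chi> k. - f t k / c k) (\<lambda>k. r k / gap k)) u \<partial>lborel)"
      using shift_in shift_box by (intro nn_integral_mono) (auto simp: indicator_def)
    also have "\<dots> = ennreal \<beta> * indicator (cube (M + 1)) t"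
      by (simp add: nn_integral_cmult_indicator box_meas \<beta>_def mult.commute)
    finally show "(\<integral>\<^sup>+ u. indicator I u * indicator F (t + axis i u) \<partial>lborel)
      \<le> ennreal \<beta> * indicator (cube (M + 1)) t" .
  qed
  also have "\<dots> = ennreal \<beta> * emeasure lborel (cube (M + 1))"
    by (simp add: nn_integral_cmult_indicator cube_borel)
  also have "\<dots> = ennreal (\<beta> * measure lborel (cube (M + 1)))"
    using \<beta> by (simp add: emeasure_eq_measure2[OF cube_fmeasurable] ennreal_mult)
  finally have "emeasure lborel F \<le> ennreal (\<beta> * measure lborel (cube (M + 1)))" .
  then have "measure lborel F \<le> \<beta> * measure lborel (cube (M + 1))"
    using \<beta> unfolding measure_def by (intro enn2real_leI) auto
  then show ?thesis by (simp add: F_def \<beta>_def transversality_const_def mult_ac)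
qed

lemma word_pairs_subset: "word_pairs n \<subseteq> {w. length w = n} \<times> {w. length w = n}"
  by (auto simp: word_pairs_def)

lemma finite_word_pairs [simp]: "finite (word_pairs n)"
  by (rule finite_subset[OF word_pairs_subset]) (simp add: finite_words)

text \<open>A common first letter cancels because the linear parts of all maps agree.\<close>

lemma close_event_Cons: "close_event \<rho> (i # v) (i # w) = close_event \<rho> v w"
proof -
  have "\<bar>S t (i # v) 0 $ k - S t (i # w) 0 $ k\<bar> \<le> \<rho> * ratio k ^ length (i # v)
    \<longleftrightarrow> \<bar>S t v 0 $ k - S t w 0 $ k\<bar> \<le> \<rho> * ratio k ^ length v" for t k
  proof -
    have "\<bar>S t (i # v) 0 $ k - S t (i # w) 0 $ k\<bar> = ratio k * \<bar>S t v 0 $ k - S t w 0 $ k\<bar>"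
      using ratio_pos[of k] by (simp add: S_map_nth abs_mult flip: right_diff_distrib)
    moreover have "\<rho> * ratio k ^ length (i # v) = ratio k * (\<rho> * ratio k ^ length v)" by simp
    ultimately show ?thesis using ratio_pos[of k] by (simp only: mult_le_cancel_left_pos)
  qed
  then show ?thesis by (simp only: close_event_def)
qed

text \<open>Induction on \<open>n\<close>: a pair with a common first letter reduces to a pair of words of length \<open>n\<close>, with \<open>CARD('i)\<close>
  choices of the letter, and transversality bounds the pairs with different first letters. The factor
  \<open>lam A / (lam A - 1)\<close> is the value of the geometric series \<open>\<Sum> lam A ^ -j\<close>.\<close>

lemma sum_close_events:
  assumes \<rho>: "0 \<le> \<rho>"
  shows "(\<Sum>(v, w)\<in>word_pairs n. measure lborel (cube M \<inter> close_event \<rho> v w))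
    \<le> transversality_const M * \<rho> ^ CARD('d) * real CARD('i) ^ n * (lam A ^ n * (lam A / (lam A - 1)))"
proof (induction n)
  case 0
  have "word_pairs 0 = {}" by (auto simp: word_pairs_def)
  then show ?case using transversality_const_nonneg \<rho> lam_gt_1 by simp
next
  case (Suc n)
  let ?m = "\<lambda>(v, w). measure lborel (cube M \<inter> close_event \<rho> v w)"
  let ?C = "transversality_const M * \<rho> ^ CARD('d)"
  let ?\<pi> = "(\<Prod>k\<in>UNIV. ratio k)"
  define P1 where "P1 = (\<lambda>(i, v, w). (i # v, i # w)) ` (UNIV \<times> word_pairs n)"
  define P2 where "P2 = {(v, w) \<in> word_pairs (Suc n). hd v \<noteq> hd w}"
  have C0: "0 \<le> ?C" using transversality_const_nonneg \<rho> by simp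
  have \<pi>0: "0 \<le> ?\<pi>" using ratio_pos by (simp add: prod_nonneg less_imp_le)
  have fin: "finite P1" "finite P2"
    by (auto simp: P1_def P2_def intro: finite_subset[OF _ finite_word_pairs[of "Suc n"]])
  have "word_pairs (Suc n) \<subseteq> P1 \<union> P2"
  proof
    fix p assume p: "p \<in> word_pairs (Suc n)"
    then obtain i v j w where vw: "p = (i # v, j # w)" "length v = n" "length w = n" "i # v \<noteq> j # w"
      by (auto simp: word_pairs_def length_Suc_conv)
    show "p \<in> P1 \<union> P2"
    proof (cases "i = j")
      case True
      then have "p = (\<lambda>(i, v, w). (i # v, i # w)) (i, v, w)" "(i, v, w) \<in> UNIV \<times> word_pairs n"
        using vw by (auto simp: word_pairs_def)
      then show ?thesis unfolding P1_def by blast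
    next
      case False
      then show ?thesis using p vw by (simp add: P2_def)
    qed
  qed
  then have "sum ?m (word_pairs (Suc n)) \<le> sum ?m (P1 \<union> P2)"
    using fin by (intro sum_mono2) auto
  also have "\<dots> \<le> sum ?m P1 + sum ?m P2"
    using fin by (subst sum_Un) (auto intro!: sum_nonneg)
  also have "sum ?m P1 = (\<Sum>(i, v, w)\<in>UNIV \<times> word_pairs n. ?m (i # v, i # w))"
    unfolding P1_def by (subst sum.reindex) (auto simp: inj_on_def split_beta' intro: sum.cong)
  also have "\<dots> = real CARD('i) * sum ?m (word_pairs n)"
    by (subst sum.cartesian_product[symmetric]) (simp add: close_event_Cons)
  also have "\<dots> \<le> real CARD('i) * (?C * real CARD('i) ^ n * (lam A ^ n * (lam A / (lam A - 1))))"
    by (intro mult_left_mono Suc) simp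
  also have "sum ?m P2 \<le> (\<Sum>p\<in>P2. ?C * ?\<pi> ^ Suc n)"
  proof (rule sum_mono)
    fix p assume "p \<in> P2"
    then obtain i v j w where "p = (i # v, j # w)" "length v = n" "length w = n" "i \<noteq> j"
      by (auto simp: P2_def word_pairs_def length_Suc_conv)
    then show "?m p \<le> ?C * ?\<pi> ^ Suc n" using transversality[of i j v n w \<rho> M] \<rho> by simp
  qed
  also have "\<dots> \<le> real CARD('i) ^ Suc n * real CARD('i) ^ Suc n * (?C * ?\<pi> ^ Suc n)"
  proof -
    have "card P2 \<le> card ({w :: 'i list. length w = Suc n} \<times> {w :: 'i list. length w = Suc n})"
      by (rule card_mono) (auto simp: P2_def word_pairs_def finite_words)
    then have "real (card P2) \<le> real (CARD('i) ^ Suc n * CARD('i) ^ Suc n)"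
      unfolding card_cartesian_product card_words by (rule of_nat_mono)
    then have "real (card P2) \<le> real CARD('i) ^ Suc n * real CARD('i) ^ Suc n" by simp
    then have "real (card P2) * (?C * ?\<pi> ^ Suc n) \<le> real CARD('i) ^ Suc n * real CARD('i) ^ Suc n * (?C * ?\<pi> ^ Suc n)"
      using C0 \<pi>0 by (intro mult_right_mono) auto
    then show ?thesis by simp
  qed
  also have "\<dots> = ?C * real CARD('i) ^ Suc n * lam A ^ Suc n"
    by (simp add: lam_eq power_mult_distrib)
  also have "real CARD('i) * (?C * real CARD('i) ^ n * (lam A ^ n * (lam A / (lam A - 1)))) + ?C * real CARD('i) ^ Suc n * lam A ^ Suc n
    = ?C * real CARD('i) ^ Suc n * (lam A ^ Suc n * (lam A / (lam A - 1)))"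
  proof -
    have "1 / (lam A - 1) + 1 = lam A / (lam A - 1)" using lam_gt_1 by (simp add: field_simps)
    moreover have "real CARD('i) * (?C * real CARD('i) ^ n * (lam A ^ n * (lam A / (lam A - 1)))) + ?C * real CARD('i) ^ Suc n * lam A ^ Suc n
      = ?C * real CARD('i) ^ Suc n * lam A ^ Suc n * (1 / (lam A - 1) + 1)"
      by (simp add: algebra_simps)
    ultimately show ?thesis by (simp add: mult_ac)
  qed
  finally show ?case by simp
qed

definition close_pairs :: "(real^'d)^'i \<Rightarrow> real \<Rightarrow> nat \<Rightarrow> ('i list \<times> 'i list) set"
  where "close_pairs t s n = {(v, w) \<in> word_pairs n. t \<in> close_event (s / L ^ n) v w}"

definition good_levels :: "(real^'d)^'i \<Rightarrow> real \<Rightarrow> nat set"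
  where "good_levels t s = {n. 1 \<le> n \<and> real (card (close_pairs t s n)) \<le> real CARD('i) ^ n / 2}"

text \<open>A function in the class \<open>H\<close> has a divergent sum along every set of sufficiently large upper density; for
  typical parameters the good levels of some \<open>s\<close> form such a set, whatever the required density below 1.\<close>

definition typical :: "(real^'d)^'i \<Rightarrow> bool"
  where "typical t \<longleftrightarrow> (\<forall>\<epsilon>>0. \<exists>s>0. ereal (1 - \<epsilon>) < upper_density (good_levels t s))"

definition bad_event :: "real \<Rightarrow> nat \<Rightarrow> ((real^'d)^'i) set"
  where "bad_event s n = {t. real CARD('i) ^ n / 2 < real (card (close_pairs t s n))}"

lemma card_close_pairs:
  "real (card (close_pairs t s n)) = (\<Sum>(v, w)\<in>word_pairs n. indicat_real (close_event (s / L ^ n) v w) t)"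
proof -
  have "close_pairs t s n = {p \<in> word_pairs n. t \<in> close_event (s / L ^ n) (fst p) (snd p)}"
    by (auto simp: close_pairs_def)
  then have "real (card (close_pairs t s n))
      = (\<Sum>p\<in>word_pairs n. if t \<in> close_event (s / L ^ n) (fst p) (snd p) then 1 else 0)"
    by (simp flip: sum.inter_filter)
  then show ?thesis by (simp add: split_beta' indicator_def of_bool_def)
qed

lemma bad_event_borel [measurable]: "bad_event s n \<in> sets borel"
proof -
  have "(\<lambda>t. real (card (close_pairs t s n))) \<in> borel_measurable borel"
    unfolding card_close_pairs split_beta' by measurable
  then show ?thesis unfolding bad_event_def by measurable
qed

definition bad_event_const :: "real \<Rightarrow> real" where "bad_event_const M = 2 * (transversality_const M * (lam A / (lam A - 1)))"

lemma bad_event_const_nonneg: "0 \<le> bad_event_const M"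
  using transversality_const_nonneg lam_gt_1 by (simp add: bad_event_const_def)

text \<open>Markov's inequality for the number of close pairs. The bound is uniform in the level \<open>n\<close>, since
  the separation scale \<open>s / L ^ n\<close> has \<open>d\<close>-th power \<open>s ^ d / lam A ^ n\<close>.\<close>

lemma measure_bad_event:
  assumes s: "0 < s"
  shows "emeasure lborel (cube M \<inter> bad_event s n) \<le> ennreal (bad_event_const M * s ^ CARD('d))"
proof -
  let ?E = "\<lambda>p. close_event (s / L ^ n) (fst p) (snd p)"
  have pos: "0 < real CARD('i) ^ n / 2" by simp
  have "ennreal (real CARD('i) ^ n / 2) * emeasure lborel (cube M \<inter> bad_event s n)
    = (\<integral>\<^sup>+ t. ennreal (real CARD('i) ^ n / 2) * indicator (cube M \<inter> bad_event s n) t \<partial>lborel)"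
    by (rule nn_integral_cmult_indicator[symmetric]) measurable
  also have "\<dots> \<le> (\<integral>\<^sup>+ t. (\<Sum>p\<in>word_pairs n. indicator (cube M \<inter> ?E p) t) \<partial>lborel)"
  proof (rule nn_integral_mono)
    fix t
    show "ennreal (real CARD('i) ^ n / 2) * indicator (cube M \<inter> bad_event s n) t
      \<le> (\<Sum>p\<in>word_pairs n. indicator (cube M \<inter> ?E p) t)"
    proof (cases "t \<in> cube M \<inter> bad_event s n")
      case True
      then have "ennreal (real CARD('i) ^ n / 2) \<le> ennreal (\<Sum>p\<in>word_pairs n. indicat_real (?E p) t)"
        by (intro ennreal_leI) (simp add: bad_event_def card_close_pairs split_beta')
      also have "\<dots> = (\<Sum>p\<in>word_pairs n. ennreal (indicat_real (?E p) t))"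
        by (rule sum_ennreal[symmetric]) simp
      also have "\<dots> = (\<Sum>p\<in>word_pairs n. indicator (cube M \<inter> ?E p) t)"
        using True by (intro sum.cong) (auto split: split_indicator)
      finally show ?thesis using True by simp
    qed simp
  qed
  also have "\<dots> = (\<Sum>p\<in>word_pairs n. emeasure lborel (cube M \<inter> ?E p))"
    by (subst nn_integral_sum) auto
  also have "\<dots> = (\<Sum>p\<in>word_pairs n. ennreal (measure lborel (cube M \<inter> ?E p)))"
    by (intro sum.cong refl emeasure_eq_measure2 fmeasurable_Int_fmeasurable cube_fmeasurable) simp
  also have "\<dots> = ennreal (\<Sum>(v, w)\<in>word_pairs n. measure lborel (cube M \<inter> close_event (s / L ^ n) v w))"
    by (subst sum_ennreal) (auto simp: split_beta')
  also have "\<dots> \<le> ennreal (transversality_const M * (s / L ^ n) ^ CARD('d) * real CARD('i) ^ n * (lam A ^ n * (lam A / (lam A - 1))))"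
    using s L_pos by (intro ennreal_leI sum_close_events) auto
  also have "transversality_const M * (s / L ^ n) ^ CARD('d) * real CARD('i) ^ n * (lam A ^ n * (lam A / (lam A - 1)))
      = real CARD('i) ^ n / 2 * (bad_event_const M * s ^ CARD('d))"
  proof -
    have "(s / L ^ n) ^ CARD('d) * lam A ^ n = s ^ CARD('d)"
      using lam_gt_1 by (simp add: power_divide power_mult[symmetric] mult.commute[of n] power_mult L_pow)
    then have "transversality_const M * ((s / L ^ n) ^ CARD('d) * lam A ^ n) * real CARD('i) ^ n * (lam A / (lam A - 1))
      = transversality_const M * s ^ CARD('d) * real CARD('i) ^ n * (lam A / (lam A - 1))" by simp
    then show ?thesis by (simp add: bad_event_const_def mult_ac)
  qed
  also have "ennreal \<dots> = ennreal (real CARD('i) ^ n / 2) * ennreal (bad_event_const M * s ^ CARD('d))"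
    using bad_event_const_nonneg s by (intro ennreal_mult) auto
  finally show ?thesis using pos by (subst (asm) ennreal_mult_le_mult_iff) auto
qed

definition bad_fraction :: "real \<Rightarrow> nat \<Rightarrow> (real^'d)^'i \<Rightarrow> real"
  where "bad_fraction s N t = (\<Sum>n\<in>{1..N}. indicat_real (bad_event s n) t) / real N"

lemma bad_fraction_nonneg: "0 \<le> bad_fraction s N t"
  by (simp add: bad_fraction_def sum_nonneg)

definition often_bad :: "real \<Rightarrow> real \<Rightarrow> ((real^'d)^'i) set"
  where "often_bad s \<epsilon> = {t. ennreal \<epsilon> \<le> liminf (\<lambda>N. ennreal (bad_fraction s N t))}"

lemma bad_fraction_borel [measurable]: "bad_fraction s N \<in> borel_measurable borel"
  unfolding bad_fraction_def by measurable

lemma often_bad_borel [measurable]: "often_bad s \<epsilon> \<in> sets borel"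
  unfolding often_bad_def by measurable

text \<open>Fatou's lemma for the proportion of bad levels, followed by Markov's inequality.\<close>

lemma measure_often_bad:
  assumes s: "0 < s"
  shows "ennreal \<epsilon> * emeasure lborel (cube M \<inter> often_bad s \<epsilon>) \<le> ennreal (bad_event_const M * s ^ CARD('d))"
proof -
  let ?K = "bad_event_const M * s ^ CARD('d)"
  have K0: "0 \<le> ?K" using bad_event_const_nonneg s by simp
  have avg: "(\<integral>\<^sup>+ t. indicator (cube M) t * ennreal (bad_fraction s N t) \<partial>lborel) \<le> ennreal ?K" for N
  proof (cases "N = 0")
    case False
    have "(\<integral>\<^sup>+ t. indicator (cube M) t * ennreal (bad_fraction s N t) \<partial>lborel)
      = (\<integral>\<^sup>+ t. ennreal (1 / real N) * (\<Sum>n\<in>{1..N}. indicator (cube M \<inter> bad_event s n) t) \<partial>lborel)"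
    proof (rule nn_integral_cong)
      fix t
      have "ennreal (bad_fraction s N t) = ennreal (1 / real N) * (\<Sum>n\<in>{1..N}. indicator (bad_event s n) t)"
      proof -
        have "bad_fraction s N t = 1 / real N * (\<Sum>n\<in>{1..N}. indicat_real (bad_event s n) t)"
          by (simp add: bad_fraction_def)
        then have "ennreal (bad_fraction s N t)
            = ennreal (1 / real N) * ennreal (\<Sum>n\<in>{1..N}. indicat_real (bad_event s n) t)"
          by (simp only:) (rule ennreal_mult, auto intro: sum_nonneg)
        also have "ennreal (\<Sum>n\<in>{1..N}. indicat_real (bad_event s n) t)
            = (\<Sum>n\<in>{1..N}. ennreal (indicat_real (bad_event s n) t))"
          by (rule sum_ennreal[symmetric]) simp
        also have "\<dots> = (\<Sum>n\<in>{1..N}. indicator (bad_event s n) t)"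
          by (intro sum.cong) (auto split: split_indicator)
        finally show ?thesis .
      qed
      then show "indicator (cube M) t * ennreal (bad_fraction s N t)
        = ennreal (1 / real N) * (\<Sum>n\<in>{1..N}. indicator (cube M \<inter> bad_event s n) t)"
        by (auto simp: indicator_def)
    qed
    also have "\<dots> = ennreal (1 / real N) * (\<Sum>n\<in>{1..N}. emeasure lborel (cube M \<inter> bad_event s n))"
      by (subst nn_integral_cmult, measurable, subst nn_integral_sum) auto
    also have "\<dots> \<le> ennreal (1 / real N) * (\<Sum>n\<in>{1..N}. ennreal ?K)"
      by (intro mult_left_mono sum_mono measure_bad_event s) auto
    also have "(\<Sum>n\<in>{1..N}. ennreal ?K) = ennreal (real N * ?K)"
      using K0 by (subst sum_ennreal) auto
    also have "ennreal (1 / real N) * ennreal (real N * ?K) = ennreal ?K"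
      using False K0 by (subst ennreal_mult[symmetric]) auto
    finally show ?thesis .
  qed (simp add: bad_fraction_def)
  have "ennreal \<epsilon> * emeasure lborel (cube M \<inter> often_bad s \<epsilon>)
    = (\<integral>\<^sup>+ t. ennreal \<epsilon> * indicator (cube M \<inter> often_bad s \<epsilon>) t \<partial>lborel)"
    by (rule nn_integral_cmult_indicator[symmetric]) measurable
  also have "\<dots> \<le> (\<integral>\<^sup>+ t. liminf (\<lambda>N. indicator (cube M) t * ennreal (bad_fraction s N t)) \<partial>lborel)"
    by (rule nn_integral_mono) (auto simp: often_bad_def indicator_def)
  also have "\<dots> \<le> liminf (\<lambda>N. \<integral>\<^sup>+ t. indicator (cube M) t * ennreal (bad_fraction s N t) \<partial>lborel)"
    by (rule nn_integral_liminf) measurable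
  also have "\<dots> \<le> liminf (\<lambda>N. ennreal ?K)"
    by (rule Liminf_mono) (simp add: avg)
  also have "\<dots> = ennreal ?K" by (simp add: Liminf_const)
  finally show ?thesis .
qed

text \<open>The proportion of bad levels drops below \<open>\<epsilon>\<close> infinitely often.\<close>

lemma upper_density_good_levels:
  assumes e: "0 < \<epsilon>" and t: "t \<notin> often_bad s \<epsilon>"
  shows "ereal (1 - \<epsilon>) \<le> upper_density (good_levels t s)"
proof -
  let ?g = "\<lambda>N. real (card {j \<in> {1..N}. j \<in> good_levels t s}) / real N"
  have g: "?g N = 1 - bad_fraction s N t" if "N \<noteq> 0" for N
  proof -
    have "{j \<in> {1..N}. j \<in> good_levels t s} = {j \<in> {1..N}. t \<notin> bad_event s j}"
      by (auto simp: good_levels_def bad_event_def)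
    moreover have "real (card {j \<in> {1..N}. t \<notin> bad_event s j}) = (\<Sum>j\<in>{1..N}. if t \<notin> bad_event s j then 1 else 0)"
      by (simp add: sum.inter_filter[symmetric])
    moreover have "\<dots> = (\<Sum>j\<in>{1..N}. 1 - indicat_real (bad_event s j) t)"
      by (intro sum.cong) (auto simp: indicator_def)
    ultimately have "real (card {j \<in> {1..N}. j \<in> good_levels t s}) = real N - (\<Sum>j\<in>{1..N}. indicat_real (bad_event s j) t)"
      by (simp add: sum_subtractf)
    then show ?thesis using that by (simp add: bad_fraction_def diff_divide_distrib)
  qed
  have "\<exists>\<^sub>F N in sequentially. ennreal (bad_fraction s N t) < ennreal \<epsilon>"
  proof (rule ccontr)
    assume "\<not> ?thesis"
    then have "\<forall>\<^sub>F N in sequentially. ennreal \<epsilon> \<le> ennreal (bad_fraction s N t)"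
      by (simp add: not_frequently not_less)
    then have "ennreal \<epsilon> \<le> liminf (\<lambda>N. ennreal (bad_fraction s N t))"
      by (rule Liminf_bounded)
    then show False using t by (simp add: often_bad_def)
  qed
  then have fr: "\<exists>\<^sub>F N in sequentially. ereal (1 - \<epsilon>) \<le> ereal (?g N)"
  proof (rule frequently_rev_mp)
    show "\<forall>\<^sub>F N in sequentially. ennreal (bad_fraction s N t) < ennreal \<epsilon> \<longrightarrow> ereal (1 - \<epsilon>) \<le> ereal (?g N)"
      using eventually_gt_at_top[of 0]
    proof eventually_elim
      case (elim N)
      then show ?case using g[of N] bad_fraction_nonneg[of s N t] by (auto simp: ennreal_less_iff)
    qed
  qed
  show ?thesis
  proof (rule ccontr)
    assume "\<not> ?thesis"
    then have "\<forall>\<^sub>F N in sequentially. ereal (?g N) < ereal (1 - \<epsilon>)"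
      unfolding upper_density_def not_le by (rule Limsup_lessD)
    then show False using fr by (simp add: frequently_def not_le)
  qed
qed

text \<open>In a fixed cube the parameters that are often bad for all \<open>s\<close> at once have measure at most
  \<open>O(s ^ d)\<close> for every \<open>s\<close>, hence measure zero; exhaust the parameter space by countably many
  cubes and proportions.\<close>

lemma AE_typical: "AE t in lborel. typical t"
proof -
  define V where "V M q l = cube (real M) \<inter> often_bad (1 / real (Suc l)) (1 / real (Suc q))" for M q l :: nat
  have Vb: "V M q l \<in> sets lborel" for M q l
    unfolding V_def by (auto intro: cube_borel often_bad_borel)
  have null: "(\<Inter>l. V M q l) \<in> null_sets lborel" for M q
  proof -
    have "emeasure lborel (\<Inter>l. V M q l) = 0"
    proof (rule ccontr)
      assume ne: "emeasure lborel (\<Inter>l. V M q l) \<noteq> 0"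
      have fin: "emeasure lborel (\<Inter>l. V M q l) \<noteq> \<infinity>"
      proof -
        have "emeasure lborel (\<Inter>l. V M q l) \<le> emeasure lborel (cube (real M))"
          by (rule emeasure_mono) (auto simp: V_def cube_borel)
        then show ?thesis using cube_fmeasurable[of "real M"] by (auto simp: fmeasurable_def top_unique)
      qed
      define x where "x = measure lborel (\<Inter>l. V M q l)"
      have x: "emeasure lborel (\<Inter>l. V M q l) = ennreal x" "0 < x"
        using ne fin emeasure_eq_ennreal_measure[of lborel "\<Inter>l. V M q l"] measure_nonneg[of lborel "\<Inter>l. V M q l"]
        by (auto simp: x_def less_le)
      have le: "1 / real (Suc q) * x \<le> bad_event_const (real M) * (1 / real (Suc l)) ^ CARD('d)" for l
      proof -
        have "ennreal (1 / real (Suc q)) * emeasure lborel (\<Inter>l. V M q l)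
          \<le> ennreal (1 / real (Suc q)) * emeasure lborel (V M q l)"
          by (intro mult_left_mono emeasure_mono Vb) auto
        also have "\<dots> \<le> ennreal (bad_event_const (real M) * (1 / real (Suc l)) ^ CARD('d))"
          unfolding V_def by (rule measure_often_bad) simp
        finally have "ennreal (1 / real (Suc q) * x) \<le> ennreal (bad_event_const (real M) * (1 / real (Suc l)) ^ CARD('d))"
          using x by (subst ennreal_mult) auto
        then show ?thesis using bad_event_const_nonneg[of "real M"] by (subst (asm) ennreal_le_iff) auto
      qed
      have "(\<lambda>l. bad_event_const (real M) * (1 / real (Suc l)) ^ CARD('d)) \<longlonglongrightarrow> bad_event_const (real M) * 0 ^ CARD('d)"
        using LIMSEQ_inverse_real_of_nat by (intro tendsto_intros) (simp add: inverse_eq_divide)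
      then have "1 / real (Suc q) * x \<le> bad_event_const (real M) * 0 ^ CARD('d)"
        by (rule LIMSEQ_le_const) (use le in auto)
      moreover have "0 < 1 / real (Suc q) * x" using x(2) by simp
      ultimately show False by (simp only: power_0_left) simp
    qed
    then show ?thesis using Vb by (auto simp: null_sets_def)
  qed
  have "(\<Union>M. \<Union>q. \<Inter>l. V M q l) \<in> null_sets lborel"
    by (intro null_sets_UN null)
  moreover have "{t. \<not> typical t} \<subseteq> (\<Union>M. \<Union>q. \<Inter>l. V M q l)"
  proof
    fix t assume "t \<in> {t. \<not> typical t}"
    then obtain \<epsilon> where e: "0 < \<epsilon>" "\<And>s. 0 < s \<Longrightarrow> upper_density (good_levels t s) \<le> ereal (1 - \<epsilon>)"
      unfolding typical_def mem_Collect_eq by (meson not_less)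
    obtain q where q: "1 / real (Suc q) < \<epsilon>" using nat_approx_posE[OF e(1)] by metis
    obtain M where M: "norm t \<le> real M" using real_arch_simple by blast
    have "\<bar>t $ i $ k\<bar> \<le> real M" for i k
      using component_le_norm_cart[of "t $ i" k] Finite_Cartesian_Product.norm_nth_le[of t i] M by linarith
    then have "t \<in> cube (real M)" by (simp add: cube_def)
    moreover have "t \<in> often_bad (1 / real (Suc l)) (1 / real (Suc q))" for l
    proof (rule ccontr)
      assume "\<not> ?thesis"
      then have "ereal (1 - 1 / real (Suc q)) \<le> upper_density (good_levels t (1 / real (Suc l)))"
        by (intro upper_density_good_levels) auto
      also have "\<dots> \<le> ereal (1 - \<epsilon>)" by (rule e(2)) simp
      finally show False using q by simp
    qed
    ultimately show "t \<in> (\<Union>M. \<Union>q. \<Inter>l. V M q l)" by (auto simp: V_def)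
  qed
  ultimately show ?thesis by (intro AE_I'[where N="\<Union>M. \<Union>q. \<Inter>l. V M q l"]) auto
qed

end

section \<open>Limsup sets of positive measure\<close>

context equal_diagonal_ifs
begin

text \<open>The box with half-widths \<open>r * \<alpha> k ^ n\<close> has measure \<open>(2 * r) ^ d\<close> divided by the number of words of length
  \<open>n\<close>.\<close>

definition \<alpha> :: "'d \<Rightarrow> real" where "\<alpha> k = ratio k / L"

lemma \<alpha>_pos: "0 < \<alpha> k" by (simp add: \<alpha>_def ratio_pos L_pos)

lemma \<alpha>_le_half: "\<alpha> k \<le> 1/2"
proof -
  have "ratio k / L \<le> ratio k / 1" using L_gt_1 ratio_pos[of k] by (intro divide_left_mono) auto
  then show ?thesis using ratio_less_half[of k] unfolding \<alpha>_def by linarith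
qed

lemma prod_\<alpha>: "(\<Prod>k\<in>UNIV. \<alpha> k) = 1 / real CARD('i)"
proof -
  have "(\<Prod>k\<in>UNIV. ratio k) \<noteq> 0" using ratio_pos by (simp add: less_imp_neq[symmetric])
  then show ?thesis by (simp add: \<alpha>_def prod_dividef L_pow lam_eq)
qed

lemma radius_mult_ratio:
  assumes "0 \<le> h n"
  shows "radius A h n * ratio k ^ n = h n powr (1 / real CARD('d)) * \<alpha> k ^ n"
proof -
  have "(lam A ^ n) powr (1 / real CARD('d)) = L ^ n"
  proof -
    have "(lam A ^ n) powr (1 / real CARD('d)) = (lam A powr real n) powr (1 / real CARD('d))"
      using lam_gt_1 by (simp add: powr_realpow)
    also have "\<dots> = L powr real n" by (simp add: L_def powr_powr mult.commute)
    finally show ?thesis using L_pos by (simp add: powr_realpow)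
  qed
  then show ?thesis
    using assms lam_gt_1 by (simp add: radius_def powr_divide \<alpha>_def power_divide)
qed

lemma sets_infinitely_often_words:
  fixes P :: "'i list \<Rightarrow> real^'d \<Rightarrow> bool"
  assumes "\<And>w. {x. P w x} \<in> sets borel"
  shows "{x \<in> X t. infinite {w. w \<noteq> [] \<and> P w x}} \<in> sets borel"
proof -
  have "{x \<in> X t. infinite {w. w \<noteq> [] \<and> P w x}}
      = {x \<in> X t. \<forall>m. \<exists>n\<ge>m. \<exists>w. length w = n \<and> 1 \<le> n \<and> P w x}"
    by (simp only: infinite_words_iff INFM_nat_le)
  also have "\<dots> = X t \<inter> (\<Inter>m. \<Union>n\<in>{m..} \<inter> {1..}. \<Union>w\<in>{w. length w = n}. {x. P w x})"
    by (intro set_eqI) (simp, blast)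
  also have "\<dots> \<in> sets borel"
    using assms finite_words by (intro sets.Int sets.countable_INT sets.countable_UN' countable_finite) auto
  finally show ?thesis .
qed

lemma W_set_borel: "W_set A t xs h \<in> sets borel"
  unfolding W_set_def
proof (rule sets_infinitely_often_words)
  fix w
  have "closed {x. T_word A t w x \<in> cball (xs (length w)) (radius A h (length w))}"
    unfolding mem_cball by (intro closed_Collect_le continuous_intros continuous_T_word)
  then show "{x. T_word A t w x \<in> cball (xs (length w)) (radius A h (length w))} \<in> sets borel"
    by (rule borel_closed)
qed

lemma R_set_borel: "R_set A t h \<in> sets borel"
  unfolding R_set_def
proof (rule sets_infinitely_often_words)
  fix w
  have "closed {x. T_word A t w x \<in> cball x (radius A h (length w))}"
    unfolding mem_cball by (intro closed_Collect_le continuous_intros continuous_T_word)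
  then show "{x. T_word A t w x \<in> cball x (radius A h (length w))} \<in> sets borel"
    by (rule borel_closed)
qed

text \<open>The half-widths are divided by the dimension so that the box about \<open>S\<^sub>w z\<close> is mapped by \<open>T\<^sub>w\<close> into the
  Euclidean ball about \<open>z\<close> with the prescribed radius.\<close>

definition limsup_set :: "(real^'d)^'i \<Rightarrow> ('i list \<Rightarrow> real^'d) \<Rightarrow> (nat \<Rightarrow> real) \<Rightarrow> (real^'d) set"
  where "limsup_set t y h = {x \<in> X t. infinite {w. w \<noteq> [] \<and>
    x \<in> abox (y w) (\<lambda>k. radius A h (length w) * ratio k ^ length w / real CARD('d))}}"

lemma limsup_set_borel: "limsup_set t y h \<in> sets borel"
  unfolding limsup_set_def by (rule sets_infinitely_often_words) simp

text \<open>Deleting every word that occurs in a close pair leaves at least half of the words on a good level.\<close>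

definition isolated_words :: "(real^'d)^'i \<Rightarrow> real \<Rightarrow> nat \<Rightarrow> 'i list set"
  where "isolated_words t s n = {w. length w = n} - fst ` close_pairs t s n"

lemma card_isolated_words:
  assumes "n \<in> good_levels t s"
  shows "real (card (isolated_words t s n)) \<le> real CARD('i) ^ n"
    and "real CARD('i) ^ n / 2 \<le> real (card (isolated_words t s n))"
proof -
  have "card (isolated_words t s n) \<le> CARD('i) ^ n"
    unfolding card_words[symmetric] isolated_words_def by (intro card_mono finite_words) auto
  then show "real (card (isolated_words t s n)) \<le> real CARD('i) ^ n"
    by (metis of_nat_le_iff of_nat_power)
  have fin: "finite (close_pairs t s n)"
    by (rule finite_subset[OF _ finite_word_pairs[of n]]) (auto simp: close_pairs_def)
  have "real (CARD('i) ^ n) \<le> real (card (isolated_words t s n) + card (fst ` close_pairs t s n))"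
    unfolding card_words[symmetric] isolated_words_def
    using diff_card_le_card_Diff[of "fst ` close_pairs t s n" "{w. length w = n}"] fin
    by (intro of_nat_mono) simp
  also have "\<dots> \<le> real (card (isolated_words t s n)) + real (card (close_pairs t s n))"
    using card_image_le[OF fin, of fst] by simp
  also have "\<dots> \<le> real (card (isolated_words t s n)) + real CARD('i) ^ n / 2"
    using assms by (simp add: good_levels_def)
  finally show "real CARD('i) ^ n / 2 \<le> real (card (isolated_words t s n))" by simp
qed

lemma isolated_words_separated:
  assumes "v \<in> isolated_words t s n" "w \<in> isolated_words t s n" "v \<noteq> w"
  shows "\<exists>k. s * \<alpha> k ^ n < \<bar>S t v 0 $ k - S t w 0 $ k\<bar>"
proof -
  have "(v, w) \<notin> close_pairs t s n" "(v, w) \<in> word_pairs n"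
    using assms by (force simp: isolated_words_def word_pairs_def)+
  then show ?thesis
    by (auto simp: close_pairs_def close_event_def word_pairs_def \<alpha>_def power_divide not_le)
qed

text \<open>The constant \<open>c\<close> is chosen before the scaling \<open>C\<close> and the centres \<open>y\<close>: it depends only on the separation
  \<open>s\<close>, which is determined by \<open>t\<close> and \<open>h\<close>. The second condition on \<open>y\<close> says that the centres
  are at least as separated as the points \<open>S\<^sub>w 0\<close>. For the application of the limsup lemma \<open>h / C\<close> is truncated at
  a multiple of \<open>s ^ d\<close>; then the boxes shrink to their centres, and as \<open>X t\<close> is closed
  the limsup set is contained in it.\<close>

lemma limsup_set_measure:
  assumes t: "typical t" and h: "h \<in> H_class"
  shows "\<exists>c>0. \<forall>C>0. \<forall>y. (\<forall>w. w \<noteq> [] \<longrightarrow> y w \<in> X t) \<longrightarrow>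
      (\<forall>v w k. length v = length w \<longrightarrow> v \<noteq> [] \<longrightarrow> \<bar>S t v 0 $ k - S t w 0 $ k\<bar> \<le> \<bar>y v $ k - y w $ k\<bar>) \<longrightarrow>
      ennreal c \<le> emeasure lborel (limsup_set t y (\<lambda>n. h n / C))"
proof -
  let ?d = "real CARD('d)"
  obtain \<epsilon> where e: "0 < \<epsilon>" and hn: "\<And>n. 1 \<le> n \<Longrightarrow> 0 \<le> h n"
    and hB: "\<And>B. B \<subseteq> {1..} \<Longrightarrow> ereal (1 - \<epsilon>) < upper_density B \<Longrightarrow> (\<Sum>\<^sub>\<infinity>n\<in>B. ennreal (h n)) = \<infinity>"
    using h by (auto simp: H_class_def H_eps_def)
  obtain s where s: "0 < s" "ereal (1 - \<epsilon>) < upper_density (good_levels t s)"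
    using t e by (auto simp: typical_def)
  define G where "G = good_levels t s"
  have G1: "n \<in> G \<Longrightarrow> 1 \<le> n" for n by (simp add: G_def good_levels_def)
  define hG where "hG n = (if n \<in> G then h n else 0)" for n
  have hG0: "0 \<le> hG n" for n using hn G1 by (simp add: hG_def)
  have div: "\<not> summable hG"
    unfolding hG_def[abs_def]
    by (rule not_summable_if_infsum_infinite) (use hn G1 hB[of G] s in \<open>auto simp: G_def\<close>)
  define c where "c = (2 ^ CARD('d) / 2)\<^sup>2 / (8 ^ CARD('d) * (4 + 1 / s ^ CARD('d)))"
  have c: "0 < c" using s by (simp add: c_def add_pos_pos)
  show ?thesis
  proof (intro exI[of _ c] conjI c allI impI)
    fix C :: real and y :: "'i list \<Rightarrow> real^'d"
    assume C: "0 < C" and yX: "\<forall>w. w \<noteq> [] \<longrightarrow> y w \<in> X t"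
      and y_sep: "\<forall>v w k. length v = length w \<longrightarrow> v \<noteq> [] \<longrightarrow> \<bar>S t v 0 $ k - S t w 0 $ k\<bar> \<le> \<bar>y v $ k - y w $ k\<bar>"
    define g where "g n = min (hG n / C) ((s / 2) ^ CARD('d))" for n
    have g0: "0 \<le> g n" for n using hG0[of n] C s by (simp add: g_def)
    define \<eta> where "\<eta> n = g n powr (1 / ?d) / ?d" for n
    have \<eta>0: "0 \<le> \<eta> n" for n by (simp add: \<eta>_def)
    have \<eta>_pow: "\<eta> n ^ CARD('d) = g n / ?d ^ CARD('d)" for n
    proof -
      have "(g n powr (1 / ?d)) ^ CARD('d) = g n"
        using g0[of n] by (cases "g n = 0") (simp_all add: powr_powr flip: powr_realpow)
      then show ?thesis by (simp add: \<eta>_def power_divide)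
    qed
    have \<eta>_le: "\<eta> n \<le> s / 2" for n
    proof -
      have "g n powr (1 / ?d) \<le> ((s / 2) ^ CARD('d)) powr (1 / ?d)"
        using g0[of n] by (intro powr_mono2) (auto simp: g_def)
      also have "\<dots> = s / 2" using s by (simp add: powr_powr flip: powr_realpow)
      finally have "\<eta> n \<le> s / 2 / ?d" unfolding \<eta>_def by (intro divide_right_mono) auto
      also have "\<dots> \<le> s / 2 / 1" using s by (intro divide_left_mono) (auto simp: Suc_le_eq)
      finally show ?thesis by simp
    qed
    \<comment> \<open>Truncation at \<open>(s / 2) ^ d\<close> ensures \<open>\<eta> \<le> s / 2\<close> without destroying the divergence.\<close>
    let ?E = "box_union \<alpha> (isolated_words t s) (\<lambda>_. y) \<eta>"
    obtain R where R: "\<And>x. x \<in> X t \<Longrightarrow> norm x \<le> R"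
      using compact_imp_bounded[OF X_compact[of t]] unfolding bounded_iff by blast
    have len: "w \<in> isolated_words t s n \<Longrightarrow> length w = n" for w n by (simp add: isolated_words_def)
    have ne: "n \<in> G \<Longrightarrow> w \<in> isolated_words t s n \<Longrightarrow> w \<noteq> []" for w n
      using len[of w n] G1[of n] by auto
    have "ennreal c \<le> emeasure lborel {x. \<exists>\<^sub>\<infinity>n. n \<in> G \<and> x \<in> ?E n}"
      unfolding c_def
    proof (rule limsup_box_union_measure[where \<mu> = "real CARD('i)"])
      show "\<exists>k. s * \<alpha> k ^ n < \<bar>y v $ k - y w $ k\<bar>"
        if vw: "n \<in> G" "v \<in> isolated_words t s n" "w \<in> isolated_words t s n" "v \<noteq> w" for n v w
      proof -
        obtain k where k: "s * \<alpha> k ^ n < \<bar>S t v 0 $ k - S t w 0 $ k\<bar>"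
          using isolated_words_separated[OF vw(2-4)] by blast
        also have "\<dots> \<le> \<bar>y v $ k - y w $ k\<bar>"
          using y_sep[rule_format, of v w k] len[OF vw(2)] len[OF vw(3)] ne[OF vw(1,2)] by simp
        finally show ?thesis by blast
      qed
      show "\<bar>y w $ k\<bar> \<le> R" if "n \<in> G" "w \<in> isolated_words t s n" for n w k
        using R[OF yX[rule_format, OF ne[OF that]]] component_le_norm_cart[of "y w" k] by linarith
      show "\<not> summable (\<lambda>n. if n \<in> G then \<eta> n ^ CARD('d) else 0)"
      proof
        assume "summable (\<lambda>n. if n \<in> G then \<eta> n ^ CARD('d) else 0)"
        moreover have "(\<lambda>n. if n \<in> G then \<eta> n ^ CARD('d) else 0) = (\<lambda>n. g n / ?d ^ CARD('d))"
          using s by (auto simp: \<eta>_pow g_def hG_def)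
        ultimately have "summable (\<lambda>n. g n / ?d ^ CARD('d) * ?d ^ CARD('d))"
          by (simp only: summable_mult2)
        then have "summable g" by simp
        then show False
          using not_summable_min[OF div hG0 C, of "(s / 2) ^ CARD('d)"] s by (simp add: g_def[abs_def])
      qed
      show "finite (isolated_words t s n)" for n by (simp add: isolated_words_def finite_words)
    qed (use \<alpha>_pos \<alpha>_le_half prod_\<alpha> s \<eta>0 \<eta>_le card_isolated_words in \<open>auto simp: G_def\<close>)
    also have "\<dots> \<le> emeasure lborel (limsup_set t y (\<lambda>n. h n / C))"
    proof (rule emeasure_mono)
      show "{x. \<exists>\<^sub>\<infinity>n. n \<in> G \<and> x \<in> ?E n} \<subseteq> limsup_set t y (\<lambda>n. h n / C)"
      proof
        fix x assume "x \<in> {x. \<exists>\<^sub>\<infinity>n. n \<in> G \<and> x \<in> ?E n}"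
        then have x: "\<exists>\<^sub>\<infinity>n. n \<in> G \<and> x \<in> ?E n" by simp
        have "x \<in> X t"
        proof (rule closed_approximable)
          fix e :: real assume "0 < e"
          then obtain m where m: "(1/2) ^ m * (s / 2) \<le> e" using half_power_le by blast
          obtain n where n: "m \<le> n" "n \<in> G" "x \<in> ?E n" using x unfolding INFM_nat_le by blast
          then obtain w where w: "w \<in> isolated_words t s n" "x \<in> abox (y w) (\<lambda>k. \<eta> n * \<alpha> k ^ n)"
            by (auto simp: box_union_def)
          have "\<bar>x $ k - y w $ k\<bar> \<le> e" for k
          proof -
            have "\<bar>x $ k - y w $ k\<bar> \<le> \<eta> n * \<alpha> k ^ n" using w(2) by (simp add: abox_def)
            also have "\<dots> \<le> s / 2 * (1/2) ^ n"
              using \<eta>_le[of n] \<eta>0[of n] \<alpha>_pos[of k] \<alpha>_le_half[of k] s by (intro mult_mono power_mono) auto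
            also have "\<dots> \<le> s / 2 * (1/2) ^ m"
              using n(1) s by (intro mult_left_mono power_decreasing) auto
            finally show ?thesis using m by (simp add: mult.commute)
          qed
          then show "\<exists>z\<in>X t. \<forall>k. \<bar>x $ k - z $ k\<bar> \<le> e" using yX ne[OF n(2) w(1)] by blast
        qed (simp add: X_compact compact_imp_closed)
        moreover have "infinite {w. w \<noteq> [] \<and>
          x \<in> abox (y w) (\<lambda>k. radius A (\<lambda>n. h n / C) (length w) * ratio k ^ length w / ?d)}"
          unfolding infinite_words_iff
        proof (rule INFM_mono[OF x])
          fix n assume n: "n \<in> G \<and> x \<in> ?E n"
          then obtain w where w: "w \<in> isolated_words t s n" "x \<in> abox (y w) (\<lambda>k. \<eta> n * \<alpha> k ^ n)"
            by (auto simp: box_union_def)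
          have le: "\<eta> n * \<alpha> k ^ n \<le> radius A (\<lambda>n. h n / C) n * ratio k ^ n / ?d" for k
          proof -
            have "0 \<le> h n / C" using hn[OF G1] n C by simp
            moreover have "g n powr (1 / ?d) \<le> (h n / C) powr (1 / ?d)"
              using g0[of n] n by (intro powr_mono2) (auto simp: g_def hG_def)
            ultimately show ?thesis
              using \<alpha>_pos[of k]
              by (subst radius_mult_ratio) (auto simp: \<eta>_def intro!: divide_right_mono mult_right_mono)
          qed
          then have "x \<in> abox (y w) (\<lambda>k. radius A (\<lambda>n. h n / C) (length w) * ratio k ^ length w / ?d)"
            using w(2) unfolding abox_def mem_Collect_eq len[OF w(1)] by (meson le order_trans)
          then show "\<exists>w. length w = n \<and> 1 \<le> n \<and>
              x \<in> abox (y w) (\<lambda>k. radius A (\<lambda>n. h n / C) (length w) * ratio k ^ length w / ?d)"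
            using len[OF w(1)] G1 n by blast
        qed
        ultimately show "x \<in> limsup_set t y (\<lambda>n. h n / C)" by (simp add: limsup_set_def)
      qed
    qed (simp add: limsup_set_borel)
    finally show "ennreal c \<le> emeasure lborel (limsup_set t y (\<lambda>n. h n / C))" .
  qed
qed

lemma T_word_near:
  assumes "x \<in> abox (S t w z) (\<lambda>k. r * ratio k ^ length w / real CARD('d))"
  shows "\<bar>T_word A t w x $ k - z $ k\<bar> \<le> r / real CARD('d)"
proof -
  have "\<bar>x $ k - S t w z $ k\<bar> = ratio k ^ length w * \<bar>T_word A t w x $ k - z $ k\<bar>"
    using ratio_power_pos[of k "length w"] S_nth[of t w "T_word A t w x" k] S_nth[of t w z k]
    by (simp add: S_T_word abs_mult flip: right_diff_distrib)
  then have "ratio k ^ length w * \<bar>T_word A t w x $ k - z $ k\<bar> \<le> ratio k ^ length w * (r / real CARD('d))"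
    using assms unfolding abox_def mem_Collect_eq by (metis mult.commute times_divide_eq_left)
  then show ?thesis using ratio_power_pos[of k "length w"] by (simp only: mult_le_cancel_left_pos)
qed

lemma limsup_set_subset_W_set: "limsup_set t (\<lambda>w. S t w (xs (length w))) h \<subseteq> W_set A t xs h"
  unfolding limsup_set_def W_set_def mem_cball
  by (auto intro!: dist_le_if_components_le T_word_near elim!: infinite_super[rotated])

text \<open>With \<open>p\<close> the fixed point of \<open>S\<^sub>w\<close> and \<open>u = T\<^sub>w x\<close>, the components satisfy
  \<open>u - x = (1 - a\<^sub>k\<^sup>n) (u - p)\<close>: returning close to \<open>x\<close> follows from coming close to \<open>p\<close>.\<close>

lemma limsup_set_subset_R_set: "limsup_set t (fixed_point t) h \<subseteq> R_set A t h"
proof -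
  have "dist x (T_word A t w x) \<le> radius A h (length w)"
    if w: "w \<noteq> []" and x: "x \<in> abox (fixed_point t w) (\<lambda>k. radius A h (length w) * ratio k ^ length w / real CARD('d))" for w x
  proof (rule dist_le_if_components_le)
    fix k
    let ?p = "fixed_point t w" and ?u = "T_word A t w x"
    have "x $ k - ?p $ k = ratio k ^ length w * (?u $ k - ?p $ k)"
      using S_nth[of t w ?u k] S_nth[of t w ?p k] by (simp add: S_T_word S_fixed_point[OF w] algebra_simps)
    then have "?u $ k - x $ k = (1 - ratio k ^ length w) * (?u $ k - ?p $ k)" by (simp add: algebra_simps)
    then have "\<bar>?u $ k - x $ k\<bar> = (1 - ratio k ^ length w) * \<bar>?u $ k - ?p $ k\<bar>"
      using one_minus_ratio_power(1)[OF w, of k] by (simp add: abs_mult)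
    also have "\<dots> \<le> 1 * \<bar>?u $ k - ?p $ k\<bar>"
      using one_minus_ratio_power(2)[OF w, of k] by (intro mult_right_mono) auto
    also have "\<bar>?u $ k - ?p $ k\<bar> \<le> radius A h (length w) / real CARD('d)"
      using x by (intro T_word_near) (simp add: S_fixed_point[OF w])
    finally show "\<bar>?u $ k - x $ k\<bar> \<le> radius A h (length w) / real CARD('d)" by simp
  qed
  then show ?thesis
    unfolding limsup_set_def R_set_def mem_cball by (auto elim!: infinite_super[rotated])
qed

lemma W_set_positive:
  assumes t: "typical t" and h: "h \<in> H_class" and xs: "\<And>n. 1 \<le> n \<Longrightarrow> xs n \<in> X t"
  shows "0 < emeasure lebesgue (W_set A t xs h)"
proof -
  let ?y = "\<lambda>w. S t w (xs (length w))"
  obtain c where c: "0 < c" and *: "\<And>y. (\<forall>w. w \<noteq> [] \<longrightarrow> y w \<in> X t) \<Longrightarrow>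
      (\<forall>v w k. length v = length w \<longrightarrow> v \<noteq> [] \<longrightarrow> \<bar>S t v 0 $ k - S t w 0 $ k\<bar> \<le> \<bar>y v $ k - y w $ k\<bar>) \<Longrightarrow>
      ennreal c \<le> emeasure lborel (limsup_set t y (\<lambda>n. h n / 1))"
    using limsup_set_measure[OF t h] zero_less_one by metis
  have "ennreal c \<le> emeasure lborel (limsup_set t ?y (\<lambda>n. h n / 1))"
  proof (rule *)
    show "\<forall>w. w \<noteq> [] \<longrightarrow> ?y w \<in> X t" using xs by (auto intro!: S_in_X simp: Suc_le_eq)
    show "\<forall>v w k. length v = length w \<longrightarrow> v \<noteq> [] \<longrightarrow> \<bar>S t v 0 $ k - S t w 0 $ k\<bar> \<le> \<bar>?y v $ k - ?y w $ k\<bar>"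
    proof (intro allI impI)
      fix v w :: "'i list" and k assume "length v = length w"
      then show "\<bar>S t v 0 $ k - S t w 0 $ k\<bar> \<le> \<bar>?y v $ k - ?y w $ k\<bar>"
        using S_nth[of t v "xs (length v)" k] S_nth[of t w "xs (length w)" k] by simp
    qed
  qed
  also have "\<dots> \<le> emeasure lborel (W_set A t xs h)"
    using limsup_set_subset_W_set[of t xs h] W_set_borel by (intro emeasure_mono) auto
  finally have "0 < emeasure lborel (W_set A t xs h)" using c by (auto simp: less_le_trans[of 0 "ennreal c"])
  then show ?thesis using W_set_borel by simp
qed

text \<open>Differences of fixed points are those of the points \<open>S\<^sub>w 0\<close> divided by \<open>1 - a\<^sub>k\<^sup>n \<le> 1\<close>, hence at least as
  large.\<close>

lemma R_set_positive:
  assumes t: "typical t" and h: "h \<in> H_class"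
  shows "0 < emeasure lebesgue (R_set A t h)"
proof -
  obtain c where c: "0 < c" and *: "\<And>y. (\<forall>w. w \<noteq> [] \<longrightarrow> y w \<in> X t) \<Longrightarrow>
      (\<forall>v w k. length v = length w \<longrightarrow> v \<noteq> [] \<longrightarrow> \<bar>S t v 0 $ k - S t w 0 $ k\<bar> \<le> \<bar>y v $ k - y w $ k\<bar>) \<Longrightarrow>
      ennreal c \<le> emeasure lborel (limsup_set t y (\<lambda>n. h n / 1))"
    using limsup_set_measure[OF t h] zero_less_one by metis
  have "ennreal c \<le> emeasure lborel (limsup_set t (fixed_point t) (\<lambda>n. h n / 1))"
  proof (rule *)
    show "\<forall>w. w \<noteq> [] \<longrightarrow> fixed_point t w \<in> X t" using fixed_point_in_X by blast
    show "\<forall>v w k. length v = length w \<longrightarrow> v \<noteq> [] \<longrightarrow>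
      \<bar>S t v 0 $ k - S t w 0 $ k\<bar> \<le> \<bar>fixed_point t v $ k - fixed_point t w $ k\<bar>"
    proof (intro allI impI)
      fix v w :: "'i list" and k assume vw: "length v = length w" "v \<noteq> []"
      let ?q = "1 - ratio k ^ length v"
      have q: "0 < ?q" "?q \<le> 1" using one_minus_ratio_power[OF vw(2)] by auto
      have "\<bar>S t v 0 $ k - S t w 0 $ k\<bar> / 1 \<le> \<bar>S t v 0 $ k - S t w 0 $ k\<bar> / ?q"
        using q by (intro divide_left_mono) auto
      also have "\<dots> = \<bar>fixed_point t v $ k - fixed_point t w $ k\<bar>"
        using q vw(1) by (simp add: fixed_point_def flip: diff_divide_distrib)
      finally show "\<bar>S t v 0 $ k - S t w 0 $ k\<bar> \<le> \<bar>fixed_point t v $ k - fixed_point t w $ k\<bar>" by simp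
    qed
  qed
  also have "\<dots> \<le> emeasure lborel (R_set A t h)"
    using limsup_set_subset_R_set[of t h] R_set_borel by (intro emeasure_mono) auto
  finally have "0 < emeasure lborel (R_set A t h)" using c by (auto simp: less_le_trans[of 0 "ennreal c"])
  then show ?thesis using R_set_borel by simp
qed

end

section \<open>From positive measure to full measure\<close>

context equal_diagonal_ifs
begin

lemma emeasure_S_image_minus:
  assumes Z: "Z \<in> sets borel"
  shows "(\<lambda>z. S t w z - y) ` Z \<in> sets borel"
    and "emeasure lborel ((\<lambda>z. S t w z - y) ` Z)
      = ennreal ((\<Prod>k\<in>UNIV. ratio k) ^ length w) * emeasure lborel Z"
proof -
  let ?c = "(\<chi> k. ratio k ^ length w) :: real^'d"
  have eq: "(\<lambda>z. S t w z - y) = (\<lambda>x. \<chi> k. ?c $ k * x $ k + (S t w 0 - y) $ k)"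
  proof
    fix z show "S t w z - y = (\<chi> k. ?c $ k * z $ k + (S t w 0 - y) $ k)"
      by (simp add: vec_eq_iff S_nth[of t w z])
  qed
  have c: "0 < ?c $ k" for k using ratio_power_pos by simp
  show "(\<lambda>z. S t w z - y) ` Z \<in> sets borel"
    unfolding eq by (rule emeasure_diagonal_affine_image(1)[OF c Z])
  show "emeasure lborel ((\<lambda>z. S t w z - y) ` Z)
      = ennreal ((\<Prod>k\<in>UNIV. ratio k) ^ length w) * emeasure lborel Z"
    unfolding eq emeasure_diagonal_affine_image(2)[OF c Z] by (simp add: prod_power_distrib)
qed

lemma S_image_borel: "Z \<in> sets borel \<Longrightarrow> S t w ` Z \<in> sets borel"
  using emeasure_S_image_minus(1)[of Z t w 0] by simp

text \<open>Let \<open>y\<close> be an uncovered point and \<open>w\<close> a word of length \<open>n\<close> with \<open>y \<in> S\<^sub>w X\<close>. The covered set \<open>S\<^sub>w Z\<close> lies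
  in the box of half-widths \<open>R * ratio k ^ n\<close> about \<open>y\<close> and takes up a proportion of it that is
  independent of \<open>n\<close>. So the uncovered set is uniformly porous.\<close>

lemma X_diff_images_null:
  assumes Z: "Z \<in> sets borel" "Z \<subseteq> X t" "emeasure lborel Z \<noteq> 0"
  shows "X t - (\<Union>w. S t w ` Z) \<in> null_sets lborel"
proof -
  define Y where "Y = (\<Union>w. S t w ` Z)"
  let ?\<pi> = "\<Prod>k\<in>UNIV. ratio k"
  have Yb: "Y \<in> sets borel" unfolding Y_def using S_image_borel[OF Z(1)] by blast
  obtain B where B: "\<And>x. x \<in> X t \<Longrightarrow> norm x \<le> B"
    using compact_imp_bounded[OF X_compact[of t]] unfolding bounded_iff by blast
  define R where "R = 2 * \<bar>B\<bar> + 1"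
  have R: "0 < R" by (simp add: R_def)
  have XR: "\<bar>x $ k - y $ k\<bar> \<le> R" if "x \<in> X t" "y \<in> X t" for x y k
    using component_le_norm_cart[of x k] component_le_norm_cart[of y k] B[OF that(1)] B[OF that(2)]
    unfolding R_def by linarith
  define P where "P n = abox (0::real^'d) (\<lambda>k. R * ratio k ^ n)" for n
  have P: "emeasure lborel (P n) = ennreal ((2 * R) ^ CARD('d) * ?\<pi> ^ n)" for n
  proof -
    have "measure lborel (P n) = (2 * R) ^ CARD('d) * ?\<pi> ^ n"
      unfolding P_def using R ratio_power_pos by (subst measure_abox) (auto simp: prod_box_sides less_imp_le)
    then show ?thesis unfolding P_def by (simp add: emeasure_eq_measure2[OF abox_fmeasurable])
  qed
  have \<pi>: "0 < ?\<pi>" using ratio_pos by (simp add: prod_pos)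
  have "emeasure lborel Z \<le> emeasure lborel (X t)" using Z by (intro emeasure_mono) auto
  then have Zfin: "emeasure lborel Z \<noteq> \<infinity>"
    using emeasure_bounded_finite[OF compact_imp_bounded[OF X_compact[of t]]] by (auto simp: top_unique)
  define z where "z = measure lborel Z"
  have z: "emeasure lborel Z = ennreal z" "0 < z"
    using Z(3) Zfin emeasure_eq_ennreal_measure[of lborel Z] measure_nonneg[of lborel Z]
    by (auto simp: z_def less_le)
  have "X t - Y \<in> null_sets lborel"
  proof (rule null_set_if_uniformly_porous[where P = P and c = "z / (2 * R) ^ CARD('d)"])
    show "X t - Y \<in> sets borel" using Yb by simp
    show "bounded (X t - Y)" using X_compact[of t] by (meson Diff_subset bounded_subset compact_imp_bounded)
    show "0 < z / (2 * R) ^ CARD('d)" using z R by simp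
    show "P n \<in> sets borel" for n by (simp add: P_def)
    show "emeasure lborel (P n) \<noteq> 0" for n
    proof -
      have "0 < (2 * R) ^ CARD('d) * ?\<pi> ^ n" using R \<pi> by (intro mult_pos_pos zero_less_power) auto
      then show ?thesis unfolding P by (metis ennreal_eq_0_iff not_le)
    qed
    show "emeasure lborel (P n) \<noteq> \<infinity>" for n unfolding P by simp
    show "\<exists>n. P n \<subseteq> ball 0 e" if "0 < e" for e
    proof -
      have "0 < e / (2 * real CARD('d))" using that by simp
      then obtain n where n: "(1/2) ^ n * R \<le> e / (2 * real CARD('d))" using half_power_le by blast
      have "norm u < e" if "u \<in> P n" for u
      proof -
        have "\<bar>u $ k\<bar> \<le> e / (2 * real CARD('d))" for k
        proof -
          have "\<bar>u $ k\<bar> \<le> R * ratio k ^ n" using that by (simp add: P_def abox_def)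
          also have "\<dots> \<le> R * (1/2) ^ n" using R by (intro mult_left_mono ratio_power_le) simp
          finally show ?thesis using n by (simp add: mult.commute)
        qed
        then have "(\<Sum>k\<in>UNIV. \<bar>u $ k\<bar>) \<le> (\<Sum>k\<in>(UNIV::'d set). e / (2 * real CARD('d)))"
          by (intro sum_mono)
        also have "\<dots> < e" using \<open>0 < e\<close> by simp
        finally show ?thesis using norm_le_l1_cart[of u] by linarith
      qed
      then show ?thesis by (intro exI[of _ n]) auto
    qed
    show "ennreal (z / (2 * R) ^ CARD('d)) * emeasure lborel (P n)
        \<le> emeasure lborel {u \<in> P n. y + u \<notin> X t - Y}" if y: "y \<in> X t - Y" for n y
    proof -
      obtain w x where w: "length w = n" "x \<in> X t" "y = S t w x"
        using X_covered[of y t n] y by blast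
      have sub: "(\<lambda>z. S t w z - y) ` Z \<subseteq> {u \<in> P n. y + u \<notin> X t - Y}"
      proof clarify
        fix z assume "z \<in> Z"
        have "\<bar>(S t w z - y) $ k\<bar> \<le> R * ratio k ^ n" for k
        proof -
          have "\<bar>(S t w z - y) $ k\<bar> = ratio k ^ n * \<bar>z $ k - x $ k\<bar>"
            using ratio_power_pos[of k n] w
            by (simp add: S_nth[of t w z] S_nth[of t w x] abs_mult flip: right_diff_distrib)
          also have "\<dots> \<le> ratio k ^ n * R"
            using ratio_power_pos[of k n] \<open>z \<in> Z\<close> Z(2) w(2) by (intro mult_left_mono XR) auto
          finally show ?thesis by (simp add: mult.commute)
        qed
        moreover have "S t w z \<in> Y" using \<open>z \<in> Z\<close> by (auto simp: Y_def)
        ultimately show "S t w z - y \<in> P n \<and> y + (S t w z - y) \<notin> X t - Y"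
          by (simp add: P_def abox_def)
      qed
      have meas: "{u \<in> P n. y + u \<notin> X t - Y} \<in> sets lborel"
      proof -
        have [measurable]: "P n \<in> sets borel" "X t - Y \<in> sets borel"
          using Yb by (simp_all add: P_def)
        show ?thesis by measurable
      qed
      have "ennreal (z / (2 * R) ^ CARD('d)) * emeasure lborel (P n) = ennreal (?\<pi> ^ n) * ennreal z"
        unfolding P using R z \<pi> by (simp add: mult.commute flip: ennreal_mult)
      also have "\<dots> = emeasure lborel ((\<lambda>z. S t w z - y) ` Z)"
        using emeasure_S_image_minus(2)[OF Z(1), of t w y] w z by simp
      also have "\<dots> \<le> emeasure lborel {u \<in> P n. y + u \<notin> X t - Y}"
        by (rule emeasure_mono[OF sub meas])
      finally show ?thesis .
    qed
  qed
  then show ?thesis by (simp only: Y_def)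
qed

text \<open>Prefixing a word of length \<open>l\<close> moves a hit from level \<open>n\<close> to level \<open>l + n\<close>, where the admissible radius is
  smaller by a factor that is bounded in terms of \<open>l\<close>, by regular decay. A large divisor \<open>c\<close> pays for it in advance.\<close>

lemma radius_shift:
  assumes h: "decaying_regularly h" and C: "0 < C"
  obtains C' where "0 < C'"
    "\<And>n c. 1 \<le> n \<Longrightarrow> C' \<le> c \<Longrightarrow> radius A (\<lambda>n. h n / c) n \<le> radius A (\<lambda>n. h n / C) (l + n)"
proof -
  have hpos: "\<And>n. 1 \<le> n \<Longrightarrow> 0 < h n" using h by (auto simp: decaying_regularly_def)
  obtain q where q: "0 < q" "\<And>n l. 1 \<le> n \<Longrightarrow> q ^ l * h n \<le> h (n + l)"
    using regular_decay_power[OF h] by metis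
  define C' where "C' = C * lam A ^ l / q ^ l"
  have lp: "0 < lam A ^ n" for n using lam_gt_1 by simp
  have C': "0 < C'" using C q lp by (simp add: C'_def)
  have "radius A (\<lambda>n. h n / c) n \<le> radius A (\<lambda>n. h n / C) (l + n)" if n: "1 \<le> n" and c: "C' \<le> c" for n c
  proof -
    have "h n / c / lam A ^ n \<le> h n / C' / lam A ^ n"
      using c C' hpos[OF n] lp by (intro divide_right_mono divide_left_mono) (auto simp: less_imp_le)
    also have "\<dots> = q ^ l * h n / C / lam A ^ (l + n)"
      by (simp add: C'_def power_add field_simps)
    also have "\<dots> \<le> h (n + l) / C / lam A ^ (l + n)"
      using q(2)[OF n, of l] C lp by (intro divide_right_mono) (auto simp: less_imp_le)
    finally have "h n / c / lam A ^ n \<le> h (l + n) / C / lam A ^ (l + n)" by (simp add: add.commute)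
    moreover have "0 \<le> h n / c / lam A ^ n"
      using c C' hpos[OF n] lp[of n] by simp
    ultimately show ?thesis unfolding radius_def by (intro powr_mono2) auto
  qed
  then show ?thesis using C' that by blast
qed

lemma limsup_set_mono:
  assumes "\<And>n. 1 \<le> n \<Longrightarrow> radius A h n \<le> radius A h' n"
  shows "limsup_set t y h \<subseteq> limsup_set t y h'"
proof -
  have "abox (y w) (\<lambda>k. radius A h (length w) * ratio k ^ length w / real CARD('d))
     \<subseteq> abox (y w) (\<lambda>k. radius A h' (length w) * ratio k ^ length w / real CARD('d))" if "w \<noteq> []" for w
  proof -
    have "radius A h (length w) * ratio k ^ length w / real CARD('d)
      \<le> radius A h' (length w) * ratio k ^ length w / real CARD('d)" for k
      using assms[of "length w"] that ratio_power_pos[of k "length w"]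
      by (intro divide_right_mono mult_right_mono) (auto simp: Suc_leI)
    then show ?thesis unfolding abox_def by (auto intro: order_trans)
  qed
  then show ?thesis unfolding limsup_set_def by (auto elim!: infinite_super[rotated])
qed

text \<open>Applying \<open>S\<^sub>v\<close> to a point costs a factor that depends on \<open>v\<close>. A point that is in the limsup sets of
  \<open>h / C\<close> for all \<open>C\<close> can pay any such factor, which is why all \<open>C\<close> are treated together.\<close>

lemma AE_in_W_sets:
  assumes t: "typical t" and h: "h \<in> H_class" "decaying_regularly h" and x: "x \<in> X t"
  shows "AE y in lborel. y \<in> X t \<longrightarrow> (\<forall>C>0. y \<in> W_set A t (\<lambda>_. x) (\<lambda>n. h n / C))"
proof -
  let ?y = "\<lambda>w. S t w x"
  have hpos: "\<And>n. 1 \<le> n \<Longrightarrow> 0 < h n" using h(2) by (auto simp: decaying_regularly_def)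
  obtain c where c: "0 < c" and *: "\<And>C y. 0 < C \<Longrightarrow> (\<forall>w. w \<noteq> [] \<longrightarrow> y w \<in> X t) \<Longrightarrow>
      (\<forall>v w k. length v = length w \<longrightarrow> v \<noteq> [] \<longrightarrow> \<bar>S t v 0 $ k - S t w 0 $ k\<bar> \<le> \<bar>y v $ k - y w $ k\<bar>) \<Longrightarrow>
      ennreal c \<le> emeasure lborel (limsup_set t y (\<lambda>n. h n / C))"
    using limsup_set_measure[OF t h(1)] by metis
  define Z where "Z j = limsup_set t ?y (\<lambda>n. h n / real (Suc j))" for j
  have Zb: "Z j \<in> sets lborel" for j by (simp add: Z_def limsup_set_borel)
  have ZX: "Z j \<subseteq> X t" for j by (auto simp: Z_def limsup_set_def)
  have Zc: "ennreal c \<le> emeasure lborel (Z j)" for j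
    unfolding Z_def
  proof (rule *)
    show "\<forall>w. w \<noteq> [] \<longrightarrow> ?y w \<in> X t" using x S_in_X by blast
    show "\<forall>v w k. length v = length w \<longrightarrow> v \<noteq> [] \<longrightarrow> \<bar>S t v 0 $ k - S t w 0 $ k\<bar> \<le> \<bar>?y v $ k - ?y w $ k\<bar>"
    proof (intro allI impI)
      fix v w :: "'i list" and k assume "length v = length w"
      then show "\<bar>S t v 0 $ k - S t w 0 $ k\<bar> \<le> \<bar>?y v $ k - ?y w $ k\<bar>"
        using S_nth[of t v x k] S_nth[of t w x k] by simp
    qed
  qed simp
  have dec: "decseq Z"
    unfolding decseq_Suc_iff
  proof
    fix j
    show "Z (Suc j) \<subseteq> Z j"
      unfolding Z_def
    proof (rule limsup_set_mono)
      fix n :: nat assume "1 \<le> n"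
      then have "h n / real (Suc (Suc j)) / lam A ^ n \<le> h n / real (Suc j) / lam A ^ n"
        using hpos[of n] lam_gt_1 by (intro divide_right_mono divide_left_mono) auto
      moreover have "0 \<le> h n / real (Suc (Suc j)) / lam A ^ n"
        using hpos[of n] \<open>1 \<le> n\<close> lam_gt_1 by simp
      ultimately show "radius A (\<lambda>n. h n / real (Suc (Suc j))) n \<le> radius A (\<lambda>n. h n / real (Suc j)) n"
        unfolding radius_def by (intro powr_mono2) auto
    qed
  qed
  have "ennreal c \<le> (INF j. emeasure lborel (Z j))" using Zc by (rule INF_greatest)
  also have "\<dots> = emeasure lborel (\<Inter>j. Z j)"
  proof (rule INF_emeasure_decseq)
    fix j
    have "emeasure lborel (Z j) \<le> emeasure lborel (X t)" using ZX by (intro emeasure_mono) auto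
    then show "emeasure lborel (Z j) \<noteq> \<infinity>"
      using emeasure_bounded_finite[OF compact_imp_bounded[OF X_compact[of t]]] by (auto simp: top_unique)
  qed (use Zb dec in auto)
  finally have "emeasure lborel (\<Inter>j. Z j) \<noteq> 0" using c by auto
  moreover have "(\<Inter>j. Z j) \<in> sets borel" "(\<Inter>j. Z j) \<subseteq> X t"
    using Zb ZX[of 0] by (simp, blast)
  ultimately have null: "X t - (\<Union>w. S t w ` (\<Inter>j. Z j)) \<in> null_sets lborel"
    by (intro X_diff_images_null)
  have inW: "S t v z \<in> W_set A t (\<lambda>_. x) (\<lambda>n. h n / C)" if z: "z \<in> (\<Inter>j. Z j)" and C: "0 < C" for v z C
  proof -
    obtain C' where C': "0 < C'"
      "\<And>n c. 1 \<le> n \<Longrightarrow> C' \<le> c \<Longrightarrow> radius A (\<lambda>n. h n / c) n \<le> radius A (\<lambda>n. h n / C) (length v + n)"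
      using radius_shift[OF h(2) C] by blast
    obtain j where "C' \<le> real j" using real_arch_simple by blast
    then have j: "C' \<le> real (Suc j)" by simp
    have "z \<in> W_set A t (\<lambda>_. x) (\<lambda>n. h n / real (Suc j))"
      using z limsup_set_subset_W_set[of t "\<lambda>_. x" "\<lambda>n. h n / real (Suc j)"] by (auto simp: Z_def)
    then have inf: "infinite {w. w \<noteq> [] \<and> T_word A t w z \<in> cball x (radius A (\<lambda>n. h n / real (Suc j)) (length w))}"
      and zX: "z \<in> X t"
      by (auto simp: W_set_def)
    have "infinite ((@) v ` {w. w \<noteq> [] \<and> T_word A t w z \<in> cball x (radius A (\<lambda>n. h n / real (Suc j)) (length w))})"
      using inf by (subst finite_image_iff) (auto simp: inj_on_def)
    moreover have "(@) v ` {w. w \<noteq> [] \<and> T_word A t w z \<in> cball x (radius A (\<lambda>n. h n / real (Suc j)) (length w))}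
      \<subseteq> {w. w \<noteq> [] \<and> T_word A t w (S t v z) \<in> cball x (radius A (\<lambda>n. h n / C) (length w))}"
    proof clarify
      fix w assume w: "w \<noteq> []" "T_word A t w z \<in> cball x (radius A (\<lambda>n. h n / real (Suc j)) (length w))"
      have "radius A (\<lambda>n. h n / real (Suc j)) (length w) \<le> radius A (\<lambda>n. h n / C) (length v + length w)"
        using w(1) j by (intro C'(2)) (auto simp: Suc_leI)
      then show "v @ w \<noteq> [] \<and> T_word A t (v @ w) (S t v z) \<in> cball x (radius A (\<lambda>n. h n / C) (length (v @ w)))"
        using w by (auto simp: T_word_append T_S_word)
    qed
    ultimately have "infinite {w. w \<noteq> [] \<and> T_word A t w (S t v z) \<in> cball x (radius A (\<lambda>n. h n / C) (length w))}"
      by (rule infinite_super[rotated])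
    then show ?thesis using S_in_X[OF zX] by (simp add: W_set_def)
  qed
  show ?thesis
  proof (rule AE_I'[OF null], rule subsetI)
    fix y assume "y \<in> {y \<in> space lborel. \<not> (y \<in> X t \<longrightarrow> (\<forall>C>0. y \<in> W_set A t (\<lambda>_. x) (\<lambda>n. h n / C)))}"
    then obtain C where y: "y \<in> X t" "0 < C" "y \<notin> W_set A t (\<lambda>_. x) (\<lambda>n. h n / C)" by auto
    have "y \<notin> S t w ` (\<Inter>j. Z j)" for w
    proof
      assume "y \<in> S t w ` (\<Inter>j. Z j)"
      then obtain z where "y = S t w z" "z \<in> (\<Inter>j. Z j)" by (rule imageE)
      then show False using inW[of z C w] y by simp
    qed
    then show "y \<in> X t - (\<Union>w. S t w ` (\<Inter>j. Z j))" using y by simp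
  qed
qed

lemma radius_small:
  assumes h: "decaying_regularly h" "decreasing h" and "0 < C" "0 < \<delta>"
  shows "\<exists>N. \<forall>n\<ge>N. 1 \<le> n \<longrightarrow> radius A (\<lambda>n. h n / C) n \<le> \<delta>"
proof -
  have hpos: "\<And>n. 1 \<le> n \<Longrightarrow> 0 < h n" using h(1) by (auto simp: decaying_regularly_def)
  have hle: "1 \<le> n \<Longrightarrow> h n \<le> h 1" for n
  proof (induction n rule: dec_induct)
    case (step n)
    then show ?case using h(2) by (force simp: decreasing_def)
  qed simp
  have "(\<lambda>n. h 1 / C * (1 / lam A) ^ n) \<longlonglongrightarrow> h 1 / C * 0"
    using lam_gt_1 by (intro tendsto_intros LIMSEQ_realpow_zero) auto
  then have "\<forall>\<^sub>F n in sequentially. h 1 / C * (1 / lam A) ^ n < \<delta> ^ CARD('d)"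
    using \<open>0 < \<delta>\<close> by (intro order_tendstoD) auto
  then obtain N where N: "\<And>n. N \<le> n \<Longrightarrow> h 1 / C * (1 / lam A) ^ n < \<delta> ^ CARD('d)"
    unfolding eventually_sequentially by blast
  have "radius A (\<lambda>n. h n / C) n \<le> \<delta>" if n: "N \<le> n" "1 \<le> n" for n
  proof -
    have "h n / C / lam A ^ n \<le> h 1 / C / lam A ^ n"
      using hle[OF n(2)] \<open>0 < C\<close> lam_gt_1 by (intro divide_right_mono) auto
    also have "\<dots> \<le> \<delta> ^ CARD('d)" using N[OF n(1)] by (simp add: power_one_over)
    finally have "(h n / C / lam A ^ n) powr (1 / real CARD('d)) \<le> (\<delta> ^ CARD('d)) powr (1 / real CARD('d))"
      using hpos[OF n(2)] \<open>0 < C\<close> lam_gt_1 by (intro powr_mono2) auto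
    also have "\<dots> = \<delta>" using \<open>0 < \<delta>\<close> by (simp add: powr_powr flip: powr_realpow)
    finally show ?thesis by (simp add: radius_def)
  qed
  then show ?thesis by blast
qed

text \<open>Outside a null set, every inverse image \<open>T\<^sub>u x\<close> that is in the self-affine set belongs to the sets \<open>W\<close> of
  \<open>p\<close> for all \<open>h / C\<close>. Hence from \<open>T\<^sub>u x\<close> there is a word \<open>w\<close> with \<open>T\<^sub>w (T\<^sub>u x)\<close> so close to \<open>p\<close> that
  it is in the self-affine set again and meets the requirement for the level of
  \<open>u @ w\<close>. Iterate.\<close>

lemma AE_branch_hits:
  assumes t: "typical t" and h: "h \<in> H_class" "decaying_regularly h" "decreasing h"
    and p: "p \<in> interior (X t)"
  shows "AE x in lborel. x \<in> X t \<longrightarrow>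
    (\<exists>j. infinite {n. n \<ge> 1 \<and> T_word A t (prefix_word j n) x \<in> cball p (radius A h n)})"
proof -
  have "p \<in> X t" using p interior_subset by blast
  then obtain N where N: "N \<in> null_sets lborel"
    and good: "\<And>y C. y \<in> X t \<Longrightarrow> y \<notin> N \<Longrightarrow> 0 < C \<Longrightarrow> y \<in> W_set A t (\<lambda>_. p) (\<lambda>n. h n / C)"
    using AE_in_W_sets[OF t h(1,2)] by (force elim!: AE_E3)
  obtain \<delta> where \<delta>: "0 < \<delta>" "cball p \<delta> \<subseteq> X t"
    using p by (auto simp: mem_interior_cball)
  have Nb: "N \<in> sets borel" using N by auto
  have "S t w ` N \<in> null_sets lborel" for w
    using emeasure_S_image_minus[OF Nb, of t w 0] N by (simp add: null_sets_def)
  then have bad: "(\<Union>w. S t w ` N) \<in> null_sets lborel" by (rule null_sets_UN)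
  have main: "\<exists>j. infinite {n. n \<ge> 1 \<and> T_word A t (prefix_word j n) x \<in> cball p (radius A h n)}"
    if x: "x \<in> X t" "x \<notin> (\<Union>w. S t w ` N)" for x
  proof -
    have notN: "T_word A t u x \<notin> N" for u
      using x(2) S_T_word[of t u x] by (metis UN_I UNIV_I imageI)
    define Q where "Q u u' \<longleftrightarrow> (\<exists>w. w \<noteq> [] \<and> u' = u @ w) \<and> T_word A t u' x \<in> cball p (radius A h (length u'))"
      for u u' :: "'i list"
    \<comment> \<open>\<open>Q u u'\<close>: the word \<open>u'\<close> properly extends \<open>u\<close> and is a hit.\<close>
    have step: "\<exists>u'. T_word A t u' x \<in> X t \<and> Q u u'" if u: "T_word A t u x \<in> X t" for u
    proof -
      obtain C where C: "0 < C"
        "\<And>n c. 1 \<le> n \<Longrightarrow> C \<le> c \<Longrightarrow> radius A (\<lambda>n. h n / c) n \<le> radius A (\<lambda>n. h n / 1) (length u + n)"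
        using radius_shift[OF h(2) zero_less_one] by blast
      obtain M where M: "\<And>n. M \<le> n \<Longrightarrow> 1 \<le> n \<Longrightarrow> radius A (\<lambda>n. h n / C) n \<le> \<delta>"
        using radius_small[OF h(2,3) C(1) \<delta>(1)] by blast
      have "T_word A t u x \<in> W_set A t (\<lambda>_. p) (\<lambda>n. h n / C)" by (rule good[OF u notN C(1)])
      then have "infinite {w. w \<noteq> [] \<and> T_word A t w (T_word A t u x) \<in> cball p (radius A (\<lambda>n. h n / C) (length w))}"
        by (simp add: W_set_def)
      then have "\<exists>\<^sub>\<infinity>n. \<exists>w. length w = n \<and> 1 \<le> n \<and> T_word A t w (T_word A t u x) \<in> cball p (radius A (\<lambda>n. h n / C) (length w))"
        by (simp only: infinite_words_iff)
      then obtain w where w: "M \<le> length w" "1 \<le> length w"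
        "T_word A t w (T_word A t u x) \<in> cball p (radius A (\<lambda>n. h n / C) (length w))"
        unfolding INFM_nat_le by blast
      have "T_word A t (u @ w) x \<in> X t"
        using w(3) M[OF w(1,2)] \<delta>(2) by (auto simp: T_word_append subset_iff)
      moreover have "T_word A t (u @ w) x \<in> cball p (radius A h (length (u @ w)))"
        using w(3) C(2)[OF w(2) order_refl] by (simp add: T_word_append)
      moreover have "w \<noteq> []" using w(2) by auto
      ultimately show ?thesis unfolding Q_def by blast
    qed
    have "\<exists>u. \<forall>k. T_word A t (u k) x \<in> X t \<and> Q (u k) (u (Suc k))"
    proof (rule dependent_nat_choice)
      show "\<exists>u. T_word A t u x \<in> X t" using x(1) by (intro exI[of _ "[]"]) (simp add: T_word_def)
    qed (rule step)
    then obtain u where u: "\<And>k. Q (u k) (u (Suc k))" by blast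
    have chain: "\<And>k. \<exists>w. w \<noteq> [] \<and> u (Suc k) = u k @ w" using u by (simp add: Q_def)
    let ?j = "\<lambda>n. u n ! (n - 1)"
    have "(\<lambda>k. length (u (Suc k))) ` UNIV \<subseteq> {n. n \<ge> 1 \<and> T_word A t (prefix_word ?j n) x \<in> cball p (radius A h n)}"
    proof clarify
      fix k
      have "T_word A t (u (Suc k)) x \<in> cball p (radius A h (length (u (Suc k))))"
        using u[of k] by (simp add: Q_def)
      moreover obtain w where "w \<noteq> []" "u (Suc k) = u k @ w" using chain by blast
      then have "1 \<le> length (u (Suc k))" by (cases w) auto
      ultimately show "1 \<le> length (u (Suc k)) \<and> T_word A t (prefix_word ?j (length (u (Suc k)))) x
          \<in> cball p (radius A h (length (u (Suc k))))"
        by (simp only: prefix_word_of_chain(1)[where u = u, OF chain])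
    qed
    moreover have "infinite (range (\<lambda>k. length (u (Suc k))))"
    proof (rule range_inj_infinite)
      have "strict_mono (\<lambda>k. length (u (Suc k)))"
        using prefix_word_of_chain(2)[where u = u, OF chain] by (simp add: strict_mono_def)
      then show "inj (\<lambda>k. length (u (Suc k)))" by (rule strict_mono_imp_inj_on)
    qed
    ultimately have "infinite {n. n \<ge> 1 \<and> T_word A t (prefix_word ?j n) x \<in> cball p (radius A h n)}"
      by (rule infinite_super)
    then show ?thesis by blast
  qed
  show ?thesis by (rule AE_I'[OF bad]) (use main in blast)
qed

end

section \<open>Metric theory of the self-affine sets\<close>

theorem theorem2p1:
  fixes A :: "'i::finite \<Rightarrow> real^'d^'d" and D :: "real^'d^'d"
  assumes "\<forall>i. invertible (A i)"
    and "positive_diagonal D"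
    and "\<forall>i. A i = D"
    and "opnorm D < 1/2"
    and "lam A > 1"
  shows
    "(AE t in (lebesgue :: ((real^'d)^'i) measure).
        \<forall>xs. (\<forall>n\<ge>1. xs n \<in> self_affine_set A t) \<longrightarrow>
          (\<forall>h\<in>H_class. emeasure lebesgue (W_set A t xs h) > 0))
     \<and>
     (AE t in (lebesgue :: ((real^'d)^'i) measure).
        \<forall>x\<in>self_affine_set A t. \<forall>h\<in>H_class. decaying_regularly h \<and> decreasing h \<longrightarrow>
          (AE y in lebesgue. y \<in> self_affine_set A t \<longrightarrow> y \<in> W_set A t (\<lambda>_. x) h))
     \<and>
     (\<forall>(U :: ((real^'d)^'i) set) (i :: nat \<Rightarrow> 'i).
        open U \<and>
        (AE t in lebesgue. t \<in> U \<longrightarrow> coding_map A t i \<in> interior (self_affine_set A t)) \<longrightarrow>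
        (AE t in lebesgue. t \<in> U \<longrightarrow>
          (\<forall>h\<in>H_class. decaying_regularly h \<and> decreasing h \<longrightarrow>
            (AE x in lebesgue. x \<in> self_affine_set A t \<longrightarrow>
              x \<in> {x. \<exists>j :: nat \<Rightarrow> 'i. infinite {n. n \<ge> 1 \<and>
                    T_word A t (prefix_word j n) x \<in> cball (coding_map A t i) (radius A h n)}}))))
     \<and>
     (AE t in (lebesgue :: ((real^'d)^'i) measure).
        \<forall>h\<in>H_class. emeasure lebesgue (R_set A t h) > 0)"
proof -
  interpret equal_diagonal_ifs A D
    using assms by unfold_locales auto
  have generic: "AE t in lebesgue. typical t" by (rule AE_completion[OF AE_typical])
  show ?thesis
  proof (intro conjI allI impI)
    show "AE t in lebesgue. \<forall>xs. (\<forall>n\<ge>1. xs n \<in> X t) \<longrightarrow> (\<forall>h\<in>H_class. emeasure lebesgue (W_set A t xs h) > 0)"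
      using generic by eventually_elim (blast intro: W_set_positive)
    show "AE t in lebesgue. \<forall>x\<in>X t. \<forall>h\<in>H_class. decaying_regularly h \<and> decreasing h \<longrightarrow>
          (AE y in lebesgue. y \<in> X t \<longrightarrow> y \<in> W_set A t (\<lambda>_. x) h)"
      using generic
    proof eventually_elim
      case (elim t)
      show ?case
      proof (intro ballI impI)
        fix x h assume "x \<in> X t" "h \<in> H_class" "decaying_regularly h \<and> decreasing h"
        then have "AE y in lborel. y \<in> X t \<longrightarrow> (\<forall>C>0. y \<in> W_set A t (\<lambda>_. x) (\<lambda>n. h n / C))"
          using AE_in_W_sets[OF elim] by blast
        then have "AE y in lborel. y \<in> X t \<longrightarrow> y \<in> W_set A t (\<lambda>_. x) h"
        proof eventually_elim
          case (elim y)
          then show ?case by (auto dest: spec[of _ 1])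
        qed
        then show "AE y in lebesgue. y \<in> X t \<longrightarrow> y \<in> W_set A t (\<lambda>_. x) h" by (rule AE_completion)
      qed
    qed
    show "AE t in lebesgue. \<forall>h\<in>H_class. emeasure lebesgue (R_set A t h) > 0"
      using generic by eventually_elim (blast intro: R_set_positive)
    fix U :: "((real^'d)^'i) set" and i :: "nat \<Rightarrow> 'i"
    assume U: "open U \<and> (AE t in lebesgue. t \<in> U \<longrightarrow> coding_map A t i \<in> interior (X t))"
    show "AE t in lebesgue. t \<in> U \<longrightarrow>
          (\<forall>h\<in>H_class. decaying_regularly h \<and> decreasing h \<longrightarrow>
            (AE x in lebesgue. x \<in> X t \<longrightarrow>
              x \<in> {x. \<exists>j :: nat \<Rightarrow> 'i. infinite {n. n \<ge> 1 \<and>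
                    T_word A t (prefix_word j n) x \<in> cball (coding_map A t i) (radius A h n)}}))"
      using generic conjunct2[OF U]
    proof eventually_elim
      case (elim t)
      show ?case
        unfolding mem_Collect_eq using elim by (intro impI ballI AE_completion AE_branch_hits) auto
    qed
  qed
qed

end
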